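(* Let $-1\leq\beta_1<\beta_2\leq 0$. Then there exists $\phi\in\mathcal O(\mathbb D^3,\mathbb D^3)\cap\mathcal C^1(\overline{\mathbb D}^3)$ such that $C_\phi$ is continuous on $A^2_{\beta_2}(\mathbb D^3)$ and $C_\phi$ is not continuous on $A^2_{\beta_1}(\mathbb D^3)$.
   Context: $\mathbb D$ is the open unit disc, $\mathbb T$ the unit circle, and $\mathcal O(\mathbb D^d,\mathbb D^d)$ is the set of holomorphic maps $\mathbb D^d\to\mathbb D^d$. $\phi\in\mathcal C^k(\overline{\mathbb D}^d)$ means that $\phi$ and its partial derivatives of order at most $k$ extend continuously to $\overline{\mathbb D}^d$. $dA$ is the normalized area measure on $\mathbb D$; for $\beta>-1$, $dA_\beta(z)=(\beta+1)(1-|z|^2)^\beta dA(z)$ and $dV_\beta(z)=dA_\beta(z_1)\cdots dA_\beta(z_d)$ on $\mathbb D^d$. For $\beta>-1$, $A^2_\beta(\mathbb D^d)$ is the space of holomorphic $f:\mathbb D^d\to\mathbb C$ with $\|f\|^2=\int_{\mathbb D^d}|f|^2\,dV_\beta<+\infty$. By convention $A^2_{-1}(\mathbb D^d)=H^2(\mathbb D^d)$, the Hardy space of holomorphic $f:\mathbb D^d\to\mathbb C$ with $\|f\|^2=\sup_{0<r<1}\int_{\mathbb T^d}|f(r\zeta)|^2\,d\sigma_d(\zeta)<+\infty$, $\sigma_d$ being the normalized measure on $\mathbb T^d$. $C_\phi(f)=f\circ\phi$; it is continuous on a space if it is a bounded operator from that space into itself. *)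

theory Defs
  imports "HOL-Analysis.Analysis"
begin

section \<open>Holomorphic functions on the polydisc\<close>

definition polydisc :: "(complex ^ 'n) set" where
  "polydisc = {z. \<forall>i. norm (z $ i) < 1}"

definition closed_polydisc :: "(complex ^ 'n) set" where
  "closed_polydisc = {z. \<forall>i. norm (z $ i) \<le> 1}"

definition torus :: "(complex ^ 'n) set" where
  "torus = {z. \<forall>i. norm (z $ i) = 1}"

text \<open>Holomorphy in several variables: the real Frechet derivative exists and is complex linear.\<close>

definition holomorphic_vec_on :: "(complex ^ 'n \<Rightarrow> complex) \<Rightarrow> (complex ^ 'n) set \<Rightarrow> bool"
    (infixl "holomorphic'_vec'_on" 50) where
  "f holomorphic_vec_on S \<longleftrightarrow>
     (\<forall>z\<in>S. \<exists>f'. (f has_derivative f') (at z within S) \<and> (\<forall>c v. f' (c *s v) = c * f' v))"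

definition polydisc_maps :: "(complex ^ 'n \<Rightarrow> complex ^ 'n) set" where
  "polydisc_maps =
     {\<phi>. (\<forall>i. (\<lambda>z. \<phi> z $ i) holomorphic_vec_on polydisc) \<and> \<phi> ` polydisc \<subseteq> polydisc}"

definition complex_partial :: "'n \<Rightarrow> (complex ^ 'n \<Rightarrow> complex) \<Rightarrow> complex ^ 'n \<Rightarrow> complex" where
  "complex_partial j f z = deriv (\<lambda>w. f (\<chi> i. if i = j then w else z $ i)) (z $ j)"

definition extends_continuously :: "(complex ^ 'n \<Rightarrow> complex) \<Rightarrow> bool" where
  "extends_continuously f \<longleftrightarrow>
     (\<exists>g. continuous_on closed_polydisc g \<and> (\<forall>z\<in>polydisc. g z = f z))"

text \<open>
  The class of functions that are \<open>C\<^sup>k\<close> up to the boundary.  It is meant for functions that are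
  holomorphic on the polydisc, for which the partial derivatives with respect to the conjugate
  variables vanish, so that only the complex partial derivatives have to be considered.
\<close>

primrec Ck_closed_polydisc :: "nat \<Rightarrow> (complex ^ 'n \<Rightarrow> complex) \<Rightarrow> bool" where
  "Ck_closed_polydisc 0 f \<longleftrightarrow> extends_continuously f"
| "Ck_closed_polydisc (Suc k) f \<longleftrightarrow>
     extends_continuously f \<and> (\<forall>j. Ck_closed_polydisc k (complex_partial j f))"

section \<open>Measures\<close>

definition disc_measure :: "real \<Rightarrow> complex measure" where
  "disc_measure \<beta> = density (uniform_measure lborel (ball 0 1))
     (\<lambda>z. ennreal ((\<beta> + 1) * (1 - (norm z)\<^sup>2) powr \<beta>))"

definition circle_measure :: "complex measure" where
  "circle_measure = distr (uniform_measure lborel {0..2 * pi}) borel cis"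

text \<open>
  The product of copies of a measure indexed by \<open>'n\<close> lives on the functions \<open>'n \<Rightarrow> complex\<close>; it is
  transported to \<open>complex ^ 'n\<close>.
\<close>

definition vec_product_measure :: "complex measure \<Rightarrow> (complex ^ 'n) measure" where
  "vec_product_measure M = distr (\<Pi>\<^sub>M i\<in>UNIV. M) borel vec_lambda"

section \<open>Bergman and Hardy spaces, composition operators\<close>

text \<open>
  Functions on the polydisc are represented by total functions with arbitrary values outside of it.
  The measures are concentrated on the polydisc (resp. the torus); the integrals are nevertheless
  restricted explicitly, as an integrand need not be measurable outside these sets.
\<close>

definition bergman_norm_sq :: "real \<Rightarrow> (complex ^ 'n \<Rightarrow> complex) \<Rightarrow> ennreal" where
  "bergman_norm_sq \<beta> f =
     (\<integral>\<^sup>+ z\<in>polydisc. ennreal ((norm (f z))\<^sup>2) \<partial>vec_product_measure (disc_measure \<beta>))"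

definition hardy_norm_sq :: "(complex ^ 'n \<Rightarrow> complex) \<Rightarrow> ennreal" where
  "hardy_norm_sq f =
     (SUP r\<in>{0<..<1}.
        (\<integral>\<^sup>+ \<zeta>\<in>torus. ennreal ((norm (f (r *\<^sub>R \<zeta>)))\<^sup>2) \<partial>vec_product_measure circle_measure))"

definition A2_norm_sq :: "real \<Rightarrow> (complex ^ 'n \<Rightarrow> complex) \<Rightarrow> ennreal" where
  "A2_norm_sq \<beta> f = (if \<beta> = -1 then hardy_norm_sq f else bergman_norm_sq \<beta> f)"

definition A2 :: "real \<Rightarrow> (complex ^ 'n \<Rightarrow> complex) set" where
  "A2 \<beta> = {f. f holomorphic_vec_on polydisc \<and> A2_norm_sq \<beta> f < \<infinity>}"

definition A2_norm :: "real \<Rightarrow> (complex ^ 'n \<Rightarrow> complex) \<Rightarrow> real" where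
  "A2_norm \<beta> f = sqrt (enn2real (A2_norm_sq \<beta> f))"

definition comp_op :: "(complex ^ 'n \<Rightarrow> complex ^ 'n) \<Rightarrow> (complex ^ 'n \<Rightarrow> complex) \<Rightarrow> complex ^ 'n \<Rightarrow> complex" where
  "comp_op \<phi> f = f \<circ> \<phi>"

definition comp_op_continuous :: "real \<Rightarrow> (complex ^ 'n \<Rightarrow> complex ^ 'n) \<Rightarrow> bool" where
  "comp_op_continuous \<beta> \<phi> \<longleftrightarrow>
     comp_op \<phi> ` A2 \<beta> \<subseteq> A2 \<beta> \<and>
     (\<exists>C. \<forall>f\<in>A2 \<beta>. A2_norm \<beta> (comp_op \<phi> f) \<le> C * A2_norm \<beta> f)"

end

theory Submission
  imports Defs "HOL-Complex_Analysis.Complex_Analysis" "HOL-Probability.Probability_Measure"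
    "HOL-Real_Asymp.Real_Asymp"
begin

text \<open>
  Choose \<open>- \<beta>\<^sub>2 < 1 / p < 1 / p' < - \<beta>\<^sub>1\<close> and a holomorphic \<open>U\<close> on the disc with \<open>Re U \<ge> 0\<close>, of class \<open>C\<^sup>1\<close> up to
  the circle, such that on the circle \<open>Re U(\<zeta>)\<close> lies between multiples of \<open>\<bar>\<zeta> - 1\<bar> powr p\<close> and
  \<open>\<bar>\<zeta> - 1\<bar> powr p'\<close>.  The map is \<open>(\<psi>, \<psi>, 0)\<close> with \<open>\<psi>(z) = z\<^sub>1 exp (- U(z\<^sub>1)) z\<^sub>2 z\<^sub>3\<close>.

  If \<open>\<psi>(z)\<close> is at distance \<open>\<delta>\<close> from a point of the circle, then \<open>1 - \<bar>z\<^sub>i\<bar>\<close> is \<open>O(\<delta>)\<close> for the three coordinates,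
  which has measure \<open>\<delta> powr (3 (\<beta> + 1))\<close>; the argument of \<open>z\<^sub>3\<close> is determined up to \<open>O(\<delta>)\<close>, and \<open>z\<^sub>1\<close> lies in
  a sector of opening \<open>\<delta> powr (1 / p)\<close>.  The total exponent \<open>3 (\<beta> + 1) + 1 + 1 / p\<close> has to be compared with the
  exponent \<open>2 (\<beta> + 2)\<close> of a Carleson box in the first two coordinates, so the threshold is \<open>\<beta> = - 1 / p\<close>.
  Above it the operator is bounded because of the sub-mean value property of \<open>\<bar>f\<bar>\<^sup>2\<close>; below it, it is unbounded on
  the polynomials \<open>\<Sum>i=N..2N. w\<^sub>1\<^bsup>3N-i\<^esup> w\<^sub>2\<^bsup>i\<^esup>\<close>.
\<close>

text \<open>The number of variables is forced by the count of exponents. With two variables and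
  \<open>z\<^sub>1 exp (- U(z\<^sub>1)) z\<^sub>2\<close>, two radial depths would face the two of
  the Carleson box, \<beta> would cancel, and the condition would be 1/p \<ge> 1 for every \<beta>.
  The extra factor adds a radial depth on one side only and leaves 1/p \<ge> -\<beta>.

  The smoothness of U asks for p > 1: a lacunary term of frequency 2^k and size 2^(-kp) stays
  summable after one differentiation precisely then. Since 1/p is taken strictly between
  \<open>- \<beta>\<^sub>2\<close> and \<open>- \<beta>\<^sub>1\<close>, this is no restriction. The
  strict gap also makes a sharp order of contact unnecessary: two exponents p' < p turn the upper
  estimate into a geometric series.

  As \<open>\<beta>\<^sub>2 > - 1\<close>, boundedness concerns Bergman spaces only; the Hardy space
  occurs only on the unbounded side, with tail exponent 0.

  On the diagonal the N+1 monomials of the test polynomial coincide and add up, while its norm sees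
  an orthogonal sum. This gains a factor of order N in the quotient of squared norms, against a loss
  of N^(-(\<beta>+1) - 1/p').\<close>

no_notation fps_nth (infixl \<open>$\<close> 75)

subsection \<open>Rotation invariance and arcs of the circle\<close>

text \<open>Agreement on boxes determines Lebesgue measure. The point is to have Tonelli in real and
  imaginary parts, on which the shears below rest.\<close>

lemma lborel_complex:
  "(lborel :: complex measure) = distr (lborel \<Otimes>\<^sub>M lborel) borel (\<lambda>(x, y). Complex x y)"
proof (rule lborel_eqI)
  fix l u :: complex
  assume "\<And>b. b \<in> Basis \<Longrightarrow> l \<bullet> b \<le> u \<bullet> b"
  from this[of 1] this[of \<i>] have le: "Re l \<le> Re u" "Im l \<le> Im u"
    by (auto simp: Basis_complex_def)
  have m: "(\<lambda>(x, y). Complex x y) \<in> (lborel \<Otimes>\<^sub>M lborel) \<rightarrow>\<^sub>M (borel :: complex measure)"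
    by (simp add: borel_prod split_beta' Complex_eq)
  have "emeasure (distr (lborel \<Otimes>\<^sub>M lborel) borel (\<lambda>(x, y). Complex x y)) (box l u)
      = emeasure (lborel \<Otimes>\<^sub>M lborel) ({Re l<..<Re u} \<times> {Im l<..<Im u})"
    by (subst emeasure_distr[OF m])
       (auto intro!: arg_cong[where f="emeasure _"] simp: box_complex_eq space_pair_measure)
  also have "\<dots> = ennreal ((Re u - Re l) * (Im u - Im l))"
    using le by (simp add: lborel.emeasure_pair_measure_Times ennreal_mult)
  also have "(Re u - Re l) * (Im u - Im l) = (\<Prod>b\<in>Basis. (u - l) \<bullet> b)"
    by (simp add: Basis_complex_def)
  finally show "emeasure (distr (lborel \<Otimes>\<^sub>M lborel) borel (\<lambda>(x, y). Complex x y)) (box l u)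
     = ennreal (\<Prod>b\<in>Basis. (u - l) \<bullet> b)" .
qed simp

lemma nn_integral_complex:
  assumes [measurable]: "f \<in> borel_measurable (borel :: complex measure)"
  shows "(\<integral>\<^sup>+z. f z \<partial>lborel) = (\<integral>\<^sup>+x. \<integral>\<^sup>+y. f (Complex x y) \<partial>lborel \<partial>lborel)"
proof -
  have m: "(\<lambda>(x, y). Complex x y) \<in> (lborel \<Otimes>\<^sub>M lborel) \<rightarrow>\<^sub>M (borel :: complex measure)"
    by (simp add: borel_prod split_beta' Complex_eq)
  note [measurable] = m
  have "(\<integral>\<^sup>+z. f z \<partial>lborel) = (\<integral>\<^sup>+p. f (case p of (x, y) \<Rightarrow> Complex x y) \<partial>(lborel \<Otimes>\<^sub>M lborel))"
    by (subst lborel_complex, subst nn_integral_distr[OF m]) auto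
  also have "\<dots> = (\<integral>\<^sup>+x. \<integral>\<^sup>+y. f (Complex x y) \<partial>lborel \<partial>lborel)"
    by (subst lborel.nn_integral_fst[symmetric]) auto
  finally show ?thesis .
qed

lemma nn_integral_lborel_shift:
  fixes f :: "real \<Rightarrow> ennreal"
  assumes "f \<in> borel_measurable borel"
  shows "(\<integral>\<^sup>+x. f (x + c) \<partial>lborel) = (\<integral>\<^sup>+x. f x \<partial>lborel)"
  using nn_integral_real_affine[OF assms, of 1 c] by (simp add: add.commute)

lemma borel_Complex [measurable]:
  "f \<in> borel_measurable M \<Longrightarrow> g \<in> borel_measurable M \<Longrightarrow> (\<lambda>x. Complex (f x) (g x)) \<in> borel_measurable M"
  by (simp add: Complex_eq)

lemma nn_integral_complex':
  assumes [measurable]: "f \<in> borel_measurable (borel :: complex measure)"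
  shows "(\<integral>\<^sup>+z. f z \<partial>lborel) = (\<integral>\<^sup>+y. \<integral>\<^sup>+x. f (Complex x y) \<partial>lborel \<partial>lborel)"
  unfolding nn_integral_complex[OF assms] 
  by (rule lborel_pair.Fubini'[symmetric]) measurable

text \<open>For fixed imaginary part the shear is a translation of the real part, so one-dimensional
  translation invariance suffices.\<close>

lemma nn_integral_shear_Re:
  assumes [measurable]: "f \<in> borel_measurable (borel :: complex measure)"
  shows "(\<integral>\<^sup>+z. f (Complex (Re z + a * Im z) (Im z)) \<partial>lborel) = (\<integral>\<^sup>+z. f z \<partial>lborel)"
  by (subst (1 2) nn_integral_complex', simp_all)
     (intro nn_integral_cong nn_integral_lborel_shift[of "\<lambda>x. f (Complex x _)"], measurable)

lemma nn_integral_shear_Im: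
  assumes [measurable]: "f \<in> borel_measurable (borel :: complex measure)"
  shows "(\<integral>\<^sup>+z. f (Complex (Re z) (Im z + a * Re z)) \<partial>lborel) = (\<integral>\<^sup>+z. f z \<partial>lborel)"
  by (subst (1 2) nn_integral_complex, simp_all)
     (intro nn_integral_cong nn_integral_lborel_shift[of "\<lambda>x. f (Complex _ x)"], measurable)

text \<open>A rotation whose angle is not a multiple of \<open>\<pi>\<close> is a product of three shears.\<close>

lemma nn_integral_rotate_lborel:
  assumes [measurable]: "f \<in> borel_measurable (borel :: complex measure)" and \<zeta>: "norm \<zeta> = 1"
  shows "(\<integral>\<^sup>+z. f (\<zeta> * z) \<partial>lborel) = (\<integral>\<^sup>+z. f z \<partial>lborel)"
proof -
  have *: "(\<integral>\<^sup>+z. g (\<zeta> * z) \<partial>lborel) = (\<integral>\<^sup>+z. g z \<partial>lborel)"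
    if "norm \<zeta> = 1" "Im \<zeta> \<noteq> 0" and [measurable]: "g \<in> borel_measurable (borel :: complex measure)" for \<zeta> g
  proof -
    define c where "c = Re \<zeta>"
    define s where "s = Im \<zeta>"
    \<comment> \<open>For \<zeta> = cis \<theta> this is -tan(\<theta>/2), the coefficient of the
      two outer shears; the inner one has coefficient sin \<theta>.\<close>
    define a where "a = (c - 1) / s"
    have s: "s \<noteq> 0" and cs: "c * c + s * s = 1"
      using that(1,2) by (auto simp: c_def s_def cmod_def power2_eq_square)
    have as: "a * s = c - 1" using s by (simp add: a_def)
    have a2: "2 * a + s * (a * a) = - s"
    proof -
      have "s * (2 * a + s * (a * a)) = 2 * (a * s) + (a * s) * (a * s)" by (simp add: algebra_simps)
      also have "\<dots> = s * (- s)" unfolding as using cs by (simp add: algebra_simps)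
      finally show ?thesis using s by (metis mult_left_cancel)
    qed
    define X where "X = (\<lambda>z. Complex (Re z + a * Im z) (Im z))"
    define Y where "Y = (\<lambda>z. Complex (Re z) (Im z + s * Re z))"
    have [measurable]: "X \<in> borel \<rightarrow>\<^sub>M borel" "Y \<in> borel \<rightarrow>\<^sub>M borel"
      unfolding X_def Y_def by measurable
    have eq: "X (Y (X z)) = \<zeta> * z" for z
    proof -
      have "Re (X (Y (X z))) = (1 + a * s) * Re z + (2 * a + s * (a * a)) * Im z"
        by (simp add: X_def Y_def algebra_simps)
      moreover have "Im (X (Y (X z))) = s * Re z + (1 + a * s) * Im z"
        by (simp add: X_def Y_def algebra_simps)
      ultimately show ?thesis
        by (simp add: as a2 complex_eq_iff) (simp add: c_def s_def)
    qed
    have "(\<integral>\<^sup>+z. g (\<zeta> * z) \<partial>lborel) = (\<integral>\<^sup>+z. g (X (Y (X z))) \<partial>lborel)" by (simp add: eq)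
    also have "\<dots> = (\<integral>\<^sup>+z. g (X (Y z)) \<partial>lborel)"
      using nn_integral_shear_Re[of "\<lambda>z. g (X (Y z))" a] by (simp add: X_def)
    also have "\<dots> = (\<integral>\<^sup>+z. g (X z) \<partial>lborel)"
      using nn_integral_shear_Im[of "\<lambda>z. g (X z)" s] by (simp add: Y_def)
    also have "\<dots> = (\<integral>\<^sup>+z. g z \<partial>lborel)"
      using nn_integral_shear_Re[of g a] by (simp add: X_def)
    finally show ?thesis .
  qed
  show ?thesis
  proof (cases "Im \<zeta> = 0")
    case False
    then show ?thesis using *[OF \<zeta>] by simp
  next
    case True
    then have "Re \<zeta> = 1 \<or> Re \<zeta> = - 1"
      using \<zeta> by (auto simp: cmod_def abs_if split: if_splits)
    then have "\<zeta> = 1 \<or> \<zeta> = - 1" using True by (auto simp: complex_eq_iff)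
    \<comment> \<open>The half turn has s = 0 and escapes the shears, but it is two quarter
      turns.\<close>
    moreover have "(\<integral>\<^sup>+z. f (- 1 * z) \<partial>lborel) = (\<integral>\<^sup>+z. f z \<partial>lborel)"
    proof -
      have "(\<integral>\<^sup>+z. f (- 1 * z) \<partial>lborel) = (\<integral>\<^sup>+z. f (\<i> * (\<i> * z)) \<partial>lborel)"
        by (simp add: mult.assoc[symmetric])
      also have "\<dots> = (\<integral>\<^sup>+z. f z \<partial>lborel)"
        using *[of \<i> "\<lambda>z. f (\<i> * z)"] *[of \<i> f] by simp
      finally show ?thesis .
    qed
    ultimately show ?thesis by auto
  qed
qed

section \<open>Integration and arcs on the unit circle\<close>

lemma measurable_cis [measurable]: "cis \<in> borel_measurable borel"
  by (simp add: borel_measurable_continuous_onI continuous_on_cis)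

lemma nn_integral_circle:
  assumes [measurable]: "f \<in> borel_measurable (borel :: complex measure)"
  shows "(\<integral>\<^sup>+\<zeta>. f \<zeta> \<partial>circle_measure) = (\<integral>\<^sup>+t\<in>{0..2*pi}. f (cis t) \<partial>lborel) / ennreal (2 * pi)"
  unfolding circle_measure_def
  by (subst nn_integral_distr) (auto simp: nn_integral_uniform_measure)

lemma nn_integral_rotate_circle:
  assumes [measurable]: "f \<in> borel_measurable (borel :: complex measure)" and \<zeta>: "norm \<zeta> = 1"
  shows "(\<integral>\<^sup>+z. f (\<zeta> * z) \<partial>circle_measure) = (\<integral>\<^sup>+z. f z \<partial>circle_measure)"
proof -
  define b where "b = Arg2pi \<zeta>"
  have b: "0 \<le> b" "b < 2 * pi" and zb: "\<zeta> = cis b"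
    using Arg2pi[of \<zeta>] \<zeta> by (auto simp: b_def cis_conv_exp is_Arg_def)
  define g where "g t = f (cis t)" for t
  have [measurable]: "g \<in> borel_measurable borel" unfolding g_def by measurable
  have per: "g (t + 2 * pi) = g t" for t
  proof -
    have "cis (t + 2 * pi) = cis t" by (simp add: complex_eq_iff)
    then show ?thesis by (simp add: g_def)
  qed
  have "(\<integral>\<^sup>+t\<in>{0..2*pi}. f (\<zeta> * cis t) \<partial>lborel) = (\<integral>\<^sup>+t. g (t + b) * indicator {b..b + 2*pi} (t + b) \<partial>lborel)"
    by (intro nn_integral_cong) (auto simp: g_def zb cis_mult add.commute split: split_indicator)
  also have "\<dots> = (\<integral>\<^sup>+t. g t * indicator {b..b + 2*pi} t \<partial>lborel)"
    by (subst nn_integral_lborel_shift[of "\<lambda>t. g t * indicator {b..b + 2*pi} t"]) auto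
  also have "\<dots> = (\<integral>\<^sup>+t. g t * indicator {b..2*pi} t + g t * indicator {2*pi<..b + 2*pi} t \<partial>lborel)"
    using b by (intro nn_integral_cong) (auto split: split_indicator)
  also have "\<dots> = (\<integral>\<^sup>+t. g t * indicator {b..2*pi} t \<partial>lborel) + (\<integral>\<^sup>+t. g t * indicator {2*pi<..b + 2*pi} t \<partial>lborel)"
    by (intro nn_integral_add) auto
  also have "(\<integral>\<^sup>+t. g t * indicator {2*pi<..b + 2*pi} t \<partial>lborel)
    = (\<integral>\<^sup>+t. g (t + 2*pi) * indicator {2*pi<..b + 2*pi} (t + 2*pi) \<partial>lborel)"
    by (subst nn_integral_lborel_shift[of "\<lambda>t. g t * indicator {2*pi<..b + 2*pi} t"]) auto
  also have "\<dots> = (\<integral>\<^sup>+t. g t * indicator {0<..b} t \<partial>lborel)"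
    unfolding per by (intro nn_integral_cong) (auto split: split_indicator)
  also have "(\<integral>\<^sup>+t. g t * indicator {b..2*pi} t \<partial>lborel) + \<dots>
     = (\<integral>\<^sup>+t. g t * indicator {b..2*pi} t + g t * indicator {0<..b} t \<partial>lborel)"
    by (intro nn_integral_add[symmetric]) auto
  also have "\<dots> = (\<integral>\<^sup>+t\<in>{0..2*pi}. g t \<partial>lborel)"
  \<comment> \<open>The two pieces may count b twice and miss 0; both points are null.\<close>
  proof (rule nn_integral_cong_AE)
    show "AE t in lborel. g t * indicator {b..2*pi} t + g t * indicator {0<..b} t = g t * indicator {0..2*pi} t"
      using AE_lborel_singleton[of 0] AE_lborel_singleton[of b]
      by eventually_elim (use b in \<open>auto split: split_indicator\<close>)
  qed
  finally show ?thesis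
    by (subst (1 2) nn_integral_circle) (auto simp: g_def)
qed

lemma prob_space_circle: "prob_space circle_measure"
  unfolding circle_measure_def
  by (rule prob_space.prob_space_distr, rule prob_space_uniform_measure) auto

lemma sets_circle [measurable_cong, simp]: "sets circle_measure = sets borel"
  by (simp add: circle_measure_def)

lemma AE_circle: "AE z in circle_measure. norm z = 1"
  unfolding circle_measure_def by (subst AE_distr_iff) auto

lemma norm_cis_minus_1: "norm (cis t - 1) = 2 * \<bar>sin (t / 2)\<bar>"
proof -
  have "(norm (cis t - 1))\<^sup>2 = (cos t - 1)\<^sup>2 + (sin t)\<^sup>2" by (simp add: cmod_power2)
  also have "\<dots> = 2 - 2 * cos t"
    using sin_cos_squared_add[of t] by (simp add: power2_eq_square algebra_simps)
  also have "\<dots> = (2 * \<bar>sin (t / 2)\<bar>)\<^sup>2"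
    using cos_double_sin[of "t/2"] by (simp add: power2_eq_square)
  finally show ?thesis by (rule power2_eq_imp_eq) auto
qed

text \<open>A weak Jordan inequality. With y = x/2, sin x = 2 sin y cos y, sin y \<ge> y cos y, and
  (cos y)^2 = (1 + cos x)/2 \<ge> 1/2; the last bound is the source of the factor 1/2.\<close>

lemma sin_ge_half:
  assumes "0 \<le> x" "x \<le> pi / 2"
  shows "x / 2 \<le> sin (x :: real)"
proof -
  define y where "y = x / 2"
  have y: "0 \<le> y" "y \<le> pi / 4" using assms by (auto simp: y_def)
  have "sin 0 - 0 * cos 0 \<le> sin y - y * cos y"
  proof (rule DERIV_nonneg_imp_nondecreasing[OF y(1)])
    fix t assume t: "0 \<le> t" "t \<le> y"
    have "((\<lambda>t. sin t - t * cos t) has_real_derivative t * sin t) (at t)"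
      by (auto intro!: derivative_eq_intros)
    moreover have "0 \<le> t * sin t" using t y by (intro mult_nonneg_nonneg sin_ge_zero) auto
    ultimately show "\<exists>d. ((\<lambda>t. sin t - t * cos t) has_real_derivative d) (at t) \<and> 0 \<le> d" by blast
  qed
  then have "y * cos y \<le> sin y" by simp
  moreover have "0 \<le> cos y" using y by (intro cos_ge_zero) auto
  ultimately have "2 * (y * cos y) * cos y \<le> 2 * sin y * cos y"
    by (intro mult_right_mono) auto
  also have "\<dots> = sin x" using sin_double[of y] by (simp add: y_def)
  finally have 1: "x * (cos y)\<^sup>2 \<le> sin x" by (simp add: y_def power2_eq_square mult_ac)
  have "0 \<le> cos x" using assms by (intro cos_ge_zero) auto
  then have "1 / 2 \<le> (cos y)\<^sup>2" using cos_double_cos[of y] by (simp add: y_def)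
  then have "x * (1 / 2) \<le> x * (cos y)\<^sup>2" using assms by (intro mult_left_mono) auto
  with 1 show ?thesis by simp
qed

lemma norm_cis_minus_1_ge:
  assumes "\<bar>t\<bar> \<le> pi"
  shows "\<bar>t\<bar> / 2 \<le> norm (cis t - 1)"
proof -
  have "\<bar>t\<bar> / 2 / 2 \<le> sin (\<bar>t\<bar> / 2)" by (rule sin_ge_half) (use assms in auto)
  then show ?thesis
    unfolding norm_cis_minus_1 by (cases "t \<ge> 0") auto
qed

lemma norm_cis_minus_1_le: "norm (cis t - 1) \<le> \<bar>t\<bar>"
  unfolding norm_cis_minus_1 using abs_sin_le_one abs_sin_x_le_abs_x[of "t/2"] by simp

lemma emeasure_circle_cball_le:
  assumes "0 \<le> \<rho>"
  shows "emeasure circle_measure (cball 1 \<rho>) \<le> ennreal \<rho>"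
proof -
  have "emeasure circle_measure (cball 1 \<rho>) = (\<integral>\<^sup>+z. indicator (cball 1 \<rho>) z \<partial>circle_measure)"
    by (intro nn_integral_indicator[symmetric]) auto
  also have "\<dots> = (\<integral>\<^sup>+t\<in>{0..2*pi}. indicator (cball 1 \<rho>) (cis t) \<partial>lborel) / ennreal (2 * pi)"
    by (rule nn_integral_circle) (auto intro: borel_measurable_indicator)
  also have "(\<integral>\<^sup>+t\<in>{0..2*pi}. indicator (cball 1 \<rho>) (cis t) \<partial>lborel)
     \<le> (\<integral>\<^sup>+t. indicator {0..2*\<rho>} t + indicator {2*pi-2*\<rho>..2*pi} t \<partial>lborel)"
  \<comment> \<open>The parametrisation by [0, 2 pi] breaks at the centre of the arc, which
    therefore shows up as one interval at each end.\<close>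
  proof (rule nn_integral_mono)
    fix t :: real
    show "indicator (cball 1 \<rho>) (cis t) * indicator {0..2*pi} t
       \<le> (indicator {0..2*\<rho>} t + indicator {2*pi-2*\<rho>..2*pi} t :: ennreal)"
    proof (cases "t \<in> {0..2*pi} \<and> cis t \<in> cball 1 \<rho>")
      case True
      then have n: "norm (cis t - 1) \<le> \<rho>" by (simp add: dist_norm norm_minus_commute)
      have "cis (t - 2*pi) = cis t" by (simp add: complex_eq_iff cos_diff sin_diff)
      then have "t \<le> 2 * \<rho> \<or> 2*pi - t \<le> 2 * \<rho>"
        using norm_cis_minus_1_ge[of t] norm_cis_minus_1_ge[of "t - 2*pi"] n True
        by (cases "t \<le> pi") auto
      then show ?thesis using True by (auto split: split_indicator)
    qed (auto split: split_indicator)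
  qed
  also have "\<dots> = ennreal (4 * \<rho>)"
    using assms by (subst nn_integral_add) (auto simp flip: ennreal_plus)
  also have "ennreal (4 * \<rho>) / ennreal (2 * pi) \<le> ennreal \<rho>"
  proof -
    have "4 * \<rho> / (2 * pi) \<le> \<rho>" using assms pi_ge_two by (simp add: field_simps)
      (metis mult_left_mono mult.commute)
    then show ?thesis using assms by (subst divide_ennreal) (auto intro!: ennreal_leI)
  qed
  finally show ?thesis by (simp add: divide_right_mono_ennreal)
qed

lemma emeasure_circle_cball_ge:
  assumes "0 \<le> \<rho>" "\<rho> \<le> 1"
  shows "ennreal (\<rho> / (2 * pi)) \<le> emeasure circle_measure (cball 1 \<rho>)"
proof -
  have "ennreal (\<rho> / (2 * pi)) = (\<integral>\<^sup>+t. indicator {0..\<rho>} t \<partial>lborel) / ennreal (2 * pi)"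
    using assms by (simp add: divide_ennreal)
  also have "\<dots> \<le> (\<integral>\<^sup>+t\<in>{0..2*pi}. indicator (cball 1 \<rho>) (cis t) \<partial>lborel) / ennreal (2 * pi)"
  proof (intro divide_right_mono_ennreal nn_integral_mono)
    fix t :: real
    show "(indicator {0..\<rho>} t :: ennreal) \<le> indicator (cball 1 \<rho>) (cis t) * indicator {0..2*pi} t"
      using norm_cis_minus_1_le[of t] assms pi_ge_two
      by (auto split: split_indicator simp: dist_norm norm_minus_commute)
  qed
  also have "\<dots> = (\<integral>\<^sup>+z. indicator (cball 1 \<rho>) z \<partial>circle_measure)"
    by (rule nn_integral_circle[symmetric]) (auto intro: borel_measurable_indicator)
  also have "\<dots> = emeasure circle_measure (cball 1 \<rho>)"
    by (intro nn_integral_indicator) auto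
  finally show ?thesis .
qed

section \<open>Mean values and orthogonality on the circle\<close>

lemma circle_mean_value:
  assumes "G holomorphic_on S" "open S" "cball 0 1 \<subseteq> S"
  shows "((\<lambda>t. G (cis t)) has_integral 2 * of_real pi * G 0) {0..2*pi}"
proof -
  have "((\<lambda>u. G u / (u - 0)) has_contour_integral 2 * of_real pi * \<i> * G 0) (circlepath 0 1)"
    by (rule Cauchy_integral_circlepath_simple) (use assms in \<open>auto intro: holomorphic_on_subset\<close>)
  then have "((\<lambda>t. G (cis t) / cis t * \<i> * cis t) has_integral 2 * of_real pi * \<i> * G 0) {0..2*pi}"
    unfolding circlepath_def by (subst (asm) has_contour_integral_part_circlepath_iff) auto
  then have "((\<lambda>t. G (cis t) * \<i>) has_integral 2 * of_real pi * \<i> * G 0) {0..2*pi}"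
    by simp
  then have "((\<lambda>t. G (cis t) * \<i> * (- \<i>)) has_integral 2 * of_real pi * \<i> * G 0 * (- \<i>)) {0..2*pi}"
    by (rule has_integral_mult_left)
  moreover have "G (cis t) * \<i> * (- \<i>) = G (cis t)" for t by (simp add: mult.assoc)
  moreover have "a * \<i> * b * (- \<i>) = a * b" for a b
    by (simp add: mult.assoc[symmetric]) (simp add: mult_ac)
  ultimately show ?thesis by (simp only:)
qed

lemma nn_integral_circle_has_integral:
  assumes [measurable]: "f \<in> borel_measurable borel"
    and "\<And>\<zeta>. norm \<zeta> = 1 \<Longrightarrow> f \<zeta> = ennreal (g \<zeta>)" and "\<And>\<zeta>. norm \<zeta> = 1 \<Longrightarrow> 0 \<le> g \<zeta>"
    and "((\<lambda>t. g (cis t)) has_integral I) {0..2*pi}"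
  shows "(\<integral>\<^sup>+\<zeta>. f \<zeta> \<partial>circle_measure) = ennreal (I / (2 * pi))"
proof -
  have I: "0 \<le> I" by (rule has_integral_nonneg[OF assms(4)]) (use assms(3) in auto)
  have "(\<integral>\<^sup>+t\<in>{0..2*pi}. f (cis t) \<partial>lborel) = (\<integral>\<^sup>+t. ennreal (g (cis t)) * indicator {0..2*pi} t \<partial>lborel)"
    by (intro nn_integral_cong) (auto simp: assms(2))
  also have "\<dots> = ennreal I"
    by (rule nn_integral_has_integral_lebesgue') (use assms(3,4) in auto)
  finally show ?thesis
    using I by (simp add: nn_integral_circle divide_ennreal)
qed

text \<open>The mean value property is applied to \<open>G\<^sup>2\<close>, which makes Cauchy--Schwarz unnecessary.\<close>

lemma circle_submean:
  assumes G: "G holomorphic_on S" "open S" "cball 0 1 \<subseteq> S"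
    and f: "f \<in> borel_measurable borel" "\<And>\<zeta>. norm \<zeta> = 1 \<Longrightarrow> f \<zeta> = ennreal ((norm (G \<zeta>))\<^sup>2)"
  shows "ennreal ((norm (G 0))\<^sup>2) \<le> (\<integral>\<^sup>+\<zeta>. f \<zeta> \<partial>circle_measure)"
proof -
  have "(\<lambda>z. (G z)\<^sup>2) holomorphic_on S" using G(1) by (intro holomorphic_intros)
  from circle_mean_value[OF this G(2,3)]
  have hi: "((\<lambda>t. (G (cis t))\<^sup>2) has_integral 2 * of_real pi * (G 0)\<^sup>2) {0..2*pi}" .
  have "continuous_on {0..2*pi} (\<lambda>t. G (cis t))"
    by (rule continuous_on_compose2[OF holomorphic_on_imp_continuous_on[OF G(1)]])
       (use G(3) in \<open>auto intro: continuous_intros\<close>)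
  then have "(\<lambda>t. (norm (G (cis t)))\<^sup>2) integrable_on {0..2*pi}"
    by (intro integrable_continuous_real continuous_intros)
  then obtain I where I: "((\<lambda>t. (norm (G (cis t)))\<^sup>2) has_integral I) {0..2*pi}"
    by (auto simp: integrable_on_def)
  have "norm (integral {0..2*pi} (\<lambda>t. (G (cis t))\<^sup>2)) \<le> integral {0..2*pi} (\<lambda>t. (norm (G (cis t)))\<^sup>2)"
    by (rule integral_norm_bound_integral) (use hi I in \<open>auto simp: norm_power\<close>)
  also have "integral {0..2*pi} (\<lambda>t. (G (cis t))\<^sup>2) = 2 * of_real pi * (G 0)\<^sup>2"
    using hi by (rule integral_unique)
  also have "integral {0..2*pi} (\<lambda>t. (norm (G (cis t)))\<^sup>2) = I"
    using I by (rule integral_unique)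
  finally have "(norm (G 0))\<^sup>2 \<le> I / (2 * pi)"
    by (simp add: norm_mult norm_power field_simps)
  also have "ennreal (I / (2 * pi)) = (\<integral>\<^sup>+\<zeta>. f \<zeta> \<partial>circle_measure)"
    by (rule nn_integral_circle_has_integral[OF f _ I, symmetric]) auto
  finally show ?thesis by (simp add: ennreal_leI)
qed

text \<open>For j > k the integrand is a positive power of cis t, and the mean value property gives
  the value at 0; j < k follows by conjugation.\<close>

lemma has_integral_cis_powers:
  "((\<lambda>t. cis t ^ j * cnj (cis t ^ k)) has_integral (if j = k then 2 * of_real pi else 0)) {0..2*pi}"
proof -
  have pos: "((\<lambda>t. cis t ^ n) has_integral 0) {0..2*pi}" if "n > 0" for n
  proof -
    have "(\<lambda>z::complex. z ^ n) holomorphic_on UNIV" by (intro holomorphic_intros)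
    from circle_mean_value[OF this open_UNIV subset_UNIV]
    have "((\<lambda>t. cis t ^ n) has_integral 2 * of_real pi * 0 ^ n) {0..2*pi}" .
    then show ?thesis using zero_power[OF that, where ?'a=complex] by (simp only: mult_zero_right)
  qed
  have mul: "cis t ^ n * cnj (cis t ^ n) = 1" for t n
    by (simp add: complex_norm_square[symmetric] norm_power del: complex_cnj_power)
  consider "j = k" | "j > k" | "j < k" by linarith
  then show ?thesis
  proof cases
    case 1
    have "((\<lambda>t::real. 1 :: complex) has_integral (2 * pi - 0) *\<^sub>R 1) {0..2*pi}"
      using has_integral_const_real[of "1::complex" 0 "2*pi"] by simp
    then show ?thesis unfolding 1 mul by (simp add: scaleR_conv_of_real)
  next
    case 2
    then have "cis t ^ j = cis t ^ (j - k) * cis t ^ k" for t by (simp flip: power_add)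
    then have "cis t ^ j * cnj (cis t ^ k) = cis t ^ (j - k)" for t
      by (simp add: mul mult.assoc del: complex_cnj_power)
    then show ?thesis using pos[of "j - k"] 2 by simp
  next
    case 3
    then have "cis t ^ k = cis t ^ (k - j) * cis t ^ j" for t by (simp flip: power_add)
    then have "cis t ^ j * cnj (cis t ^ k) = cnj (cis t ^ (k - j)) * (cis t ^ j * cnj (cis t ^ j))" for t
      by (simp add: mult_ac)
    then have "cis t ^ j * cnj (cis t ^ k) = cnj (cis t ^ (k - j))" for t
      by (simp add: mul del: complex_cnj_power)
    moreover have "((\<lambda>t. cnj (cis t ^ (k - j))) has_integral cnj 0) {0..2*pi}"
      using iffD2[OF has_integral_cnj pos[of "k - j"]] 3 by (simp add: comp_def)
    ultimately show ?thesis using 3 by (simp del: complex_cnj_power)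
  qed
qed

lemma circle_parseval:
  assumes "finite J"
  shows "(\<integral>\<^sup>+\<zeta>. ennreal ((norm (\<Sum>j\<in>J. d j * \<zeta> ^ j))\<^sup>2) \<partial>circle_measure)
       = ennreal (\<Sum>j\<in>J. (norm (d j))\<^sup>2)"
proof -
  let ?F = "\<lambda>\<zeta>. (\<Sum>j\<in>J. d j * \<zeta> ^ j)"
  have eq: "?F \<zeta> * cnj (?F \<zeta>) = (\<Sum>j\<in>J. \<Sum>k\<in>J. d j * cnj (d k) * (\<zeta> ^ j * cnj (\<zeta> ^ k)))" for \<zeta>
    by (simp add: sum_product mult_ac)
  have "((\<lambda>t. \<Sum>j\<in>J. \<Sum>k\<in>J. d j * cnj (d k) * (cis t ^ j * cnj (cis t ^ k)))
     has_integral (\<Sum>j\<in>J. \<Sum>k\<in>J. d j * cnj (d k) * (if j = k then 2 * of_real pi else 0))) {0..2*pi}"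
    by (intro has_integral_sum assms has_integral_mult_right has_integral_cis_powers)
  also have "(\<Sum>j\<in>J. \<Sum>k\<in>J. d j * cnj (d k) * (if j = k then 2 * of_real pi else 0))
     = (\<Sum>j\<in>J. 2 * of_real pi * of_real ((norm (d j))\<^sup>2))"
  proof (rule sum.cong[OF refl])
    fix j assume j: "j \<in> J"
    have "(\<Sum>k\<in>J. d j * cnj (d k) * (if j = k then 2 * of_real pi else 0))
        = (\<Sum>k\<in>J. if j = k then d j * cnj (d j) * (2 * of_real pi) else 0)"
      by (intro sum.cong) auto
    also have "\<dots> = d j * cnj (d j) * (2 * of_real pi)"
      using assms j by (simp add: sum.delta)
    also have "\<dots> = 2 * of_real pi * of_real ((norm (d j))\<^sup>2)"
      unfolding complex_norm_square by (rule mult.commute)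
    finally show "(\<Sum>k\<in>J. d j * cnj (d k) * (if j = k then 2 * of_real pi else 0))
        = 2 * of_real pi * of_real ((norm (d j))\<^sup>2)" .
  qed
  also have "\<dots> = of_real (2 * pi * (\<Sum>j\<in>J. (norm (d j))\<^sup>2))"
    by (simp add: sum_distrib_left)
  finally have "((\<lambda>t. of_real ((norm (?F (cis t)))\<^sup>2) :: complex) has_integral
      of_real (2 * pi * (\<Sum>j\<in>J. (norm (d j))\<^sup>2))) {0..2*pi}"
    unfolding complex_norm_square eq .
  from has_integral_Re[OF this]
  have "((\<lambda>t. (norm (?F (cis t)))\<^sup>2) has_integral 2 * pi * (\<Sum>j\<in>J. (norm (d j))\<^sup>2)) {0..2*pi}"
    by simp
  from nn_integral_circle_has_integral[OF _ _ _ this, of "\<lambda>\<zeta>. ennreal ((norm (?F \<zeta>))\<^sup>2)"]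
  show ?thesis by simp
qed

subsection \<open>Rotation invariant measures on the disc\<close>

definition vec3 :: "complex \<Rightarrow> complex \<Rightarrow> complex \<Rightarrow> complex ^ 3" where
  "vec3 x y z = (\<chi> i. if i = 1 then x else if i = 2 then y else z)"

lemma vec3_nth [simp]: "vec3 x y z $ 1 = x" "vec3 x y z $ 2 = y" "vec3 x y z $ 3 = z"
  by (simp_all add: vec3_def)

lemma measurable_vec3 [measurable]:
  assumes [measurable]: "f \<in> borel_measurable M" "g \<in> borel_measurable M" "h \<in> borel_measurable M"
  shows "(\<lambda>x. vec3 (f x) (g x) (h x)) \<in> borel_measurable M"
proof (subst borel_measurable_euclidean_space, rule ballI)
  fix b :: "complex ^ 3" assume "b \<in> Basis"
  then obtain i c where b: "b = axis i c" by (auto simp: Basis_vec_def)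
  show "(\<lambda>x. vec3 (f x) (g x) (h x) \<bullet> b) \<in> borel_measurable M"
    using exhaust_3[of i] by (auto simp: b inner_axis)
qed

lemma measurable_vec_nth [measurable]: "(\<lambda>v :: complex ^ 3. v $ i) \<in> borel_measurable borel"
  by (intro borel_measurable_continuous_onI continuous_intros)

lemma sets_vec_product_measure [measurable_cong, simp]: "sets (vec_product_measure M) = sets borel"
  by (simp add: vec_product_measure_def)

lemma nn_integral_vec3:
  assumes M: "sigma_finite_measure M" and sets_M [measurable_cong, simp]: "sets M = sets borel"
    and [measurable]: "f \<in> borel_measurable borel"
  shows "(\<integral>\<^sup>+v. f v \<partial>vec_product_measure M) = (\<integral>\<^sup>+x. \<integral>\<^sup>+y. \<integral>\<^sup>+z. f (vec3 x y z) \<partial>M \<partial>M \<partial>M)"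
proof -
  interpret P: product_sigma_finite "\<lambda>_::3. M"
    using M by (simp add: product_sigma_finite_def)
  have lam: "vec_lambda = (\<lambda>g::3\<Rightarrow>complex. vec3 (g 1) (g 2) (g 3))"
    by (auto simp: fun_eq_iff vec_eq_iff forall_3)
  have U: "(UNIV::3 set) = insert 1 (insert 2 (insert 3 {}))" using exhaust_3 by auto
  have m1: "vec_lambda \<in> (\<Pi>\<^sub>M i\<in>(UNIV::3 set). M) \<rightarrow>\<^sub>M (borel :: (complex ^ 3) measure)"
    unfolding lam by measurable
  have m3: "(\<lambda>g. f (vec3 (g 1) (g 2) (g 3))) \<in> borel_measurable (\<Pi>\<^sub>M i\<in>insert 1 (insert 2 (insert 3 {})). M)"
    by measurable
  have m2: "(\<lambda>g. f (vec3 x (g 2) (g 3))) \<in> borel_measurable (\<Pi>\<^sub>M i\<in>insert 2 (insert 3 {}). M)" for x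
    by measurable
  have m4: "(\<lambda>g. f (vec3 x y (g 3))) \<in> borel_measurable (\<Pi>\<^sub>M i\<in>{3::3}. M)" for x y
    by measurable
  have "(\<integral>\<^sup>+v. f v \<partial>vec_product_measure M) = (\<integral>\<^sup>+g. f (vec3 (g 1) (g 2) (g 3)) \<partial>(\<Pi>\<^sub>M i\<in>(UNIV::3 set). M))"
    unfolding vec_product_measure_def by (subst nn_integral_distr[OF m1]) (simp_all add: lam)
  also have "\<dots> = (\<integral>\<^sup>+x. \<integral>\<^sup>+y. \<integral>\<^sup>+z. f (vec3 x y z) \<partial>M \<partial>M \<partial>M)"
    unfolding U using m2 m3 m4
    by (simp add: P.product_nn_integral_insert_rev P.product_nn_integral_singleton space_PiM_empty)
  finally show ?thesis .
qed

lemma prob_space_vec_product_measure: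
  assumes M: "prob_space M" and S: "sets M = sets borel"
  shows "prob_space (vec_product_measure M :: (complex ^ 3) measure)"
proof
  interpret prob_space M by fact
  have "emeasure (vec_product_measure M :: (complex ^ 3) measure) (space (vec_product_measure M))
     = (\<integral>\<^sup>+v. 1 \<partial>(vec_product_measure M :: (complex ^ 3) measure))" by simp
  also have "\<dots> = 1"
    by (subst nn_integral_vec3[OF _ S]) (simp_all add: emeasure_space_1 sigma_finite_measure_axioms)
  finally show "emeasure (vec_product_measure M :: (complex ^ 3) measure) (space (vec_product_measure M)) = 1" .
qed

text \<open>A common interface for the circle measure and the weighted area measures, so that the
  sector and test polynomial estimates are proved once for Hardy and Bergman spaces.\<close>

locale rotation_invariant = prob_space \<mu> for \<mu> :: "complex measure" +
  assumes sets_mu [measurable_cong, simp]: "sets \<mu> = sets borel"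
    and rotate: "f \<in> borel_measurable borel \<Longrightarrow> norm \<zeta> = 1 \<Longrightarrow> (\<integral>\<^sup>+z. f (\<zeta> * z) \<partial>\<mu>) = (\<integral>\<^sup>+z. f z \<partial>\<mu>)"
    and AE_le_1: "AE z in \<mu>. norm z \<le> 1"
begin

text \<open>A substitute for polar coordinates: after averaging over rotations the inner integral
  runs over a circle, where Parseval or an arc length applies.\<close>

lemma nn_integral_average:
  assumes [measurable]: "f \<in> borel_measurable borel"
  shows "(\<integral>\<^sup>+z. f z \<partial>\<mu>) = (\<integral>\<^sup>+z. \<integral>\<^sup>+\<zeta>. f (\<zeta> * z) \<partial>circle_measure \<partial>\<mu>)"
proof -
  interpret C: prob_space circle_measure by (rule prob_space_circle)
  interpret P: pair_sigma_finite \<mu> circle_measure ..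
  have "(\<integral>\<^sup>+z. f z \<partial>\<mu>) = (\<integral>\<^sup>+\<zeta>. (\<integral>\<^sup>+z. f z \<partial>\<mu>) \<partial>circle_measure)"
    by (simp add: C.emeasure_space_1)
  also have "\<dots> = (\<integral>\<^sup>+\<zeta>. \<integral>\<^sup>+z. f (\<zeta> * z) \<partial>\<mu> \<partial>circle_measure)"
    by (rule nn_integral_cong_AE) (use AE_circle in \<open>eventually_elim, simp add: rotate\<close>)
  also have "\<dots> = (\<integral>\<^sup>+z. \<integral>\<^sup>+\<zeta>. f (\<zeta> * z) \<partial>circle_measure \<partial>\<mu>)"
    by (rule P.Fubini') measurable
  finally show ?thesis .
qed

end

text \<open>The exponent a stands for \<beta> + 1. The circle measure has a = 0, which makes the
  Hardy space the end point \<beta> = -1 of the Bergman scale.\<close>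

locale radial_tails = rotation_invariant +
  fixes a c C :: real
  assumes a_nonneg: "0 \<le> a" and c_pos: "0 < c" and C_ge_1: "1 \<le> C"
    and tail_ge: "0 < x \<Longrightarrow> x \<le> 1 \<Longrightarrow> ennreal (c * x powr a) \<le> emeasure \<mu> {z. 1 - x \<le> norm z}"
    and tail_le_aux: "0 < x \<Longrightarrow> x \<le> 1 \<Longrightarrow> emeasure \<mu> {z. 1 - x \<le> norm z} \<le> ennreal (C * x powr a)"
begin

text \<open>Beyond x = 1 the total mass 1 is enough, thanks to C \<ge> 1. The extension is wanted in
  \<open>moment_le\<close>, where the depth (k + 1)/j is unbounded.\<close>

lemma tail_le:
  assumes "0 < x"
  shows "emeasure \<mu> {z. 1 - x \<le> norm z} \<le> ennreal (C * x powr a)"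
proof (cases "x \<le> 1")
  case False
  then have "1 \<le> x powr a" using a_nonneg by (intro ge_one_powr_ge_zero) auto
  then have "1 * 1 \<le> C * x powr a" using C_ge_1 by (intro mult_mono) auto
  moreover have "emeasure \<mu> {z. 1 - x \<le> norm z} \<le> 1"
    using emeasure_le_1 by blast
  ultimately show ?thesis by (simp add: order_trans ennreal_1[symmetric] ennreal_leI del: ennreal_1)
qed (use tail_le_aux assms in auto)

end

section \<open>The circle measure and the weighted area measures as instances\<close>

lemma radial_tails_circle: "radial_tails circle_measure 0 1 1"
proof -
  interpret C: prob_space circle_measure by (rule prob_space_circle)
  have "emeasure circle_measure {z. 1 - x \<le> norm z} = 1" if "0 < x" for x
    by (rule C.emeasure_eq_1_AE) (use AE_circle in \<open>auto elim!: eventually_mono simp: that less_imp_le\<close>)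
  moreover have "AE z in circle_measure. norm z \<le> 1"
    using AE_circle by eventually_elim simp
  ultimately show ?thesis
    by unfold_locales (auto simp: nn_integral_rotate_circle)
qed

text \<open>The disc of radius sqrt(1 - x) has area pi (1 - x), linear in x. In the variable 1 -
  |z|^2 the Bergman weight becomes (\<beta> + 1) t^\<beta> on [0, 1], with an explicit
  primitive.\<close>

lemma distr_uniform_disc:
  "distr (uniform_measure lborel (ball 0 1)) borel (\<lambda>z::complex. 1 - (norm z)\<^sup>2) = uniform_measure lborel {0..1}"
    (is "?L = ?R")
proof (rule measure_eqI_lessThan)
  show "sets ?L = sets borel" "sets ?R = sets borel" by simp_all
  have b: "emeasure lborel (ball (0::complex) r) = ennreal (pi * r\<^sup>2)" if "0 \<le> r" for r
    using that by (simp add: emeasure_ball unit_ball_vol_2)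
  interpret L: prob_space ?L
    by (rule prob_space.prob_space_distr, rule prob_space_uniform_measure) (auto simp: b)
  show "emeasure ?L {x<..} < \<infinity>" for x
    unfolding infinity_ennreal_def less_top[symmetric] by (rule L.emeasure_finite[unfolded infinity_ennreal_def])
  fix x :: real
  have "emeasure ?L {x<..} = emeasure (uniform_measure lborel (ball 0 1)) {z::complex. x < 1 - (norm z)\<^sup>2}"
    by (subst emeasure_distr) (auto simp: vimage_def)
  also have "\<dots> = emeasure lborel (ball 0 1 \<inter> {z::complex. x < 1 - (norm z)\<^sup>2}) / ennreal pi"
    by (subst emeasure_uniform_measure) (auto simp: b)
  also have "\<dots> = emeasure ?R {x<..}"
  proof -
    consider "x < 0" | "0 \<le> x" "x < 1" | "1 \<le> x" by linarith
    then show ?thesis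
    proof cases
      case 1
      have "x < 1 - (norm z)\<^sup>2" if "norm z < 1" for z :: complex
        using that 1 power_le_one[of "norm z" 2] by (smt (verit) norm_ge_zero)
      then have "ball 0 1 \<inter> {z::complex. x < 1 - (norm z)\<^sup>2} = ball 0 1" by auto
      moreover have "{0..1} \<inter> {x<..} = {0..1}" using 1 by auto
      ultimately show ?thesis by (simp add: b emeasure_uniform_measure divide_ennreal)
    next
      case 2
      have "ball 0 1 \<inter> {z::complex. x < 1 - (norm z)\<^sup>2} = ball 0 (sqrt (1 - x))"
      proof (intro set_eqI iffI)
        fix z :: complex assume "z \<in> ball 0 (sqrt (1 - x))"
        then have *: "norm z < sqrt (1 - x)" by simp
        then have "(norm z)\<^sup>2 < 1 - x" using 2 
          by (metis norm_ge_zero real_less_rsqrt real_sqrt_less_iff real_sqrt_unique real_sqrt_abs abs_norm_cancel)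
        moreover have "norm z < 1" using * 2 by (smt (verit) real_sqrt_le_1_iff)
        ultimately show "z \<in> ball 0 1 \<inter> {z::complex. x < 1 - (norm z)\<^sup>2}" by simp
      qed (auto intro: real_less_rsqrt)
      moreover have "{0..1} \<inter> {x<..} = {x<..1}" using 2 by auto
      ultimately show ?thesis
        using 2 by (simp add: b emeasure_uniform_measure divide_ennreal divide_ennreal_def[of _ 1])
    next
      case 3
      then have "ball 0 1 \<inter> {z::complex. x < 1 - (norm z)\<^sup>2} = {}"
        by (auto simp: not_less) (smt (verit) zero_le_power2)
      moreover have "{0..1} \<inter> {x<..} = {}" using 3 by auto
      ultimately show ?thesis by (simp add: emeasure_uniform_measure)
    qed
  qed
  finally show "emeasure ?L {x<..} = emeasure ?R {x<..}" .
qed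

lemma sets_disc_measure [measurable_cong, simp]: "sets (disc_measure \<beta>) = sets borel"
  by (simp add: disc_measure_def)

lemma nn_integral_disc_measure:
  assumes [measurable]: "f \<in> borel_measurable borel"
  shows "(\<integral>\<^sup>+z. f z \<partial>disc_measure \<beta>) =
    (\<integral>\<^sup>+z. ennreal ((\<beta> + 1) * (1 - (norm z)\<^sup>2) powr \<beta>) * f z * indicator (ball 0 1) z \<partial>lborel) / ennreal pi"
  unfolding disc_measure_def
  by (subst nn_integral_density, simp, simp, subst nn_integral_uniform_measure)
     (simp_all add: emeasure_ball unit_ball_vol_2)

lemma emeasure_disc_tail:
  assumes \<beta>: "-1 < \<beta>" and x: "0 \<le> x" "x \<le> 1"
  shows "emeasure (disc_measure \<beta>) {z. 1 - x \<le> norm z} = ennreal ((2 * x - x\<^sup>2) powr (\<beta> + 1))"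
proof -
  \<comment> \<open>y = 1 - (1 - x)^2 is the value of 1 - |z|^2 on the circle |z| = 1 - x.\<close>
  define y where "y = 2 * x - x\<^sup>2"
  have "x * x \<le> x" using x by (simp add: mult_left_le)
  then have y: "0 \<le> y" "y \<le> 1"
    using x zero_le_power2[of "1 - x"] by (auto simp: y_def power2_eq_square algebra_simps)
  have iff: "1 - x \<le> norm z \<longleftrightarrow> 1 - (norm z)\<^sup>2 \<le> y" for z :: complex
  proof -
    have "1 - x \<le> norm z \<longleftrightarrow> (1 - x)\<^sup>2 \<le> (norm z)\<^sup>2"
      using x by (simp add: power2_le_iff_abs_le)
    then show ?thesis by (auto simp: y_def power2_eq_square algebra_simps)
  qed
  let ?g = "\<lambda>t. ennreal ((\<beta> + 1) * t powr \<beta>) * indicator {..y} t"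
  have "emeasure (disc_measure \<beta>) {z. 1 - x \<le> norm z}
     = (\<integral>\<^sup>+z. ?g (1 - (norm z)\<^sup>2) \<partial>uniform_measure lborel (ball (0::complex) 1))"
    unfolding disc_measure_def
    by (subst emeasure_density) (auto intro!: nn_integral_cong simp: iff split: split_indicator)
  also have "\<dots> = (\<integral>\<^sup>+t. ?g t \<partial>uniform_measure lborel {0..1})"
    unfolding distr_uniform_disc[symmetric] by (subst nn_integral_distr) auto
  also have "\<dots> = (\<integral>\<^sup>+t. ennreal ((\<beta> + 1) * t powr \<beta>) * indicator {0..y} t \<partial>lborel)"
    using y by (subst nn_integral_uniform_measure)
      (auto intro!: nn_integral_cong simp: divide_ennreal_def split: split_indicator)
  also have "\<dots> = ennreal ((\<beta> + 1) * (y powr (\<beta> + 1) / (\<beta> + 1)))"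
  proof (rule nn_integral_has_integral_lebesgue')
    show "((\<lambda>t. (\<beta> + 1) * t powr \<beta>) has_integral (\<beta> + 1) * (y powr (\<beta> + 1) / (\<beta> + 1))) {0..y}"
      by (intro has_integral_mult_right has_integral_powr_from_0 \<beta> y)
  qed (use \<beta> in auto)
  finally show ?thesis using \<beta> by (simp add: y_def)
qed

lemma AE_disc_measure: "AE z in disc_measure \<beta>. norm z < 1"
proof -
  have "AE z in uniform_measure lborel (ball (0::complex) 1). z \<in> ball 0 1"
    by (rule AE_uniform_measureI) auto
  then show ?thesis
    unfolding disc_measure_def by (subst AE_density) (auto elim: eventually_mono)
qed

lemma prob_space_disc_measure:
  assumes "-1 < \<beta>"
  shows "prob_space (disc_measure \<beta>)"
proof
  have "space (disc_measure \<beta>) = {z. 1 - 1 \<le> norm z}" by (auto simp: disc_measure_def)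
  then show "emeasure (disc_measure \<beta>) (space (disc_measure \<beta>)) = 1"
    using emeasure_disc_tail[OF assms, of 1] by simp
qed

lemma radial_tails_disc:
  assumes \<beta>: "-1 < \<beta>"
  shows "radial_tails (disc_measure \<beta>) (\<beta> + 1) 1 (2 powr (\<beta> + 1))"
proof -
  interpret prob_space "disc_measure \<beta>" by (rule prob_space_disc_measure) fact
  show ?thesis
  proof
    show "AE z in disc_measure \<beta>. norm z \<le> 1"
      using AE_disc_measure by eventually_elim simp
    fix f :: "complex \<Rightarrow> ennreal" and \<zeta> :: complex
    assume [measurable]: "f \<in> borel_measurable borel" and \<zeta>: "norm \<zeta> = 1"
    let ?w = "\<lambda>z. ennreal ((\<beta> + 1) * (1 - (norm z)\<^sup>2) powr \<beta>) * f z * indicator (ball 0 1) z"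
    have "(\<integral>\<^sup>+z. ?w (\<zeta> * z) \<partial>lborel) = (\<integral>\<^sup>+z. ?w z \<partial>lborel)"
      by (rule nn_integral_rotate_lborel[OF _ \<zeta>])
        (auto intro!: borel_measurable_times_ennreal borel_measurable_indicator)
    then show "(\<integral>\<^sup>+z. f (\<zeta> * z) \<partial>disc_measure \<beta>) = (\<integral>\<^sup>+z. f z \<partial>disc_measure \<beta>)"
      using \<zeta> by (simp add: nn_integral_disc_measure norm_mult indicator_def)
  next
    fix x :: real assume x: "0 < x" "x \<le> 1"
    \<comment> \<open>x \<le> 2x - x^2 \<le> 2x produces the constants 1 and
      \<open>2 powr (\<beta> + 1)\<close>.\<close>
    have "x * x \<le> x" using x by (simp add: mult_left_le)
    then have "x powr (\<beta> + 1) \<le> (2 * x - x\<^sup>2) powr (\<beta> + 1)"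
      using x \<beta> by (intro powr_mono2) (auto simp: power2_eq_square)
    then show "ennreal (1 * x powr (\<beta> + 1)) \<le> emeasure (disc_measure \<beta>) {z. 1 - x \<le> norm z}"
      using x by (subst emeasure_disc_tail[OF \<beta>]) (auto intro: ennreal_leI)
    have "(2 * x - x\<^sup>2) powr (\<beta> + 1) \<le> (2 * x) powr (\<beta> + 1)"
      using x \<beta> \<open>x * x \<le> x\<close> by (intro powr_mono2) (auto simp: power2_eq_square)
    then show "emeasure (disc_measure \<beta>) {z. 1 - x \<le> norm z} \<le> ennreal (2 powr (\<beta> + 1) * x powr (\<beta> + 1))"
      using x by (subst emeasure_disc_tail[OF \<beta>]) (auto intro: ennreal_leI simp: powr_mult)
  qed (use \<beta> in \<open>auto intro!: ge_one_powr_ge_zero\<close>)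
qed

section \<open>Polar sectors\<close>

lemma measurable_sgn_complex [measurable]: "sgn \<in> borel_measurable (borel :: complex measure)"
proof -
  have "(\<lambda>z::complex. z /\<^sub>R norm z) \<in> borel_measurable borel" by measurable
  then show ?thesis by (simp add: sgn_div_norm[abs_def])
qed

lemma emeasure_circle_sector:
  assumes "norm \<eta> = 1" "norm \<xi> = 1"
  shows "emeasure circle_measure {\<zeta>. norm (\<zeta> * \<xi> - \<eta>) \<le> \<rho>} = emeasure circle_measure (cball 1 \<rho>)"
proof -
  have "\<xi> \<noteq> 0" using assms by auto
  have "norm (\<eta> / \<xi> * \<zeta> * \<xi> - \<eta>) = norm (\<zeta> - 1)" for \<zeta>
  proof -
    have "\<eta> / \<xi> * \<zeta> * \<xi> - \<eta> = \<eta> * (\<zeta> - 1)" using \<open>\<xi> \<noteq> 0\<close> by (simp add: field_simps)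
    then show ?thesis using assms by (simp add: norm_mult)
  qed
  then have "(\<integral>\<^sup>+\<zeta>. indicator {\<zeta>. norm (\<zeta> * \<xi> - \<eta>) \<le> \<rho>} (\<eta> / \<xi> * \<zeta>) \<partial>circle_measure)
      = (\<integral>\<^sup>+\<zeta>. indicator (cball 1 \<rho>) \<zeta> \<partial>circle_measure)"
    by (intro nn_integral_cong) (auto simp: dist_norm norm_minus_commute split: split_indicator)
  moreover have "(\<integral>\<^sup>+\<zeta>. indicator {\<zeta>. norm (\<zeta> * \<xi> - \<eta>) \<le> \<rho>} (\<eta> / \<xi> * \<zeta>) \<partial>circle_measure)
     = (\<integral>\<^sup>+\<zeta>. indicator {\<zeta>. norm (\<zeta> * \<xi> - \<eta>) \<le> \<rho>} \<zeta> \<partial>circle_measure)"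
    by (rule nn_integral_rotate_circle) (use assms in \<open>auto simp: norm_divide\<close>)
  ultimately show ?thesis by simp
qed

text \<open>A polar rectangle with independent depth and width. Both scales are needed, since the
  first coordinate has depth of order \<delta> and width of order \<delta>^(1/p);
  \<open>sgn z\<close> is the radial projection to the circle.\<close>

definition sector :: "complex \<Rightarrow> real \<Rightarrow> real \<Rightarrow> complex set" where
  "sector \<eta> x \<rho> = {z. 1 - x \<le> norm z \<and> norm (sgn z - \<eta>) \<le> \<rho>}"

lemma sector_borel [measurable]: "sector \<eta> x \<rho> \<in> sets borel"
  unfolding sector_def by measurable

text \<open>Averaging over rotations separates angle from modulus. The bound x < 1 keeps the origin
  out, where \<open>sgn\<close> is not unimodular.\<close>

lemma (in rotation_invariant) emeasure_sector:
  assumes "norm \<eta> = 1" "x < 1"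
  shows "emeasure \<mu> (sector \<eta> x \<rho>) = emeasure circle_measure (cball 1 \<rho>) * emeasure \<mu> {z. 1 - x \<le> norm z}"
proof -
  have "emeasure \<mu> (sector \<eta> x \<rho>) = (\<integral>\<^sup>+z. indicator (sector \<eta> x \<rho>) z \<partial>\<mu>)"
    by simp
  also have "\<dots> = (\<integral>\<^sup>+z. \<integral>\<^sup>+\<zeta>. indicator (sector \<eta> x \<rho>) (\<zeta> * z) \<partial>circle_measure \<partial>\<mu>)"
    by (rule nn_integral_average) simp
  also have "\<dots> = (\<integral>\<^sup>+z. emeasure circle_measure (cball 1 \<rho>) * indicator {z. 1 - x \<le> norm z} z \<partial>\<mu>)"
  proof (rule nn_integral_cong)
    fix z
    have "(\<integral>\<^sup>+\<zeta>. indicator (sector \<eta> x \<rho>) (\<zeta> * z) \<partial>circle_measure)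
       = (\<integral>\<^sup>+\<zeta>. indicator {\<zeta>. norm (\<zeta> * sgn z - \<eta>) \<le> \<rho>} \<zeta> * indicator {z. 1 - x \<le> norm z} z \<partial>circle_measure)"
    proof (rule nn_integral_cong_AE)
      show "AE \<zeta> in circle_measure. (indicator (sector \<eta> x \<rho>) (\<zeta> * z) :: ennreal)
         = indicator {\<zeta>. norm (\<zeta> * sgn z - \<eta>) \<le> \<rho>} \<zeta> * indicator {z. 1 - x \<le> norm z} z"
        using AE_circle
      proof eventually_elim
        fix \<zeta> :: complex assume "norm \<zeta> = 1"
        then have "sgn \<zeta> = \<zeta>" by (simp add: sgn_div_norm)
        with \<open>norm \<zeta> = 1\<close> show "(indicator (sector \<eta> x \<rho>) (\<zeta> * z) :: ennreal)
         = indicator {\<zeta>. norm (\<zeta> * sgn z - \<eta>) \<le> \<rho>} \<zeta> * indicator {z. 1 - x \<le> norm z} z"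
          by (auto simp: sector_def sgn_mult norm_mult split: split_indicator)
      qed
    qed
    also have "\<dots> = emeasure circle_measure {\<zeta>. norm (\<zeta> * sgn z - \<eta>) \<le> \<rho>} * indicator {z. 1 - x \<le> norm z} z"
      by (subst nn_integral_multc) auto
    also have "\<dots> = emeasure circle_measure (cball 1 \<rho>) * indicator {z. 1 - x \<le> norm z} z"
    proof (cases "1 - x \<le> norm z")
      case True
      then have "norm (sgn z) = 1" using assms(2) by (auto simp: norm_sgn)
      then show ?thesis by (simp add: emeasure_circle_sector assms)
    qed simp
    finally show "(\<integral>\<^sup>+\<zeta>. indicator (sector \<eta> x \<rho>) (\<zeta> * z) \<partial>circle_measure)
      = emeasure circle_measure (cball 1 \<rho>) * indicator {z. 1 - x \<le> norm z} z" .
  qed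
  also have "\<dots> = emeasure circle_measure (cball 1 \<rho>) * emeasure \<mu> {z. 1 - x \<le> norm z}"
    by (subst nn_integral_cmult) auto
  finally show ?thesis .
qed

context radial_tails
begin

lemma emeasure_sector_le:
  assumes "norm \<eta> = 1" "0 < x" "x < 1" "0 \<le> \<rho>"
  shows "emeasure \<mu> (sector \<eta> x \<rho>) \<le> ennreal (\<rho> * (C * x powr a))"
  unfolding emeasure_sector[OF assms(1,3)]
  using assms emeasure_circle_cball_le[OF assms(4)] tail_le[of x] C_ge_1
  by (subst ennreal_mult) (auto intro!: mult_mono)

lemma emeasure_sector_ge:
  assumes "norm \<eta> = 1" "0 < x" "x < 1" "0 \<le> \<rho>" "\<rho> \<le> 1"
  shows "ennreal (\<rho> / (2 * pi) * (c * x powr a)) \<le> emeasure \<mu> (sector \<eta> x \<rho>)"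
  unfolding emeasure_sector[OF assms(1,3)]
  using assms emeasure_circle_cball_ge[OF assms(4,5)] tail_ge[of x] c_pos
  by (subst ennreal_mult) (auto intro!: mult_mono)

end

text \<open>|w| (sgn z - sgn w) = (|w| - |z|) sgn z + (z - w), and either summand has modulus at
  most |z - w|.\<close>

lemma norm_sgn_diff_le:
  fixes z w :: complex
  assumes "z \<noteq> 0" "w \<noteq> 0"
  shows "norm (sgn z - sgn w) \<le> 2 * norm (z - w) / norm w"
proof -
  have "norm w * norm (sgn z - sgn w) = norm (norm w *\<^sub>R sgn z - w)"
  proof -
    have "norm w *\<^sub>R sgn z - w = norm w *\<^sub>R (sgn z - sgn w)"
      using assms by (simp add: scaleR_diff_right sgn_div_norm)
    then show ?thesis by simp
  qed
  also have "norm w *\<^sub>R sgn z - w = (norm w - norm z) *\<^sub>R sgn z + (z - w)"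
    using assms by (simp add: scaleR_diff_left left_diff_distrib sgn_div_norm)
  also have "norm \<dots> \<le> \<bar>norm w - norm z\<bar> * norm (sgn z) + norm (z - w)"
    by (metis norm_scaleR norm_triangle_ineq)
  also have "\<dots> \<le> 2 * norm (z - w)"
    using assms norm_triangle_ineq3[of w z] by (simp add: norm_sgn norm_minus_commute)
  finally show ?thesis using assms by (simp add: field_simps)
qed

text \<open>With d = 1 - |b|, average the mean value inequality over the disc of radius d/2 about b,
  of area pi d^2/4. There 1 - |z|^2 \<le> 3d, so for \<beta> \<le> 0 the weight is at least (\<beta>
  + 1) (3d)^\<beta>; the quotient is the constant. Rotations about b, under which Lebesgue measure
  is invariant, again replace polar coordinates.\<close>

lemma disc_submean:
  assumes \<beta>: "-1 < \<beta>" "\<beta> \<le> 0" and G: "G holomorphic_on ball 0 1"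
    and b: "norm b < 1"
    and [measurable]: "f \<in> borel_measurable borel"
    and f: "\<And>z. norm z < 1 \<Longrightarrow> f z = ennreal ((norm (G z))\<^sup>2)"
  shows "ennreal ((norm (G b))\<^sup>2) \<le> ennreal (4 * 3 powr - \<beta> / (\<beta> + 1) * (1 - norm b) powr (- \<beta> - 2)) *
    (\<integral>\<^sup>+z. f z * indicator (ball b ((1 - norm b) / 2)) z \<partial>disc_measure \<beta>)"
proof -
  interpret C: prob_space circle_measure by (rule prob_space_circle)
  interpret P: pair_sigma_finite lborel circle_measure ..
  define d where "d = 1 - norm b"
  have d: "0 < d" "d \<le> 1" using b by (auto simp: d_def)
  define g where "g z = f (b + z) * indicator (ball 0 (d/2)) z" for z
  have [measurable]: "g \<in> borel_measurable borel"
    unfolding g_def by (auto intro!: borel_measurable_times_ennreal borel_measurable_indicator)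
  \<comment> \<open>The map u to G(b + u z) carries the circle about b through b + z to the unit
    circle, so that \<open>circle_submean\<close> applies.\<close>
  have sm: "ennreal ((norm (G b))\<^sup>2) * indicator (ball 0 (d/2)) z \<le> (\<integral>\<^sup>+\<zeta>. g (\<zeta> * z) \<partial>circle_measure)" for z
  proof (cases "norm z < d / 2")
    case True
    have le: "norm (b + u * z) < 1" if "norm u \<le> 1" for u
    proof -
      have "norm (b + u * z) \<le> norm b + norm u * norm z" by (metis norm_mult norm_triangle_ineq)
      also have "\<dots> \<le> norm b + 1 * norm z" using that by (intro add_left_mono mult_right_mono) auto
      also have "\<dots> < 1" using True d by (simp add: d_def)
      finally show ?thesis .
    qed
    let ?S = "{u. norm (b + u * z) < 1}"
    have S: "open ?S" by (intro open_Collect_less continuous_intros)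
    have "(\<lambda>u. G (b + u * z)) holomorphic_on ?S"
      by (rule holomorphic_on_compose_gen[OF _ G, unfolded comp_def]) (auto intro!: holomorphic_intros)
    then have "ennreal ((norm (G (b + 0 * z)))\<^sup>2) \<le> (\<integral>\<^sup>+\<zeta>. f (b + \<zeta> * z) \<partial>circle_measure)"
      by (rule circle_submean[OF _ S]) (use le in \<open>auto simp: f\<close>)
    also have "\<dots> = (\<integral>\<^sup>+\<zeta>. g (\<zeta> * z) \<partial>circle_measure)"
      by (rule nn_integral_cong_AE) (use AE_circle True in \<open>auto elim!: eventually_mono simp: g_def norm_mult\<close>)
    finally show ?thesis using True by simp
  qed simp
  have area: "emeasure lborel (ball (0::complex) (d/2)) = ennreal (pi * (d/2)\<^sup>2)"
    using d by (simp add: emeasure_ball unit_ball_vol_2)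
  have "ennreal (pi * (d/2)\<^sup>2) * ennreal ((norm (G b))\<^sup>2)
     = (\<integral>\<^sup>+z. ennreal ((norm (G b))\<^sup>2) * indicator (ball 0 (d/2)) z \<partial>(lborel :: complex measure))"
    by (subst nn_integral_cmult_indicator) (auto simp: area mult.commute)
  also have "\<dots> \<le> (\<integral>\<^sup>+z. \<integral>\<^sup>+\<zeta>. g (\<zeta> * z) \<partial>circle_measure \<partial>lborel)"
    by (intro nn_integral_mono sm)
  also have "\<dots> = (\<integral>\<^sup>+\<zeta>. \<integral>\<^sup>+z. g (\<zeta> * z) \<partial>lborel \<partial>circle_measure)"
    by (rule P.Fubini'[symmetric]) measurable
  also have "\<dots> = (\<integral>\<^sup>+\<zeta>. \<integral>\<^sup>+z. g z \<partial>lborel \<partial>circle_measure)"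
    by (rule nn_integral_cong_AE) (use AE_circle in \<open>auto elim!: eventually_mono simp: nn_integral_rotate_lborel\<close>)
  also have "\<dots> = (\<integral>\<^sup>+z. g z \<partial>lborel)"
    by (simp add: C.emeasure_space_1)
  also have "\<dots> = (\<integral>\<^sup>+z. g (- b + z) \<partial>distr lborel borel ((+) b))"
    by (subst nn_integral_distr) auto
  also have "\<dots> = (\<integral>\<^sup>+z. g (- b + z) \<partial>lborel)"
    by (simp add: lborel_distr_plus)
  also have "\<dots> \<le> (\<integral>\<^sup>+z. ennreal ((3 * d) powr - \<beta> / (\<beta> + 1)) *
      (ennreal ((\<beta> + 1) * (1 - (norm z)\<^sup>2) powr \<beta>) * (f z * indicator (ball b (d/2)) z) * indicator (ball 0 1) z) \<partial>lborel)"
  proof (rule nn_integral_mono)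
    fix z :: complex
    show "g (- b + z) \<le> ennreal ((3 * d) powr - \<beta> / (\<beta> + 1)) *
      (ennreal ((\<beta> + 1) * (1 - (norm z)\<^sup>2) powr \<beta>) * (f z * indicator (ball b (d/2)) z) * indicator (ball 0 1) z)"
    proof (cases "norm (z - b) < d / 2")
      case True
      have z1: "norm z < 1" "1 - norm z \<le> 3 * d / 2"
        using True norm_triangle_ineq2[of z b] norm_triangle_ineq2[of b z]
        by (auto simp: d_def norm_minus_commute)
      have "(norm z)\<^sup>2 < 1" using z1 by (simp add: power_less_one_iff)
      have "1 - (norm z)\<^sup>2 = (1 - norm z) * (1 + norm z)" by (simp add: power2_eq_square algebra_simps)
      also have "\<dots> \<le> (3 * d / 2) * 2" using z1 d by (intro mult_mono) auto
      finally have "(3 * d) powr \<beta> \<le> (1 - (norm z)\<^sup>2) powr \<beta>"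
        using \<open>(norm z)\<^sup>2 < 1\<close> \<beta> by (intro powr_mono2') auto
      then have "(3 * d) powr - \<beta> * (3 * d) powr \<beta> \<le> (3 * d) powr - \<beta> * (1 - (norm z)\<^sup>2) powr \<beta>"
        by (intro mult_left_mono) auto
      also have "(3 * d) powr - \<beta> * (3 * d) powr \<beta> = 1"
        using d by (simp flip: powr_add)
      finally have "1 \<le> ennreal ((3 * d) powr - \<beta> / (\<beta> + 1)) * ennreal ((\<beta> + 1) * (1 - (norm z)\<^sup>2) powr \<beta>)"
        using \<beta> by (subst ennreal_mult[symmetric]) (auto simp flip: ennreal_1 intro!: ennreal_leI)
      then have "1 * f z \<le> ennreal ((3 * d) powr - \<beta> / (\<beta> + 1)) * ennreal ((\<beta> + 1) * (1 - (norm z)\<^sup>2) powr \<beta>) * f z"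
        by (intro mult_right_mono) auto
      then show ?thesis using True z1 by (simp add: g_def dist_norm norm_minus_commute mult.assoc)
    qed (simp add: g_def)
  qed
  also have "\<dots> = ennreal ((3 * d) powr - \<beta> / (\<beta> + 1)) *
      (\<integral>\<^sup>+z. (ennreal ((\<beta> + 1) * (1 - (norm z)\<^sup>2) powr \<beta>) * (f z * indicator (ball b (d/2)) z) * indicator (ball 0 1) z) \<partial>lborel)"
    by (intro nn_integral_cmult) (auto intro!: borel_measurable_times_ennreal borel_measurable_indicator)
  also have "(\<integral>\<^sup>+z. (ennreal ((\<beta> + 1) * (1 - (norm z)\<^sup>2) powr \<beta>) * (f z * indicator (ball b (d/2)) z) * indicator (ball 0 1) z) \<partial>lborel)
     = ennreal pi * (\<integral>\<^sup>+z. f z * indicator (ball b (d/2)) z \<partial>disc_measure \<beta>)"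
    by (subst nn_integral_disc_measure)
       (auto intro!: borel_measurable_times_ennreal borel_measurable_indicator simp: ennreal_times_divide ennreal_mult_divide_eq mult.commute[of "ennreal pi"])
  finally have *: "ennreal (pi * (d/2)\<^sup>2) * ennreal ((norm (G b))\<^sup>2) \<le> ennreal ((3 * d) powr - \<beta> / (\<beta> + 1)) *
     (ennreal pi * (\<integral>\<^sup>+z. f z * indicator (ball b (d/2)) z \<partial>disc_measure \<beta>))" .
  let ?I = "\<integral>\<^sup>+z. f z * indicator (ball b (d/2)) z \<partial>disc_measure \<beta>"
  have "ennreal ((norm (G b))\<^sup>2) = ennreal (4 / (pi * d\<^sup>2)) * (ennreal (pi * (d/2)\<^sup>2) * ennreal ((norm (G b))\<^sup>2))"
    using d by (simp flip: ennreal_mult mult.assoc add: power2_eq_square)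
  also have "\<dots> \<le> ennreal (4 / (pi * d\<^sup>2)) * (ennreal ((3 * d) powr - \<beta> / (\<beta> + 1)) * (ennreal pi * ?I))"
    by (intro mult_left_mono *) auto
  also have "\<dots> = ennreal (4 / (pi * d\<^sup>2) * ((3 * d) powr - \<beta> / (\<beta> + 1)) * pi) * ?I"
  proof -
    have "ennreal x * (ennreal y * (ennreal pi * u)) = ennreal (x * y * pi) * u" if "0 \<le> x" "0 \<le> y" for x y u
      using that by (simp add: ennreal_mult mult.assoc)
    then show ?thesis using d \<beta> by simp
  qed
  also have "4 / (pi * d\<^sup>2) * ((3 * d) powr - \<beta> / (\<beta> + 1)) * pi = 4 * 3 powr - \<beta> / (\<beta> + 1) * (d powr - \<beta> / d powr 2)"
    using d by (simp add: powr_mult mult_ac)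
  also have "d powr - \<beta> / d powr 2 = d powr (- \<beta> - 2)"
    by (simp add: powr_diff)
  finally show ?thesis by (simp add: d_def)
qed

subsection \<open>A function with prescribed contact at the circle\<close>

text \<open>The real part of \<open>fejer_poly m\<close> on the unit circle is \<open>\<bar>1 - \<zeta>\<bar>\<^sup>2\<^sup>m\<close>: it is obtained from the double
  sum \<open>(1 - \<zeta>)\<^sup>m cnj ((1 - \<zeta>)\<^sup>m)\<close> by replacing each \<open>\<zeta>\<^sup>j cnj (\<zeta>\<^sup>l)\<close> by \<open>\<zeta>\<close> to the power \<open>\<bar>j - l\<bar>\<close>,
  which has the same real part.\<close>

definition fejer_poly :: "nat \<Rightarrow> complex \<Rightarrow> complex" where
  "fejer_poly m z = (\<Sum>j\<le>m. \<Sum>l\<le>m.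
     of_real ((-1) ^ j * real (m choose j) * ((-1) ^ l * real (m choose l))) * z ^ ((j - l) + (l - j)))"

lemma Re_fejer_poly:
  assumes z: "norm z = 1"
  shows "Re (fejer_poly m z) = norm (z - 1) ^ (2 * m)"
proof -
  define b where "b j = (-1) ^ j * real (m choose j)" for j
  have mul: "z ^ n * cnj (z ^ n) = 1" for n
    using z by (simp only: complex_norm_square[symmetric] norm_power) simp
  have Re: "Re (z ^ ((j - l) + (l - j))) = Re (z ^ j * cnj (z ^ l))" for j l
  proof (cases "l \<le> j")
    case True
    then have "z ^ j = z ^ (j - l) * z ^ l" by (simp flip: power_add)
    then have "z ^ j * cnj (z ^ l) = z ^ (j - l)" by (simp only: mult.assoc mul mult_1_right)
    then show ?thesis using True by simp
  next
    case False
    then have "z ^ l = z ^ (l - j) * z ^ j" by (simp flip: power_add)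
    then have "z ^ j * cnj (z ^ l) = (z ^ j * cnj (z ^ j)) * cnj (z ^ (l - j))" by (simp add: mult_ac)
    also have "\<dots> = cnj (z ^ (l - j))" by (simp only: mul mult_1_left)
    finally have "Re (z ^ j * cnj (z ^ l)) = Re (cnj (z ^ (l - j)))" by (rule arg_cong)
    then show ?thesis using False by (simp del: complex_cnj_power)
  qed
  have "(1 - z) ^ m = (\<Sum>j\<le>m. of_nat (m choose j) * (- z) ^ j * 1 ^ (m - j))"
    using binomial_ring[of "- z" 1 m] by simp
  also have "\<dots> = (\<Sum>j\<le>m. of_real (b j) * z ^ j)"
    by (intro sum.cong) (auto simp: b_def power_minus[of z])
  finally have bin: "(1 - z) ^ m = (\<Sum>j\<le>m. of_real (b j) * z ^ j)" .
  have "of_real ((norm ((1 - z) ^ m))\<^sup>2) = (1 - z) ^ m * cnj ((1 - z) ^ m)"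
    by (rule complex_norm_square)
  also have "\<dots> = (\<Sum>j\<le>m. \<Sum>l\<le>m. of_real (b j * b l) * (z ^ j * cnj (z ^ l)))"
    unfolding bin by (simp add: sum_product mult_ac)
  finally have "(norm ((1 - z) ^ m))\<^sup>2 = Re (\<Sum>j\<le>m. \<Sum>l\<le>m. of_real (b j * b l) * (z ^ j * cnj (z ^ l)))"
    by (metis Re_complex_of_real)
  also have "\<dots> = (\<Sum>j\<le>m. \<Sum>l\<le>m. b j * b l * Re (z ^ j * cnj (z ^ l)))"
    unfolding Re_sum
    by (intro sum.cong refl) (simp only: times_complex.simps Re_complex_of_real Im_complex_of_real mult_zero_left diff_0_right)
  also have "\<dots> = Re (fejer_poly m z)"
    unfolding fejer_poly_def Re_sum Re[symmetric] b_def
    by (intro sum.cong refl) (simp only: times_complex.simps Re_complex_of_real Im_complex_of_real mult_zero_left diff_0_right)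
  finally show ?thesis
    by (simp add: norm_power norm_minus_commute mult.commute flip: power_mult)
qed

lemma fejer_poly_bounds:
  obtains B where "B \<ge> 0" "\<And>z. norm z \<le> 1 \<Longrightarrow> norm (fejer_poly m z) \<le> B"
    "\<And>z. norm z \<le> 1 \<Longrightarrow> norm (deriv (fejer_poly m) z) \<le> B"
proof -
  have hol: "fejer_poly m holomorphic_on UNIV"
    unfolding fejer_poly_def by (intro holomorphic_intros)
  have "continuous_on (cball 0 1) (fejer_poly m)"
    using hol by (meson holomorphic_on_imp_continuous_on holomorphic_on_subset subset_UNIV)
  then have "bounded (fejer_poly m ` cball 0 1)"
    by (intro compact_imp_bounded compact_continuous_image) auto
  then obtain B1 where B1: "\<And>z. norm z \<le> 1 \<Longrightarrow> norm (fejer_poly m z) \<le> B1"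
    unfolding bounded_iff by (metis imageI mem_cball_0)
  have "continuous_on (cball 0 1) (deriv (fejer_poly m))"
    using holomorphic_deriv[OF hol open_UNIV]
    by (meson holomorphic_on_imp_continuous_on holomorphic_on_subset subset_UNIV)
  then have "bounded (deriv (fejer_poly m) ` cball 0 1)"
    by (intro compact_imp_bounded compact_continuous_image) auto
  then obtain B2 where B2: "\<And>z. norm z \<le> 1 \<Longrightarrow> norm (deriv (fejer_poly m) z) \<le> B2"
    unfolding bounded_iff by (metis imageI mem_cball_0)
  show ?thesis
    by (rule that[of "max 0 (max B1 B2)"]) (use B1 B2 in \<open>auto simp: le_max_iff_disj\<close>)
qed

text \<open>The function is a lacunary series; the term of index \<open>k\<close> is responsible for the size of its real
  part at distance about \<open>2 powr - k\<close> from \<open>1\<close>.\<close>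

lemma exists_power_contact:
  fixes p p' :: real
  assumes p: "1 < p" and p': "0 < p'" "p' < p"
  obtains U V :: "complex \<Rightarrow> complex" and c C :: real where
    "continuous_on (cball 0 1) V"
    "\<And>z. norm z \<le> 1 \<Longrightarrow> (U has_field_derivative V z) (at z within cball 0 1)"
    "\<And>z. norm z \<le> 1 \<Longrightarrow> 0 \<le> Re (U z)"
    "0 < c" "0 \<le> C"
    "\<And>\<zeta>. norm \<zeta> = 1 \<Longrightarrow> c * norm (\<zeta> - 1) powr p \<le> Re (U \<zeta>)"
    "\<And>\<zeta>. norm \<zeta> = 1 \<Longrightarrow> Re (U \<zeta>) \<le> C * norm (\<zeta> - 1) powr p'"
proof -
  \<comment> \<open>2m \<ge> p' allows the power 2m of a number in [0, 2] to be bounded by a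
    multiple of its power p'.\<close>
  obtain m :: nat where m: "p' / 2 \<le> real m" using real_arch_simple by blast
  define H where "H = fejer_poly m"
  obtain B where B: "B \<ge> 0" "\<And>z. norm z \<le> 1 \<Longrightarrow> norm (H z) \<le> B"
    "\<And>z. norm z \<le> 1 \<Longrightarrow> norm (deriv H z) \<le> B"
    using fejer_poly_bounds[of m] unfolding H_def by metis
  have hol: "H holomorphic_on UNIV"
    unfolding H_def fejer_poly_def by (intro holomorphic_intros)
  \<comment> \<open>Differentiating z^(2^k) costs 2^k, so the derivative series needs 2s < 1, which
    is p > 1. At distance 2^(-k) from 1 the amplitude s^k is that distance to the power p.\<close>
  define s where "s = 2 powr - p"
  have s: "0 < s" "2 * s < 1" "s < 1"
  proof -
    show "0 < s" by (simp add: s_def)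
    have "s < 2 powr -1" unfolding s_def using p by (intro powr_less_mono) auto
    then show "2 * s < 1" by simp
    with \<open>0 < s\<close> show "s < 1" by linarith
  qed
  define u where "u k z = of_real (s ^ k) * H (z ^ (2 ^ k))" for k z
  define v where "v k z = of_real (s ^ k) * (deriv H (z ^ (2 ^ k)) * (of_nat (2 ^ k) * z ^ (2 ^ k - 1)))" for k z
  have der: "(u k has_field_derivative v k z) (at z within S)" for k z S
  proof -
    have "(H has_field_derivative deriv H (z ^ (2 ^ k))) (at (z ^ (2 ^ k)))"
      by (rule holomorphic_derivI[OF hol]) auto
    then have "((\<lambda>z. H (z ^ (2 ^ k))) has_field_derivative deriv H (z ^ (2 ^ k)) * (of_nat (2 ^ k) * z ^ (2 ^ k - 1))) (at z within S)"
      by (rule DERIV_chain2) (auto intro!: derivative_eq_intros)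
    then show ?thesis
      unfolding u_def v_def by (rule DERIV_cmult)
  qed
  have vb: "norm (v k z) \<le> B * (2 * s) ^ k" if "norm z \<le> 1" for k z
  proof -
    have "norm (deriv H (z ^ (2 ^ k)) * (of_nat (2 ^ k) * z ^ (2 ^ k - 1))) \<le> B * (2 ^ k * 1)"
      unfolding norm_mult
      by (intro mult_mono B(3)) (use that B(1) in \<open>auto simp: norm_power power_le_one\<close>)
    then show ?thesis
      using s by (simp add: v_def norm_mult norm_power power_mult_distrib mult_ac mult_left_mono)
  qed
  have ub: "norm (u k z) \<le> B * s ^ k" if "norm z \<le> 1" for k z
    using s B(2)[of "z ^ (2 ^ k)"] that
    by (simp add: u_def norm_mult norm_power mult.commute mult_right_mono power_le_one)
  have sumU: "summable (\<lambda>k. u k z)" if "norm z \<le> 1" for z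
    by (rule summable_comparison_test'[where g = "\<lambda>k. B * s ^ k" and N = 0])
       (use ub[OF that] s in \<open>auto intro!: summable_mult summable_geometric\<close>)
  define V where "V z = (\<Sum>k. v k z)" for z
  have uni: "uniform_limit (cball 0 1) (\<lambda>n z. \<Sum>k<n. v k z) V sequentially"
    unfolding V_def
  proof (rule Weierstrass_m_test[where M = "\<lambda>k. B * (2 * s) ^ k"])
    show "summable (\<lambda>k. B * (2 * s) ^ k)"
      by (intro summable_mult summable_geometric) (use s in simp)
  qed (use vb in auto)
  \<comment> \<open>Termwise differentiation takes place within the closed disc, so boundary points
    are included and U is Lipschitz up to the circle.\<close>
  have "\<exists>U. \<forall>z\<in>cball 0 1. (\<lambda>k. u k z) sums U z \<and> (U has_field_derivative V z) (at z within cball 0 1)"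
    by (rule has_field_derivative_series[where f' = v and ?x0.0 = 0]) (use der uni sumU in auto)
  then obtain U where "\<forall>z\<in>cball 0 1. (\<lambda>k. u k z) sums U z \<and> (U has_field_derivative V z) (at z within cball 0 1)"
    by blast
  then have U: "(\<lambda>k. u k z) sums U z" "(U has_field_derivative V z) (at z within cball 0 1)" if "norm z \<le> 1" for z
    using that by simp_all
  have contV: "continuous_on (cball 0 1) V"
  proof (rule uniform_limit_theorem[OF _ uni])
    have "continuous_on (cball 0 1) (\<lambda>z. deriv H (z ^ (2 ^ k)))" for k
      by (rule continuous_on_compose2[OF holomorphic_on_imp_continuous_on[OF holomorphic_deriv[OF hol open_UNIV]]])
         (auto intro!: continuous_intros)
    then show "\<forall>\<^sub>F n in sequentially. continuous_on (cball 0 1) (\<lambda>z. \<Sum>k<n. v k z)"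
      unfolding v_def by (intro always_eventually allI continuous_intros)
  qed auto
  have Re_u: "Re (u k \<zeta>) = s ^ k * norm (\<zeta> ^ (2 ^ k) - 1) ^ (2 * m)" if "norm \<zeta> = 1" for k \<zeta>
    using that by (simp add: u_def H_def Re_fejer_poly norm_power del: of_real_power)
  have Re_U: "(\<lambda>k. s ^ k * norm (\<zeta> ^ (2 ^ k) - 1) ^ (2 * m)) sums Re (U \<zeta>)" if "norm \<zeta> = 1" for \<zeta>
    using sums_Re[OF U(1)[of \<zeta>]] that by (simp add: Re_u)
  \<comment> \<open>Termwise positivity is known on the circle only; the maximum principle for Re (-
    U) carries it into the disc.\<close>
  have pos: "0 \<le> Re (U z)" if "norm z \<le> 1" for z
  proof -
    have contU: "continuous_on (cball 0 1) U"
      by (rule DERIV_continuous_on) (use U(2) in auto)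
    have hol: "U holomorphic_on ball 0 1"
    proof (rule holomorphic_onI)
      fix z :: complex assume "z \<in> ball 0 1"
      then have "(U has_field_derivative V z) (at z within ball 0 1)"
        by (intro DERIV_subset[OF U(2)]) auto
      then show "U field_differentiable at z within ball 0 1"
        by (auto simp: field_differentiable_def)
    qed
    have circ: "0 \<le> Re (U \<zeta>)" if "norm \<zeta> = 1" for \<zeta>
      using sums_le[OF _ sums_zero Re_U[OF that]] s by simp
    have "Re (- U z) \<le> 0" if "norm z < 1"
    proof -
      have 1: "(\<lambda>z. - U z) holomorphic_on interior (ball 0 1)"
        using hol by (simp add: holomorphic_on_minus)
      have 2: "continuous_on (closure (ball 0 1)) (\<lambda>z. - U z)"
        using contU by (simp add: continuous_on_minus)
      show ?thesis
        by (rule maximum_real_frontier[OF 1 2]) (use circ that in \<open>auto simp: dist_norm\<close>)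
    qed
    with circ that show ?thesis by (cases "norm z < 1") auto
  qed
  define c where "c = pi powr - p * (1/2) ^ (2 * m)"
  have lower: "c * norm (\<zeta> - 1) powr p \<le> Re (U \<zeta>)" if \<zeta>: "norm \<zeta> = 1" for \<zeta>
  proof (cases "\<zeta> = 1")
    case True
    then show ?thesis using pos[of \<zeta>] by simp
  next
    case False
    obtain \<theta> where \<theta>: "\<zeta> = cis \<theta>" "\<bar>\<theta>\<bar> \<le> pi"
    proof (rule that)
      have "\<zeta> \<noteq> 0" using \<zeta> by auto
      then show "\<zeta> = cis (Arg \<zeta>)" using \<zeta> by (simp add: cis_Arg sgn_div_norm)
      show "\<bar>Arg \<zeta>\<bar> \<le> pi" using Arg_bounded[of \<zeta>] by auto
    qed
    have th: "\<theta> \<noteq> 0" using False \<theta> by auto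
    \<comment> \<open>The first k with 2^k |\<theta>| > pi/2 still has 2^k |\<theta>| \<le> pi. The
      first bound puts \<zeta>^(2^k) at distance at least 1/2 from 1; the second gives |\<theta>|
      \<le> pi 2^(-k), hence s^k \<ge> (|\<theta>|/pi)^p. This single term yields the constant
      c.\<close>
    define P where "P k \<longleftrightarrow> pi / 2 < 2 ^ k * \<bar>\<theta>\<bar>" for k :: nat
    obtain n :: nat where n: "pi / 2 / \<bar>\<theta>\<bar> < 2 ^ n" using real_arch_pow[of 2 "pi / 2 / \<bar>\<theta>\<bar>"] by auto
    then have "P n" using th by (simp add: P_def field_simps)
    define k where "k = (LEAST k. P k)"
    have "P k" unfolding k_def by (rule LeastI, fact)
    then have k1: "pi / 2 < 2 ^ k * \<bar>\<theta>\<bar>" by (simp add: P_def)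
    have k2: "2 ^ k * \<bar>\<theta>\<bar> \<le> pi"
    proof (cases k)
      case (Suc j)
      then have "\<not> P j" unfolding k_def by (metis lessI not_less_Least)
      then show ?thesis using Suc by (simp add: P_def)
    qed (use \<theta> in simp)
    have "\<zeta> ^ (2 ^ k) = cis (2 ^ k * \<theta>)"
      using Complex.DeMoivre[of \<theta> "2 ^ k"] by (simp add: \<theta>(1))
    then have "1/2 \<le> norm (\<zeta> ^ (2 ^ k) - 1)"
      using norm_cis_minus_1_ge[of "2 ^ k * \<theta>"] k1 k2 pi_ge_two by (simp add: abs_mult)
    then have "(1/2) ^ (2 * m) \<le> norm (\<zeta> ^ (2 ^ k) - 1) ^ (2 * m)"
      by (intro power_mono) auto
    moreover have "norm (\<zeta> - 1) powr p * pi powr - p \<le> s ^ k"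
    proof -
      have "norm (\<zeta> - 1) \<le> \<bar>\<theta>\<bar>" using norm_cis_minus_1_le[of \<theta>] by (simp add: \<theta>)
      also have "\<dots> \<le> pi * (2 powr - real k)"
        using k2 by (simp add: powr_minus powr_realpow field_simps)
      finally have "norm (\<zeta> - 1) powr p \<le> (pi * (2 powr - real k)) powr p"
        using p by (intro powr_mono2) auto
      also have "\<dots> = pi powr p * s ^ k"
        by (simp add: powr_mult powr_powr s_def powr_realpow[symmetric] mult.commute)
      finally show ?thesis by (simp add: powr_minus field_simps)
    qed
    ultimately have "norm (\<zeta> - 1) powr p * pi powr - p * (1/2) ^ (2 * m) \<le> s ^ k * norm (\<zeta> ^ (2 ^ k) - 1) ^ (2 * m)"
      using s by (intro mult_mono) auto
    also have "\<dots> \<le> Re (U \<zeta>)"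
      using sum_le_suminf[OF sums_summable[OF Re_U[OF \<zeta>]], of "{k}"] s sums_unique[OF Re_U[OF \<zeta>]] by simp
    finally show ?thesis by (simp add: c_def mult_ac)
  qed
  \<comment> \<open>t = s 2^p' is the ratio of the majorant s^k 4^m (2^k |\<zeta> - 1|)^p'; it is
    below 1 because p' < p.\<close>
  define t where "t = 2 powr (p' - p)"
  have t: "0 < t" "t < 1" using p' by (auto simp: t_def powr_less_one)
  define C where "C = 4 ^ m * (1 / (1 - t))"
  have upper: "Re (U \<zeta>) \<le> C * norm (\<zeta> - 1) powr p'" if \<zeta>: "norm \<zeta> = 1" for \<zeta>
  proof (rule sums_le[OF _ Re_U[OF \<zeta>]])
    show "(\<lambda>k. 4 ^ m * norm (\<zeta> - 1) powr p' * t ^ k) sums (C * norm (\<zeta> - 1) powr p')"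
      using sums_mult[OF geometric_sums[of t], of "4 ^ m * norm (\<zeta> - 1) powr p'"] t
      by (simp add: C_def mult_ac)
    fix k
    define y where "y = norm (\<zeta> ^ (2 ^ k) - 1)"
    have y2: "y \<le> 2" using norm_triangle_ineq4[of "\<zeta> ^ (2 ^ k)" 1] \<zeta> by (simp add: y_def norm_power)
    have yN: "y \<le> 2 ^ k * norm (\<zeta> - 1)"
      using norm_power_diff[of \<zeta> 1 "2 ^ k"] \<zeta> by (simp add: y_def)
    have "y ^ (2 * m) = y powr (2 * real m - p') * y powr p'" if "y \<noteq> 0"
    proof -
      have "0 < y" using that by (simp add: y_def)
      then show ?thesis by (simp flip: powr_add powr_realpow)
    qed
    moreover have "y powr (2 * real m - p') \<le> 2 powr (2 * real m - p')"
      using y2 m by (intro powr_mono2) (auto simp: y_def)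
    moreover have "2 powr (2 * real m - p') \<le> 2 powr (2 * real m)"
      using p' by (intro powr_mono) auto
    moreover have "2 powr (2 * real m) = (4::real) ^ m"
      by (simp add: powr_powr[symmetric] powr_realpow)
    moreover have "y powr p' \<le> (2 ^ k * norm (\<zeta> - 1)) powr p'"
      using yN p' by (intro powr_mono2) (auto simp: y_def)
    ultimately have "y ^ (2 * m) \<le> 4 ^ m * (2 ^ k * norm (\<zeta> - 1)) powr p'" if "y \<noteq> 0"
      using that by (auto intro!: mult_mono)
    \<comment> \<open>Converting a natural power to \<open>powr\<close> needs a positive base, hence
      the separate case; m = 0 would contradict 0 < p' \<le> 2m.\<close>
    moreover have "y ^ (2 * m) \<le> 4 ^ m * (2 ^ k * norm (\<zeta> - 1)) powr p'" if "y = 0"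
      using that p' m by (cases "m = 0") (auto simp: power_0_left)
    ultimately have "s ^ k * y ^ (2 * m) \<le> s ^ k * (4 ^ m * (2 ^ k * norm (\<zeta> - 1)) powr p')"
      using s by (intro mult_left_mono) auto
    also have "\<dots> = 4 ^ m * norm (\<zeta> - 1) powr p' * t ^ k"
    proof -
      have "s ^ k * (2 ^ k) powr p' = t ^ k"
        by (simp add: s_def t_def powr_realpow[symmetric] powr_powr powr_add[symmetric] algebra_simps)
      then show ?thesis by (simp add: powr_mult mult_ac)
    qed
    finally show "s ^ k * norm (\<zeta> ^ (2 ^ k) - 1) ^ (2 * m) \<le> 4 ^ m * norm (\<zeta> - 1) powr p' * t ^ k"
      by (simp add: y_def)
  qed
  show ?thesis
    by (rule that[OF contV U(2) pos _ _ lower upper]) (use t in \<open>auto simp: c_def C_def\<close>)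
qed

subsection \<open>The map and its Carleson estimate\<close>

lemma open_polydisc: "open (polydisc :: (complex ^ 3) set)"
proof -
  have "polydisc = {z :: complex ^ 3. norm (z $ 1) < 1} \<inter> {z. norm (z $ 2) < 1} \<inter> {z. norm (z $ 3) < 1}"
    by (auto simp: polydisc_def forall_3)
  moreover have "open \<dots>"
    by (intro open_Int open_Collect_less continuous_intros)
  ultimately show ?thesis by simp
qed

lemma polydisc_borel [measurable]: "(polydisc :: (complex ^ 3) set) \<in> sets borel"
  using open_polydisc by simp

lemma vec3_in_polydisc [simp]: "vec3 x y z \<in> polydisc \<longleftrightarrow> norm x < 1 \<and> norm y < 1 \<and> norm z < 1"
  by (simp add: polydisc_def forall_3)

section \<open>Calculus of holomorphic functions on the polydisc\<close>

lemma holomorphic_vec_on_const: "(\<lambda>v. k) holomorphic_vec_on S"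
  unfolding holomorphic_vec_on_def by (auto intro!: exI[of _ "\<lambda>_. 0"])

lemma holomorphic_vec_on_nth: "(\<lambda>v. v $ i) holomorphic_vec_on S"
  unfolding holomorphic_vec_on_def
  by (auto intro!: exI[of _ "\<lambda>v. v $ i"] bounded_linear_imp_has_derivative bounded_linear_vec_nth)

lemma holomorphic_vec_on_add:
  assumes "f holomorphic_vec_on S" "g holomorphic_vec_on S"
  shows "(\<lambda>v. f v + g v) holomorphic_vec_on S"
  unfolding holomorphic_vec_on_def
proof
  fix z assume "z \<in> S"
  then obtain f' g' where "(f has_derivative f') (at z within S)" "(g has_derivative g') (at z within S)"
    and l: "\<And>c v. f' (c *s v) = c * f' v" "\<And>c v. g' (c *s v) = c * g' v"
    using assms unfolding holomorphic_vec_on_def by meson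
  then have "((\<lambda>v. f v + g v) has_derivative (\<lambda>h. f' h + g' h)) (at z within S)"
    by (intro has_derivative_add)
  then show "\<exists>f'. ((\<lambda>v. f v + g v) has_derivative f') (at z within S) \<and> (\<forall>c v. f' (c *s v) = c * f' v)"
    using l by (auto intro!: exI simp: algebra_simps)
qed

lemma holomorphic_vec_on_mult:
  assumes "f holomorphic_vec_on S" "g holomorphic_vec_on S"
  shows "(\<lambda>v. f v * g v) holomorphic_vec_on S"
  unfolding holomorphic_vec_on_def
proof
  fix z assume "z \<in> S"
  then obtain f' g' where "(f has_derivative f') (at z within S)" "(g has_derivative g') (at z within S)"
    and l: "\<And>c v. f' (c *s v) = c * f' v" "\<And>c v. g' (c *s v) = c * g' v"
    using assms unfolding holomorphic_vec_on_def by meson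
  then have "((\<lambda>v. f v * g v) has_derivative (\<lambda>h. f z * g' h + f' h * g z)) (at z within S)"
    by (intro has_derivative_mult)
  then show "\<exists>f'. ((\<lambda>v. f v * g v) has_derivative f') (at z within S) \<and> (\<forall>c v. f' (c *s v) = c * f' v)"
    using l by (auto intro!: exI simp: algebra_simps)
qed

lemma holomorphic_vec_on_power:
  "f holomorphic_vec_on S \<Longrightarrow> (\<lambda>v. f v ^ n) holomorphic_vec_on S"
  by (induction n) (simp_all add: holomorphic_vec_on_const holomorphic_vec_on_mult)

lemma holomorphic_vec_on_sum:
  "(\<And>j. j \<in> J \<Longrightarrow> f j holomorphic_vec_on S) \<Longrightarrow> (\<lambda>v. \<Sum>j\<in>J. f j v) holomorphic_vec_on S"
  by (induction J rule: infinite_finite_induct) (simp_all add: holomorphic_vec_on_const holomorphic_vec_on_add)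

lemma holomorphic_vec_on_coordinate:
  assumes h: "h holomorphic_on ball 0 1"
  shows "(\<lambda>v :: complex ^ 3. h (v $ i)) holomorphic_vec_on polydisc"
  unfolding holomorphic_vec_on_def
proof
  fix z :: "complex ^ 3" assume "z \<in> polydisc"
  then have "z $ i \<in> ball 0 1" by (simp add: polydisc_def)
  then have "(h has_field_derivative deriv h (z $ i)) (at (z $ i))"
    by (rule holomorphic_derivI[OF h open_ball])
  then have "(h has_derivative (*) (deriv h (z $ i))) (at (z $ i))"
    by (simp add: has_field_derivative_def)
  from has_derivative_compose[OF bounded_linear_imp_has_derivative[OF bounded_linear_vec_nth] this]
  have "((\<lambda>v. h (v $ i)) has_derivative (\<lambda>v. deriv h (z $ i) * v $ i)) (at z within polydisc)" .
  then show "\<exists>f'. ((\<lambda>v. h (v $ i)) has_derivative f') (at z within polydisc) \<and> (\<forall>c v. f' (c *s v) = c * f' v)"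
    by (intro exI[of _ "\<lambda>v. deriv h (z $ i) * v $ i"]) (simp add: algebra_simps)
qed

text \<open>g runs along a complex line of direction e. Complex linearity of the real derivative f'
  turns the chain rule into multiplication by f' e, which is a complex derivative.\<close>

lemma holomorphic_vec_on_slice:
  assumes f: "f holomorphic_vec_on (polydisc :: (complex ^ 3) set)"
    and g: "\<And>x. norm x < 1 \<Longrightarrow> g x \<in> polydisc"
    and gd: "\<And>x. (g has_derivative (\<lambda>h. h *s e)) (at x)"
  shows "(\<lambda>x. f (g x)) holomorphic_on ball 0 1"
proof (rule holomorphic_onI)
  fix x :: complex assume x: "x \<in> ball 0 1"
  then have "g x \<in> polydisc" using g by simp
  then obtain f' where f': "(f has_derivative f') (at (g x) within polydisc)"
    and l: "\<And>c v. f' (c *s v) = c * f' v"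
    using f unfolding holomorphic_vec_on_def by meson
  then have "(f has_derivative f') (at (g x))"
    using \<open>g x \<in> polydisc\<close> by (simp add: at_within_open[OF _ open_polydisc])
  from has_derivative_compose[OF gd this]
  have "((\<lambda>x. f (g x)) has_derivative (\<lambda>h. h * f' e)) (at x)" by (simp add: l)
  then have "((\<lambda>x. f (g x)) has_field_derivative f' e) (at x)"
    by (simp add: has_field_derivative_def mult_commute_abs)
  then have "(\<lambda>x. f (g x)) field_differentiable at x"
    by (auto simp: field_differentiable_def)
  then show "(\<lambda>x. f (g x)) field_differentiable at x within ball 0 1"
    by (rule field_differentiable_at_within)
qed

lemma vec3_slices:
  "((\<lambda>x. vec3 x y z) has_derivative (\<lambda>h. h *s vec3 1 0 0)) (at x0)"
  "((\<lambda>y. vec3 x y z) has_derivative (\<lambda>h. h *s vec3 0 1 0)) (at y0)"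
  "((\<lambda>z. vec3 x y z) has_derivative (\<lambda>h. h *s vec3 0 0 1)) (at z0)"
proof -
  have lin: "bounded_linear (\<lambda>h::complex. h *s e)" for e :: "complex ^ 3"
  proof (rule linear_conv_bounded_linear[THEN iffD1], rule linearI)
    fix r :: real and h :: complex
    show "(r *\<^sub>R h) *s e = r *\<^sub>R (h *s e)" by (simp add: vec_eq_iff)
  qed (simp add: vec_eq_iff algebra_simps)
  have *: "((\<lambda>h. k + h *s e) has_derivative (\<lambda>h. h *s e)) (at x0)" for k e :: "complex ^ 3" and x0
    using has_derivative_add[OF has_derivative_const bounded_linear_imp_has_derivative[OF lin]] by simp
  have **: "(f has_derivative (\<lambda>h. h *s e)) (at x0)" if "\<And>h. f h = f 0 + h *s e" for f :: "complex \<Rightarrow> complex ^ 3" and e x0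
  proof -
    have "((\<lambda>h. f 0 + h *s e) has_derivative (\<lambda>h. h *s e)) (at x0)" by (rule *)
    then show ?thesis unfolding that[symmetric] .
  qed
  show "((\<lambda>x. vec3 x y z) has_derivative (\<lambda>h. h *s vec3 1 0 0)) (at x0)"
    "((\<lambda>y. vec3 x y z) has_derivative (\<lambda>h. h *s vec3 0 1 0)) (at y0)"
    "((\<lambda>z. vec3 x y z) has_derivative (\<lambda>h. h *s vec3 0 0 1)) (at z0)"
    by (rule **, simp add: vec_eq_iff forall_3)+
qed

lemma holomorphic_vec_on_imp_continuous_on:
  assumes "f holomorphic_vec_on S"
  shows "continuous_on S f"
  unfolding continuous_on_eq_continuous_within
proof
  fix z assume "z \<in> S"
  then obtain f' where "(f has_derivative f') (at z within S)"
    using assms unfolding holomorphic_vec_on_def by meson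
  then show "continuous (at z within S) f" by (rule has_derivative_continuous)
qed

lemma holomorphic_vec_on_compose:
  fixes \<phi> :: "complex ^ 'n \<Rightarrow> complex ^ 'n"
  assumes f: "f holomorphic_vec_on polydisc" and \<phi>: "\<phi> \<in> polydisc_maps"
  shows "(f \<circ> \<phi>) holomorphic_vec_on polydisc"
  unfolding holomorphic_vec_on_def
proof
  fix z :: "complex ^ 'n" assume z: "z \<in> polydisc"
  then have im: "\<phi> ` polydisc \<subseteq> polydisc" and hol: "\<And>i. (\<lambda>z. \<phi> z $ i) holomorphic_vec_on polydisc"
    using \<phi> by (auto simp: polydisc_maps_def)
  then have "\<phi> z \<in> polydisc" using z by auto
  then obtain f' where f': "(f has_derivative f') (at (\<phi> z) within polydisc)" and l: "\<And>c v. f' (c *s v) = c * f' v"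
    using f unfolding holomorphic_vec_on_def by meson
  have "\<forall>i. \<exists>g'. ((\<lambda>z. \<phi> z $ i) has_derivative g') (at z within polydisc) \<and> (\<forall>c v. g' (c *s v) = c * g' v)"
    using hol z unfolding holomorphic_vec_on_def by blast
  then obtain g' where g': "\<And>i. ((\<lambda>z. \<phi> z $ i) has_derivative g' i) (at z within polydisc)"
    and lg: "\<And>i c v. g' i (c *s v) = c * g' i v" by metis
  have "(\<phi> has_derivative (\<lambda>h. \<chi> i. g' i h)) (at z within polydisc)"
  proof (subst has_derivative_componentwise_within, rule ballI)
    fix b :: "complex ^ 'n" assume "b \<in> Basis"
    then obtain i u where b: "b = axis i u" by (auto simp: Basis_vec_def)
    show "((\<lambda>x. \<phi> x \<bullet> b) has_derivative (\<lambda>x. (\<chi> i. g' i x) \<bullet> b)) (at z within polydisc)"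
      unfolding b inner_axis using has_derivative_inner_left[OF g'[of i], of u] by simp
  qed
  moreover have "(f has_derivative f') (at (\<phi> z) within \<phi> ` polydisc)"
    using f' im by (rule has_derivative_subset)
  ultimately have "(f \<circ> \<phi> has_derivative f' \<circ> (\<lambda>h. \<chi> i. g' i h)) (at z within polydisc)"
    by (rule diff_chain_within)
  moreover have "(\<chi> i. g' i (c *s v)) = c *s (\<chi> i. g' i v)" for c v
    by (simp add: vec_eq_iff lg)
  ultimately show "\<exists>f'. (f \<circ> \<phi> has_derivative f') (at z within polydisc) \<and> (\<forall>c v. f' (c *s v) = c * f' v)"
    by (intro exI[of _ "f' \<circ> (\<lambda>h. \<chi> i. g' i h)"]) (simp add: l)
qed

section \<open>The map attached to a contact function: size and regularity\<close>

locale contact_map =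
  fixes U V :: "complex \<Rightarrow> complex" and p p' k K :: real
  assumes p_gt_1: "1 < p" and p'_pos: "0 < p'"
    and continuous_V: "continuous_on (cball 0 1) V"
    and deriv_U: "norm z \<le> 1 \<Longrightarrow> (U has_field_derivative V z) (at z within cball 0 1)"
    and Re_U_nonneg: "norm z \<le> 1 \<Longrightarrow> 0 \<le> Re (U z)"
    and k_pos: "0 < k" and K_nonneg: "0 \<le> K"
    and Re_U_ge: "norm \<zeta> = 1 \<Longrightarrow> k * norm (\<zeta> - 1) powr p \<le> Re (U \<zeta>)"
    and Re_U_le: "norm \<zeta> = 1 \<Longrightarrow> Re (U \<zeta>) \<le> K * norm (\<zeta> - 1) powr p'"
begin

text \<open>|g(z)| = |z| exp(- Re U(z)): the first factor forces |z| near 1 when |g(z)| is near 1,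
  and the second then forces z near the point 1, where Re U is small.\<close>

definition g :: "complex \<Rightarrow> complex" where "g z = z * exp (- U z)"

definition \<psi> :: "complex ^ 3 \<Rightarrow> complex" where "\<psi> v = g (v $ 1) * v $ 2 * v $ 3"

text \<open>The image lies in the disc of points (w, w, 0). Evaluation there is as expensive as at a
  boundary point of the bidisc, while the third coordinate, kept at the centre, costs only a
  constant.\<close>

definition \<Phi> :: "complex ^ 3 \<Rightarrow> complex ^ 3" where "\<Phi> v = vec3 (\<psi> v) (\<psi> v) 0"

lemma continuous_U: "continuous_on (cball 0 1) U"
  by (rule DERIV_continuous_on) (use deriv_U in auto)

lemma norm_g: "norm (g z) = norm z * exp (- Re (U z))"
  by (simp add: g_def norm_mult)

lemma norm_g_le:
  assumes "norm z \<le> 1"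
  shows "norm (g z) \<le> norm z"
  unfolding norm_g using Re_U_nonneg[OF assms] by (intro mult_left_le) auto

lemma norm_\<psi>: "norm (\<psi> v) = norm (g (v $ 1)) * norm (v $ 2) * norm (v $ 3)"
  by (simp add: \<psi>_def norm_mult)

lemma norm_\<psi>_le:
  assumes "v \<in> polydisc"
  shows "norm (\<psi> v) \<le> norm (g (v $ 1))" "norm (\<psi> v) \<le> norm (v $ 2)" "norm (\<psi> v) \<le> norm (v $ 3)"
proof -
  have v: "norm (v $ 1) \<le> 1" "norm (v $ 2) \<le> 1" "norm (v $ 3) \<le> 1"
    using assms by (auto simp: polydisc_def less_imp_le)
  then have g: "norm (g (v $ 1)) \<le> 1" using norm_g_le[of "v $ 1"] by linarith
  show "norm (\<psi> v) \<le> norm (g (v $ 1))"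
    unfolding norm_\<psi> mult.assoc using v by (intro mult_left_le mult_le_one) auto
  have "norm (\<psi> v) = norm (v $ 2) * (norm (g (v $ 1)) * norm (v $ 3))"
    by (simp add: norm_\<psi> mult_ac)
  also have "\<dots> \<le> norm (v $ 2)" using v g by (intro mult_left_le mult_le_one) auto
  finally show "norm (\<psi> v) \<le> norm (v $ 2)" .
  have "norm (\<psi> v) = norm (v $ 3) * (norm (g (v $ 1)) * norm (v $ 2))"
    by (simp add: norm_\<psi> mult_ac)
  also have "\<dots> \<le> norm (v $ 3)" using v g by (intro mult_left_le mult_le_one) auto
  finally show "norm (\<psi> v) \<le> norm (v $ 3)" .
qed

lemma norm_\<psi>_less_1: "v \<in> polydisc \<Longrightarrow> norm (\<psi> v) < 1"
  using norm_\<psi>_le(2)[of v] by (auto simp: polydisc_def dest: spec[of _ 2])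

text \<open>The contact estimates hold on the circle only. The bounded derivative transfers them
  between z and \<open>sgn z\<close> at a cost of order 1 - |z|.\<close>

lemma U_lipschitz:
  obtains L where "0 \<le> L" "\<And>z w. norm z \<le> 1 \<Longrightarrow> norm w \<le> 1 \<Longrightarrow> \<bar>Re (U z) - Re (U w)\<bar> \<le> L * norm (z - w)"
proof -
  have "bounded (V ` cball 0 1)"
    using continuous_V by (intro compact_imp_bounded compact_continuous_image) auto
  then obtain L where L: "\<And>z. norm z \<le> 1 \<Longrightarrow> norm (V z) \<le> L"
    unfolding bounded_iff by (metis imageI mem_cball_0)
  show ?thesis
  proof (rule that)
    show "0 \<le> L" using order_trans[OF norm_ge_zero L[of 0]] by simp
    fix z w :: complex assume zw: "norm z \<le> 1" "norm w \<le> 1"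
    have "norm (U z - U w) \<le> L * norm (z - w)"
      by (rule field_differentiable_bound[of "cball 0 1"]) (use deriv_U L zw in auto)
    then show "\<bar>Re (U z) - Re (U w)\<bar> \<le> L * norm (z - w)"
      using abs_Re_le_cmod[of "U z - U w"] by simp
  qed
qed

lemma g_deriv:
  assumes "norm z < 1"
  shows "(g has_field_derivative exp (- U z) * (1 - z * V z)) (at z)"
proof -
  have "(U has_field_derivative V z) (at z within ball 0 1)"
    by (rule DERIV_subset[OF deriv_U]) (use assms in auto)
  then have "(U has_field_derivative V z) (at z)"
    using assms by (simp add: at_within_open[OF _ open_ball])
  then show ?thesis unfolding g_def
    by (auto intro!: derivative_eq_intros simp: algebra_simps)
qed

lemma g_holomorphic: "g holomorphic_on ball 0 1"
proof (rule holomorphic_onI)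
  fix z :: complex assume "z \<in> ball 0 1"
  then have "g field_differentiable at z"
    using g_deriv[of z] by (auto simp: field_differentiable_def)
  then show "g field_differentiable at z within ball 0 1"
    by (rule field_differentiable_at_within)
qed

lemma \<psi>_holomorphic: "\<psi> holomorphic_vec_on polydisc"
  unfolding \<psi>_def by (intro holomorphic_vec_on_mult holomorphic_vec_on_nth holomorphic_vec_on_coordinate g_holomorphic)

lemma \<Phi>_polydisc_maps: "\<Phi> \<in> polydisc_maps"
proof -
  have "(\<lambda>z. \<Phi> z $ i) holomorphic_vec_on polydisc" for i
    using exhaust_3[of i] by (auto simp: \<Phi>_def \<psi>_holomorphic holomorphic_vec_on_const)
  moreover have "\<Phi> z \<in> polydisc" if "z \<in> polydisc" for z
    using that by (simp add: \<Phi>_def norm_\<psi>_less_1)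
  ultimately show ?thesis by (auto simp: polydisc_maps_def)
qed

lemma continuous_coordinate:
  fixes h :: "complex \<Rightarrow> complex"
  assumes "continuous_on (cball 0 1) h"
  shows "continuous_on closed_polydisc (\<lambda>v :: complex ^ 3. h (v $ i))"
  by (rule continuous_on_compose2[OF assms]) (auto intro!: continuous_intros simp: closed_polydisc_def)

lemma \<Phi>_C1: "Ck_closed_polydisc 1 (\<lambda>z. \<Phi> z $ i)"
proof -
  have cg: "continuous_on (cball 0 1) g"
    unfolding g_def by (intro continuous_intros continuous_U)
  have cdg: "continuous_on (cball 0 1) (\<lambda>z. exp (- U z) * (1 - z * V z))"
    by (intro continuous_intros continuous_U continuous_V)
  have 0: "extends_continuously \<psi>"
    unfolding extends_continuously_def \<psi>_def
    by (intro exI[of _ "\<lambda>v. g (v $ 1) * v $ 2 * v $ 3"]) (auto intro!: continuous_intros continuous_coordinate cg)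
  have d1: "complex_partial 1 \<psi> v = exp (- U (v $ 1)) * (1 - v $ 1 * V (v $ 1)) * v $ 2 * v $ 3" if "v \<in> polydisc" for v
    unfolding complex_partial_def \<psi>_def
    by (rule DERIV_imp_deriv) (use that in \<open>auto intro!: derivative_eq_intros g_deriv simp: polydisc_def\<close>)
  have d2: "complex_partial 2 \<psi> v = g (v $ 1) * v $ 3" if "v \<in> polydisc" for v
    unfolding complex_partial_def \<psi>_def
    by (rule DERIV_imp_deriv) (auto intro!: derivative_eq_intros)
  have d3: "complex_partial 3 \<psi> v = g (v $ 1) * v $ 2" if "v \<in> polydisc" for v
    unfolding complex_partial_def \<psi>_def
    by (rule DERIV_imp_deriv) (auto intro!: derivative_eq_intros)
  have "extends_continuously (complex_partial j \<psi>)" for j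
  proof -
    consider "j = 1" | "j = 2" | "j = 3" using exhaust_3 by blast
    then show ?thesis
    proof cases
      case 1
      show ?thesis unfolding extends_continuously_def \<open>j = 1\<close>
        by (intro exI[of _ "\<lambda>v. exp (- U (v $ 1)) * (1 - v $ 1 * V (v $ 1)) * v $ 2 * v $ 3"] conjI
             continuous_intros continuous_coordinate[OF cdg] ballI d1[symmetric])
    next
      case 2
      show ?thesis unfolding extends_continuously_def \<open>j = 2\<close>
        by (intro exI[of _ "\<lambda>v. g (v $ 1) * v $ 3"] conjI
             continuous_intros continuous_coordinate[OF cg] ballI d2[symmetric])
    next
      case 3
      show ?thesis unfolding extends_continuously_def \<open>j = 3\<close>
        by (intro exI[of _ "\<lambda>v. g (v $ 1) * v $ 2"] conjI
             continuous_intros continuous_coordinate[OF cg] ballI d3[symmetric])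
    qed
  qed
  with 0 have \<psi>: "Ck_closed_polydisc 1 \<psi>" by simp
  have "extends_continuously (\<lambda>v :: complex ^ 3. 0)"
    unfolding extends_continuously_def by (intro exI[of _ "\<lambda>v. 0"]) auto
  moreover have "complex_partial j (\<lambda>v :: complex ^ 3. 0) = (\<lambda>v. 0)" for j
    by (simp add: complex_partial_def fun_eq_iff)
  ultimately have "Ck_closed_polydisc 1 (\<lambda>v :: complex ^ 3. 0)" by simp
  with \<psi> show ?thesis
    using exhaust_3[of i] by (auto simp: \<Phi>_def)
qed

section \<open>Measure of the preimages of Carleson boxes\<close>

definition \<psi>0 :: "complex ^ 3 \<Rightarrow> complex" where "\<psi>0 v = (if v \<in> polydisc then \<psi> v else 0)"

text \<open>U is arbitrary off the closed disc, so \<psi> may fail to be measurable as a total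
  function; the cut-off version can enter Fubini integrals.\<close>

lemma \<psi>0_borel [measurable]: "\<psi>0 \<in> borel_measurable borel"
  unfolding \<psi>0_def
  by (rule borel_measurable_continuous_on_if)
     (auto intro: holomorphic_vec_on_imp_continuous_on \<psi>_holomorphic)

text \<open>With a = \<beta> + 1 the hypothesis reads - \<beta> \<le> 1/p. It enters only at the
  end, where \<delta> \<le> 1 lets the exponent 1 + 3a + 1/p be lowered to 2 + 2a, the exponent that
  \<open>polydisc_submean\<close> requires.\<close>

lemma carleson:
  assumes \<mu>: "radial_tails \<mu> a c C" and a: "1 - a \<le> 1 / p"
  obtains B where "0 \<le> B" "\<And>w. norm w < 1 \<Longrightarrow>
    emeasure (vec_product_measure \<mu>) {v \<in> polydisc. norm (\<psi>0 v - w) < 1 - norm w} \<le> ennreal (B * (1 - norm w) powr (2 + 2 * a))"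
proof -
  interpret radial_tails \<mu> a c C by fact
  interpret P: prob_space "vec_product_measure \<mu> :: (complex ^ 3) measure"
    by (rule prob_space_vec_product_measure) (auto intro: prob_space_axioms)
  obtain L where L: "0 \<le> L" "\<And>z w. norm z \<le> 1 \<Longrightarrow> norm w \<le> 1 \<Longrightarrow> \<bar>Re (U z) - Re (U w)\<bar> \<le> L * norm (z - w)"
    using U_lipschitz by blast
  \<comment> \<open>Solves k |sgn x - 1|^p \<le> (4 + 2L) \<delta> for the angle: 4 \<delta> bounds
    Re U(x), and 2 L \<delta> is the price of passing from x to \<open>sgn x\<close>.\<close>
  define \<kappa> where "\<kappa> = ((4 + 2 * L) / k) powr (1 / p)"
  define B0 where "B0 = 8 * \<kappa> * (C * 2 powr a) ^ 3"
  \<comment> \<open>\<open>B0\<close> collects the constants for \<delta> < 1/4; the other term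
    makes the bound at least the total mass 1 when \<delta> \<ge> 1/4.\<close>
  define B where "B = max B0 (4 powr (2 + 2 * a))"
  have \<kappa>: "0 \<le> \<kappa>" by (simp add: \<kappa>_def)
  have "0 \<le> B" by (simp add: B_def le_max_iff_disj)
  moreover have "emeasure (vec_product_measure \<mu>) {v \<in> polydisc. norm (\<psi>0 v - w) < 1 - norm w}
    \<le> ennreal (B * (1 - norm w) powr (2 + 2 * a))" if w: "norm w < 1" for w
  proof -
    define \<delta> where "\<delta> = 1 - norm w"
    have \<delta>: "0 < \<delta>" "\<delta> \<le> 1" using w by (auto simp: \<delta>_def)
    define E where "E = {v \<in> polydisc. norm (\<psi>0 v - w) < \<delta>}"
    have [measurable]: "E \<in> sets borel" unfolding E_def by measurable
    show ?thesis
    proof (cases "\<delta> < 1/4")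
      case False
      have "1 = 4 powr (2 + 2 * a) * (1/4) powr (2 + 2 * a)"
        by (simp flip: powr_mult)
      also have "\<dots> \<le> B * \<delta> powr (2 + 2 * a)"
        using False a_nonneg \<delta> by (intro mult_mono powr_mono2) (auto simp: B_def le_max_iff_disj)
      finally have "ennreal 1 \<le> ennreal (B * \<delta> powr (2 + 2 * a))" by (rule ennreal_leI)
      then show ?thesis
        using P.emeasure_le_1[of E] unfolding E_def \<delta>_def ennreal_1 by (rule order_trans[rotated])
    next
      case True
      define \<rho> where "\<rho> = \<kappa> * \<delta> powr (1 / p)"
      define T where "T = {y::complex. 1 - 2 * \<delta> \<le> norm y}"
      define Z where "Z x y = {z. vec3 x y z \<in> E}" for x y
      have [measurable]: "T \<in> sets borel" unfolding T_def by measurable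
      have [measurable]: "Z x y \<in> sets borel" for x y unfolding Z_def by measurable
      have big: "1 - 2 * \<delta> \<le> norm (\<psi> v)" if "v \<in> E" for v
      proof -
        have "norm (\<psi> v - w) < \<delta>" using that by (auto simp: E_def \<psi>0_def)
        then show ?thesis using norm_triangle_ineq2[of w "\<psi> v"] by (simp add: \<delta>_def norm_minus_commute)
      qed
      have x_in: "v $ 1 \<in> sector 1 (2 * \<delta>) \<rho>" if v: "v \<in> E" for v
      proof -
        define x where "x = v $ 1"
        have vP: "v \<in> polydisc" using v by (simp add: E_def)
        then have x1: "norm x < 1" by (simp add: polydisc_def x_def)
        have gx: "1 - 2 * \<delta> \<le> norm (g x)"
          using big[OF v] norm_\<psi>_le(1)[OF vP] by (simp add: x_def)
        then have nx: "1 - 2 * \<delta> \<le> norm x" using norm_g_le[of x] x1 by simp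
        then have "x \<noteq> 0" using True by auto
        have "norm x * exp (- Re (U x)) \<le> 1 * exp (- Re (U x))"
          using x1 by (intro mult_right_mono) auto
        with gx have "1 - 2 * \<delta> \<le> exp (- Re (U x))" unfolding norm_g by linarith
        then have "ln (1 - 2 * \<delta>) \<le> ln (exp (- Re (U x)))"
          using True by (intro ln_mono) auto
        then have "ln (1 - 2 * \<delta>) \<le> - Re (U x)" by simp
        \<comment> \<open>\<delta> < 1/4 serves twice: 2 \<delta> \<le> 1/2 for the logarithm bound,
          and 8 \<delta>^2 \<le> 2 \<delta>.\<close>
        moreover have "- (2 * \<delta>) - 2 * (2 * \<delta>)\<^sup>2 \<le> ln (1 - 2 * \<delta>)"
          by (rule ln_one_minus_pos_lower_bound) (use \<delta> True in auto)
        moreover have "2 * (2 * \<delta>)\<^sup>2 \<le> 2 * \<delta>"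
          using \<delta> True mult_right_mono[of "4 * \<delta>" 1 "2 * \<delta>"] by (simp add: power2_eq_square)
        ultimately have "Re (U x) \<le> 4 * \<delta>" by linarith
        moreover have "\<bar>Re (U (sgn x)) - Re (U x)\<bar> \<le> L * norm (sgn x - x)"
          by (rule L(2)) (use x1 in \<open>auto simp: norm_sgn\<close>)
        moreover have "norm (sgn x - x) = 1 - norm x"
        proof -
          have "sgn x - x = (1 - norm x) *\<^sub>R sgn x"
            using \<open>x \<noteq> 0\<close> by (simp add: scaleR_diff_left left_diff_distrib sgn_div_norm)
          then show ?thesis using \<open>x \<noteq> 0\<close> x1 by (simp add: norm_sgn)
        qed
        moreover have "L * (1 - norm x) \<le> L * (2 * \<delta>)"
          using nx L by (intro mult_left_mono) auto
        moreover have "k * norm (sgn x - 1) powr p \<le> Re (U (sgn x))"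
          by (rule Re_U_ge) (use \<open>x \<noteq> 0\<close> in \<open>simp add: norm_sgn\<close>)
        ultimately have "k * norm (sgn x - 1) powr p \<le> (4 + 2 * L) * \<delta>"
          by (simp add: algebra_simps)
        then have "norm (sgn x - 1) powr p \<le> (4 + 2 * L) / k * \<delta>"
          using k_pos by (simp add: field_simps)
        then have "(norm (sgn x - 1) powr p) powr (1 / p) \<le> ((4 + 2 * L) / k * \<delta>) powr (1 / p)"
          using p_gt_1 by (intro powr_mono2) auto
        also have "\<dots> = \<rho>"
          unfolding \<rho>_def \<kappa>_def by (subst powr_mult) (use L(1) k_pos \<delta> in auto)
        finally have "norm (sgn x - 1) \<le> \<rho>" using p_gt_1 by (simp add: powr_powr)
        then show ?thesis using nx by (simp add: sector_def x_def)
      qed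
      have y_in: "v $ 2 \<in> T" if v: "v \<in> E" for v
        using big[OF v] norm_\<psi>_le(2)[of v] v by (auto simp: T_def E_def)
      \<comment> \<open>For fixed x and y the function is linear in z, namely z u, and |z u| \<ge>
        1/2 on the slice. Any member z0 can serve as centre: two values z u and z0 u differ by at
        most 2 \<delta>, so |z - z0|/|z0| \<le> 4 \<delta>, and projecting to the circle doubles
        this to 8 \<delta>.\<close>
      have Z: "emeasure \<mu> (Z x y) \<le> ennreal (8 * \<delta> * (C * (2 * \<delta>) powr a))" for x y
      proof (cases "Z x y = {}")
        case False
        then obtain z0 where z0: "z0 \<in> Z x y" by blast
        define u where "u = g x * y"
        have Zu: "norm (z * u - w) < \<delta>" "1 - 2 * \<delta> \<le> norm (z * u)" "1 - 2 * \<delta> \<le> norm z" if "z \<in> Z x y" for z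
        proof -
          have vE: "vec3 x y z \<in> E" using that by (simp add: Z_def)
          have "\<psi> (vec3 x y z) = z * u" by (simp add: \<psi>_def u_def)
          then show "norm (z * u - w) < \<delta>" "1 - 2 * \<delta> \<le> norm (z * u)"
            using vE big[OF vE] by (auto simp: E_def \<psi>0_def)
          show "1 - 2 * \<delta> \<le> norm z"
            using big[OF vE] norm_\<psi>_le(3)[of "vec3 x y z"] vE by (auto simp: E_def)
        qed
        have "Z x y \<subseteq> sector (sgn z0) (2 * \<delta>) (8 * \<delta>)"
        proof
          fix z assume z: "z \<in> Z x y"
          have nz: "z \<noteq> 0" "z0 \<noteq> 0" "u \<noteq> 0" using Zu(2)[OF z] Zu(2)[OF z0] True by auto
          have "norm ((z - z0) * u) \<le> norm (z * u - w) + norm (z0 * u - w)"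
            using norm_triangle_ineq4[of "z * u - w" "z0 * u - w"] by (simp add: algebra_simps)
          then have 1: "norm (z - z0) * norm u \<le> 2 * \<delta>"
            using Zu(1)[OF z] Zu(1)[OF z0] by (simp add: norm_mult)
          have 2: "1/2 \<le> norm z0 * norm u" using Zu(2)[OF z0] True by (simp add: norm_mult)
          have "norm (z - z0) / norm z0 = (norm (z - z0) * norm u) / (norm z0 * norm u)"
            using nz by simp
          also have "\<dots> \<le> (2 * \<delta>) / (1/2)"
            using 1 2 \<delta> by (intro frac_le) auto
          finally have "norm (sgn z - sgn z0) \<le> 8 * \<delta>"
            using norm_sgn_diff_le[OF nz(1,2)] by simp
          then show "z \<in> sector (sgn z0) (2 * \<delta>) (8 * \<delta>)"
            using Zu(3)[OF z] by (simp add: sector_def)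
        qed
        then have "emeasure \<mu> (Z x y) \<le> emeasure \<mu> (sector (sgn z0) (2 * \<delta>) (8 * \<delta>))"
          by (intro emeasure_mono) auto
        also have "\<dots> \<le> ennreal (8 * \<delta> * (C * (2 * \<delta>) powr a))"
          by (rule emeasure_sector_le) (use \<delta> True Zu(2)[OF z0] in \<open>auto simp: norm_sgn\<close>)
        finally show ?thesis .
      qed simp
      have "emeasure (vec_product_measure \<mu>) E = (\<integral>\<^sup>+v. indicator E v \<partial>vec_product_measure \<mu>)"
        by simp
      also have "\<dots> = (\<integral>\<^sup>+x. \<integral>\<^sup>+y. \<integral>\<^sup>+z. indicator E (vec3 x y z) \<partial>\<mu> \<partial>\<mu> \<partial>\<mu>)"
        by (rule nn_integral_vec3) (auto intro: sigma_finite_measure_axioms)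
      \<comment> \<open>A nonempty slice already confines x and y, and the bound on its measure is
        uniform in them; the triple integral is thus dominated by a product.\<close>
      also have "\<dots> \<le> (\<integral>\<^sup>+x. \<integral>\<^sup>+y. ennreal (8 * \<delta> * (C * (2 * \<delta>) powr a)) * indicator (sector 1 (2 * \<delta>) \<rho>) x * indicator T y \<partial>\<mu> \<partial>\<mu>)"
      proof (intro nn_integral_mono)
        fix x y
        have "(\<integral>\<^sup>+z. indicator E (vec3 x y z) \<partial>\<mu>) = (\<integral>\<^sup>+z. indicator (Z x y) z \<partial>\<mu>)"
          by (intro nn_integral_cong) (auto simp: Z_def split: split_indicator)
        also have "\<dots> = emeasure \<mu> (Z x y)" by simp
        also have "\<dots> \<le> ennreal (8 * \<delta> * (C * (2 * \<delta>) powr a)) * indicator (sector 1 (2 * \<delta>) \<rho>) x * indicator T y"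
        proof (cases "Z x y = {}")
          case False
          then obtain z where "vec3 x y z \<in> E" by (auto simp: Z_def)
          from x_in[OF this] y_in[OF this] Z[of x y] show ?thesis by simp
        qed simp
        finally show "(\<integral>\<^sup>+z. indicator E (vec3 x y z) \<partial>\<mu>)
          \<le> ennreal (8 * \<delta> * (C * (2 * \<delta>) powr a)) * indicator (sector 1 (2 * \<delta>) \<rho>) x * indicator T y" .
      qed
      also have "\<dots> = (\<integral>\<^sup>+x. ennreal (8 * \<delta> * (C * (2 * \<delta>) powr a)) * emeasure \<mu> T * indicator (sector 1 (2 * \<delta>) \<rho>) x \<partial>\<mu>)"
        by (subst nn_integral_cmult_indicator) (auto simp: mult_ac)
      also have "\<dots> = ennreal (8 * \<delta> * (C * (2 * \<delta>) powr a)) * emeasure \<mu> T * emeasure \<mu> (sector 1 (2 * \<delta>) \<rho>)"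
        by (rule nn_integral_cmult_indicator) simp
      also have "\<dots> \<le> ennreal (8 * \<delta> * (C * (2 * \<delta>) powr a)) * ennreal (C * (2 * \<delta>) powr a) * ennreal (\<rho> * (C * (2 * \<delta>) powr a))"
        by (intro mult_mono emeasure_sector_le) (use \<delta> True \<kappa> tail_le[of "2 * \<delta>"] in \<open>auto simp: T_def \<rho>_def\<close>)
      also have "\<dots> = ennreal (8 * \<delta> * (C * (2 * \<delta>) powr a) * (C * (2 * \<delta>) powr a) * (\<rho> * (C * (2 * \<delta>) powr a)))"
        using \<delta> \<kappa> C_ge_1 by (simp add: ennreal_mult \<rho>_def)
      also have "8 * \<delta> * (C * (2 * \<delta>) powr a) * (C * (2 * \<delta>) powr a) * (\<rho> * (C * (2 * \<delta>) powr a))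
          = B0 * (\<delta> powr 1 * \<delta> powr a * \<delta> powr a * \<delta> powr a * \<delta> powr (1 / p))"
        using \<delta> by (simp add: B0_def \<rho>_def powr_mult power3_eq_cube)
      also have "\<delta> powr 1 * \<delta> powr a * \<delta> powr a * \<delta> powr a * \<delta> powr (1 / p) = \<delta> powr (1 + a + a + a + 1 / p)"
        by (simp only: powr_add)
      also have "ennreal (B0 * \<delta> powr (1 + a + a + a + 1 / p)) \<le> ennreal (B * \<delta> powr (2 + 2 * a))"
      proof (intro ennreal_leI mult_mono)
        show "\<delta> powr (1 + a + a + a + 1 / p) \<le> \<delta> powr (2 + 2 * a)"
          using \<delta> a by (intro powr_mono') auto
      qed (auto simp: B_def le_max_iff_disj)
      finally show ?thesis by (simp add: E_def \<delta>_def)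
    qed
  qed
  ultimately show ?thesis by (rule that)
qed

end

subsection \<open>Boundedness\<close>

lemma measurable_holomorphic_vec_sq:
  assumes "f holomorphic_vec_on (polydisc :: (complex ^ 3) set)"
  shows "(\<lambda>v. ennreal ((norm (f v))\<^sup>2) * indicator polydisc v) \<in> borel_measurable borel"
proof -
  have "(\<lambda>v. if v \<in> polydisc then f v else 0) \<in> borel_measurable borel"
    by (rule borel_measurable_continuous_on_if)
       (auto intro: holomorphic_vec_on_imp_continuous_on assms)
  then have "(\<lambda>v. ennreal ((norm (if v \<in> polydisc then f v else 0))\<^sup>2)) \<in> borel_measurable borel"
    by measurable
  also have "(\<lambda>v. ennreal ((norm (if v \<in> polydisc then f v else 0))\<^sup>2)) = (\<lambda>v. ennreal ((norm (f v))\<^sup>2) * indicator polydisc v)"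
    by (auto simp: fun_eq_iff)
  finally show ?thesis .
qed

text \<open>\<open>disc_submean\<close> is applied in each variable in turn: about 0 in the third,
  at the cost of a constant, and about b in the other two, at the cost of (1 - |b|)^(-\<beta> - 2)
  each. The localisation is kept in the first variable only, which suffices for comparing b with the
  first coordinate of v in the Fubini argument.\<close>

lemma polydisc_submean:
  assumes \<beta>: "-1 < \<beta>" "\<beta> \<le> 0" and f: "f holomorphic_vec_on (polydisc :: (complex ^ 3) set)"
    and b: "norm b < 1"
  shows "ennreal ((norm (f (vec3 b b 0)))\<^sup>2) \<le>
    ennreal ((4 * 3 powr - \<beta> / (\<beta> + 1)) ^ 3 * (1 - norm b) powr (- 2 * \<beta> - 4)) *
    (\<integral>\<^sup>+v. ennreal ((norm (f v))\<^sup>2) * indicator polydisc v * indicator {v. norm (v $ 1 - b) < (1 - norm b) / 2} v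
      \<partial>vec_product_measure (disc_measure \<beta>))"
proof -
  let ?\<mu> = "disc_measure \<beta>"
  interpret prob_space ?\<mu> by (rule prob_space_disc_measure) fact
  define F where "F v = ennreal ((norm (f v))\<^sup>2) * indicator polydisc v" for v
  have [measurable]: "F \<in> borel_measurable borel"
    unfolding F_def by (rule measurable_holomorphic_vec_sq[OF f])
  have Feq: "F v = ennreal ((norm (f v))\<^sup>2)" if "v \<in> polydisc" for v
    using that by (simp add: F_def)
  define k where "k = 4 * 3 powr - \<beta> / (\<beta> + 1)"
  have k: "0 \<le> k" using \<beta> by (simp add: k_def)
  define d where "d = 1 - norm b"
  define D where "D = ennreal (k * d powr (- \<beta> - 2))"
  have [measurable]: "ball b (d / 2) \<in> sets borel" by simp
  have s3: "F (vec3 x y 0) \<le> ennreal k * (\<integral>\<^sup>+z. F (vec3 x y z) \<partial>?\<mu>)" for x y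
  proof (cases "norm x < 1 \<and> norm y < 1")
    case True
    have "(\<lambda>z. f (vec3 x y z)) holomorphic_on ball 0 1"
      by (rule holomorphic_vec_on_slice[OF f _ vec3_slices(3)]) (use True in auto)
    then have "ennreal ((norm (f (vec3 x y 0)))\<^sup>2) \<le> ennreal (k * (1 - norm (0::complex)) powr (- \<beta> - 2)) *
       (\<integral>\<^sup>+z. F (vec3 x y z) * indicator (ball 0 ((1 - norm (0::complex)) / 2)) z \<partial>?\<mu>)"
      unfolding k_def by (rule disc_submean[OF \<beta>]) (use True in \<open>auto simp: Feq\<close>)
    also have "\<dots> \<le> ennreal k * (\<integral>\<^sup>+z. F (vec3 x y z) \<partial>?\<mu>)"
      by (auto intro!: mult_left_mono nn_integral_mono split: split_indicator)
    finally show ?thesis using True by (simp add: F_def)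
  qed (auto simp: F_def)
  have s2: "F (vec3 x b 0) \<le> D * (\<integral>\<^sup>+y. F (vec3 x y 0) \<partial>?\<mu>)" for x
  proof (cases "norm x < 1")
    case True
    have "(\<lambda>y. f (vec3 x y 0)) holomorphic_on ball 0 1"
      by (rule holomorphic_vec_on_slice[OF f _ vec3_slices(2)]) (use True in auto)
    then have "ennreal ((norm (f (vec3 x b 0)))\<^sup>2) \<le> D *
       (\<integral>\<^sup>+y. F (vec3 x y 0) * indicator (ball b ((1 - norm b) / 2)) y \<partial>?\<mu>)"
      unfolding D_def k_def d_def by (rule disc_submean[OF \<beta> _ b]) (use True b in \<open>auto simp: Feq\<close>)
    also have "\<dots> \<le> D * (\<integral>\<^sup>+y. F (vec3 x y 0) \<partial>?\<mu>)"
      by (auto intro!: mult_left_mono nn_integral_mono split: split_indicator)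
    finally show ?thesis using True b by (simp add: F_def)
  qed (auto simp: F_def)
  have "(\<lambda>x. f (vec3 x b 0)) holomorphic_on ball 0 1"
    by (rule holomorphic_vec_on_slice[OF f _ vec3_slices(1)]) (use b in auto)
  then have "ennreal ((norm (f (vec3 b b 0)))\<^sup>2) \<le> D *
     (\<integral>\<^sup>+x. F (vec3 x b 0) * indicator (ball b ((1 - norm b) / 2)) x \<partial>?\<mu>)"
    unfolding D_def k_def d_def by (rule disc_submean[OF \<beta> _ b]) (use b in \<open>auto simp: Feq\<close>)
  also have "\<dots> \<le> D * (\<integral>\<^sup>+x. D * (\<integral>\<^sup>+y. ennreal k * (\<integral>\<^sup>+z. F (vec3 x y z) \<partial>?\<mu>) \<partial>?\<mu>) * indicator (ball b (d / 2)) x \<partial>?\<mu>)"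
    unfolding d_def
    by (intro mult_left_mono nn_integral_mono mult_right_mono order_trans[OF s2] s3) auto
  also have "\<dots> = D * (\<integral>\<^sup>+x. D * (ennreal k * (\<integral>\<^sup>+y. \<integral>\<^sup>+z. F (vec3 x y z) * indicator (ball b (d / 2)) x \<partial>?\<mu> \<partial>?\<mu>)) \<partial>?\<mu>)"
    by (simp add: nn_integral_cmult nn_integral_multc mult.assoc)
  also have "\<dots> = D * (D * (ennreal k * (\<integral>\<^sup>+x. \<integral>\<^sup>+y. \<integral>\<^sup>+z. F (vec3 x y z) * indicator (ball b (d / 2)) x \<partial>?\<mu> \<partial>?\<mu> \<partial>?\<mu>)))"
    by (subst nn_integral_cmult, measurable)+
  also have "(\<integral>\<^sup>+x. \<integral>\<^sup>+y. \<integral>\<^sup>+z. F (vec3 x y z) * indicator (ball b (d / 2)) x \<partial>?\<mu> \<partial>?\<mu> \<partial>?\<mu>)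
     = (\<integral>\<^sup>+x. \<integral>\<^sup>+y. \<integral>\<^sup>+z. F (vec3 x y z) * indicator {v. norm (v $ 1 - b) < d / 2} (vec3 x y z) \<partial>?\<mu> \<partial>?\<mu> \<partial>?\<mu>)"
    by (intro nn_integral_cong) (auto simp: dist_norm norm_minus_commute split: split_indicator)
  also have "\<dots> = (\<integral>\<^sup>+v. F v * indicator {v. norm (v $ 1 - b) < d / 2} v \<partial>vec_product_measure ?\<mu>)"
    by (rule nn_integral_vec3[symmetric]) (auto intro: sigma_finite_measure_axioms)
  also have "D * (D * (ennreal k * u)) = ennreal (k ^ 3 * d powr (- 2 * \<beta> - 4)) * u" for u
  proof -
    have "D * D * ennreal k = ennreal (k ^ 3 * (d powr (- \<beta> - 2) * d powr (- \<beta> - 2)))"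
      using k by (simp add: D_def power3_eq_cube mult_ac flip: ennreal_mult)
    also have "d powr (- \<beta> - 2) * d powr (- \<beta> - 2) = d powr (- 2 * \<beta> - 4)"
      by (simp flip: powr_add)
    finally show ?thesis by (simp only: mult.assoc[symmetric])
  qed
  finally show ?thesis by (simp add: F_def d_def k_def)
qed

context contact_map
begin

text \<open>The Carleson embedding proved by hand. Bound |f|^2 at \<Phi> v by its local average and
  exchange integrals; for fixed w the integral over v is controlled by \<open>carleson\<close> at
  the first coordinate of w. The powers -2\<beta> - 4 and 2 + 2(\<beta> + 1) of \<delta>
  cancel.\<close>

lemma bergman_bounded:
  assumes \<beta>: "-1 < \<beta>" "\<beta> \<le> 0" and q: "- \<beta> \<le> 1 / p"
  obtains B where "0 \<le> B" "\<And>f. f holomorphic_vec_on polydisc \<Longrightarrow>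
    bergman_norm_sq \<beta> (f \<circ> \<Phi>) \<le> ennreal B * bergman_norm_sq \<beta> f"
proof -
  let ?V = "vec_product_measure (disc_measure \<beta>) :: (complex ^ 3) measure"
  interpret V: prob_space ?V
    by (rule prob_space_vec_product_measure) (use prob_space_disc_measure \<beta> in auto)
  interpret P: pair_sigma_finite ?V ?V ..
  obtain A where A: "0 \<le> A" "\<And>w. norm w < 1 \<Longrightarrow>
    emeasure ?V {v \<in> polydisc. norm (\<psi>0 v - w) < 1 - norm w} \<le> ennreal (A * (1 - norm w) powr (2 + 2 * (\<beta> + 1)))"
    by (rule carleson[OF radial_tails_disc[OF \<beta>(1)]]) (use q in auto)
  define k where "k = (4 * 3 powr - \<beta> / (\<beta> + 1)) ^ 3"
  have k: "0 \<le> k" using \<beta> by (simp add: k_def)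
  define e where "e = - 2 * \<beta> - 4"
  define B where "B = k * (2/3) powr e * A"
  have "0 \<le> B" using k A by (simp add: B_def)
  moreover have "bergman_norm_sq \<beta> (f \<circ> \<Phi>) \<le> ennreal B * bergman_norm_sq \<beta> f"
    if f: "f holomorphic_vec_on polydisc" for f
  proof -
    define F where "F v = ennreal ((norm (f v))\<^sup>2) * indicator polydisc v" for v
    have [measurable]: "F \<in> borel_measurable borel"
      unfolding F_def by (rule measurable_holomorphic_vec_sq[OF f])
    define N where "N v w = (if norm (w $ 1 - \<psi>0 v) < (1 - norm (\<psi>0 v)) / 2 then 1 else 0 :: ennreal)" for v w :: "complex ^ 3"
    have [measurable]: "(\<lambda>(v, w). N v w) \<in> borel_measurable (borel \<Otimes>\<^sub>M borel)"
      unfolding N_def by measurable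
    define R where "R v = ennreal (k * (1 - norm (\<psi>0 v)) powr e) * indicator polydisc v" for v
    have [measurable]: "R \<in> borel_measurable borel" unfolding R_def by measurable
    have "bergman_norm_sq \<beta> (f \<circ> \<Phi>) \<le> (\<integral>\<^sup>+v. \<integral>\<^sup>+w. R v * (F w * N v w) \<partial>?V \<partial>?V)"
      unfolding bergman_norm_sq_def
    proof (rule nn_integral_mono)
      fix v :: "complex ^ 3"
      show "ennreal ((norm ((f \<circ> \<Phi>) v))\<^sup>2) * indicator polydisc v \<le> (\<integral>\<^sup>+w. R v * (F w * N v w) \<partial>?V)"
      proof (cases "v \<in> polydisc")
        case True
        have "ennreal ((norm (f (vec3 (\<psi> v) (\<psi> v) 0)))\<^sup>2) \<le> ennreal (k * (1 - norm (\<psi> v)) powr e) *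
          (\<integral>\<^sup>+w. ennreal ((norm (f w))\<^sup>2) * indicator polydisc w * indicator {w. norm (w $ 1 - \<psi> v) < (1 - norm (\<psi> v)) / 2} w \<partial>?V)"
          unfolding k_def e_def by (rule polydisc_submean[OF \<beta> f norm_\<psi>_less_1[OF True]])
        also have "(\<integral>\<^sup>+w. ennreal ((norm (f w))\<^sup>2) * indicator polydisc w * indicator {w. norm (w $ 1 - \<psi> v) < (1 - norm (\<psi> v)) / 2} w \<partial>?V)
           = (\<integral>\<^sup>+w. F w * N v w \<partial>?V)"
          by (intro nn_integral_cong) (auto simp: F_def N_def \<psi>0_def True)
        also have "ennreal (k * (1 - norm (\<psi> v)) powr e) * \<dots> = (\<integral>\<^sup>+w. R v * (F w * N v w) \<partial>?V)"
          by (subst nn_integral_cmult) (auto simp: R_def \<psi>0_def True)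
        finally show ?thesis using True by (simp add: \<Phi>_def)
      qed simp
    qed
    also have "\<dots> = (\<integral>\<^sup>+w. \<integral>\<^sup>+v. R v * (F w * N v w) \<partial>?V \<partial>?V)"
      by (rule P.Fubini') measurable
    also have "\<dots> \<le> (\<integral>\<^sup>+w. ennreal B * F w \<partial>?V)"
    proof (rule nn_integral_mono)
      fix w :: "complex ^ 3"
      show "(\<integral>\<^sup>+v. R v * (F w * N v w) \<partial>?V) \<le> ennreal B * F w"
      proof (cases "w \<in> polydisc")
        case True
        then have w1: "norm (w $ 1) < 1" by (simp add: polydisc_def)
        define \<delta> where "\<delta> = 1 - norm (w $ 1)"
        have \<delta>: "0 < \<delta>" using w1 by (simp add: \<delta>_def)
        let ?S = "{v \<in> polydisc. norm (\<psi>0 v - w $ 1) < 1 - norm (w $ 1)}"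
        have pw: "R v * (F w * N v w) \<le> F w * ennreal (k * ((2/3) * \<delta>) powr e) * indicator ?S v" for v
        proof (cases "v \<in> polydisc \<and> norm (w $ 1 - \<psi>0 v) < (1 - norm (\<psi>0 v)) / 2")
          case True
          \<comment> \<open>With r = 1 - |\<psi>(v)| and distance below r/2, one has r/2 < \<delta>
            < 3r/2. The first inequality places \<psi>(v) in the box of radius \<delta>; the second,
            as e < 0, gives the factor (2/3)^e.\<close>
          have 1: "2/3 * \<delta> \<le> 1 - norm (\<psi>0 v)" "norm (\<psi>0 v - w $ 1) < \<delta>"
            using True norm_triangle_ineq2[of "w $ 1" "\<psi>0 v"] norm_triangle_ineq2[of "\<psi>0 v" "w $ 1"]
            by (auto simp: \<delta>_def norm_minus_commute)
          then have "k * (1 - norm (\<psi>0 v)) powr e \<le> k * ((2/3) * \<delta>) powr e"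
            using k \<delta> \<beta> by (intro mult_left_mono powr_mono2') (auto simp: e_def)
          then have "R v \<le> ennreal (k * ((2/3) * \<delta>) powr e)"
            using True by (simp add: R_def ennreal_leI)
          then have "R v * F w \<le> ennreal (k * ((2/3) * \<delta>) powr e) * F w"
            by (rule mult_right_mono) simp
          then show ?thesis using True 1(2) by (simp add: N_def \<delta>_def mult.commute)
        qed (auto simp: N_def R_def)
        have "(\<integral>\<^sup>+v. R v * (F w * N v w) \<partial>?V) \<le> (\<integral>\<^sup>+v. F w * ennreal (k * ((2/3) * \<delta>) powr e) * indicator ?S v \<partial>?V)"
          by (intro nn_integral_mono pw)
        also have "\<dots> = F w * ennreal (k * ((2/3) * \<delta>) powr e) * emeasure ?V ?S"
          by (rule nn_integral_cmult_indicator) measurable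
        also have "\<dots> \<le> F w * ennreal (k * ((2/3) * \<delta>) powr e) * ennreal (A * \<delta> powr (2 + 2 * (\<beta> + 1)))"
          unfolding \<delta>_def by (intro mult_left_mono A w1) auto
        also have "\<dots> = F w * ennreal (k * ((2/3) * \<delta>) powr e * (A * \<delta> powr (2 + 2 * (\<beta> + 1))))"
          using k A by (simp add: ennreal_mult mult.assoc)
        also have "k * ((2/3) * \<delta>) powr e * (A * \<delta> powr (2 + 2 * (\<beta> + 1))) = B * (\<delta> powr e * \<delta> powr (2 + 2 * (\<beta> + 1)))"
          unfolding B_def by (subst powr_mult) (use \<delta> in \<open>simp_all add: mult_ac\<close>)
        also have "\<delta> powr e * \<delta> powr (2 + 2 * (\<beta> + 1)) = 1"
          using \<delta> by (simp add: e_def flip: powr_add)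
        finally show ?thesis by (simp add: mult.commute)
      qed (simp add: F_def)
    qed
    also have "\<dots> = ennreal B * bergman_norm_sq \<beta> f"
      unfolding bergman_norm_sq_def by (subst nn_integral_cmult) (auto simp: F_def[symmetric])
    finally show ?thesis .
  qed
  ultimately show ?thesis by (rule that)
qed

lemma comp_op_continuous_\<Phi>:
  assumes \<beta>: "-1 < \<beta>" "\<beta> \<le> 0" and q: "- \<beta> \<le> 1 / p"
  shows "comp_op_continuous \<beta> \<Phi>"
proof -
  obtain B where B: "0 \<le> B" "\<And>f. f holomorphic_vec_on polydisc \<Longrightarrow>
    bergman_norm_sq \<beta> (f \<circ> \<Phi>) \<le> ennreal B * bergman_norm_sq \<beta> f"
    using bergman_bounded[OF assms] by blast
  have eq: "A2_norm_sq \<beta> f = bergman_norm_sq \<beta> f" for f :: "complex ^ 3 \<Rightarrow> complex"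
    using \<beta> by (simp add: A2_norm_sq_def)
  have fin: "ennreal B * bergman_norm_sq \<beta> f < \<infinity>" if "f \<in> A2 \<beta>" for f :: "complex ^ 3 \<Rightarrow> complex"
    using that by (simp add: A2_def eq ennreal_mult_less_top)
  have "f \<circ> \<Phi> \<in> A2 \<beta>" if "f \<in> A2 \<beta>" for f
  proof -
    have f: "f holomorphic_vec_on polydisc" using that by (simp add: A2_def)
    then show ?thesis
      using B(2)[OF f] fin[OF that] holomorphic_vec_on_compose[OF f \<Phi>_polydisc_maps]
      by (auto simp: A2_def eq intro: order_le_less_trans)
  qed
  moreover have "A2_norm \<beta> (f \<circ> \<Phi>) \<le> sqrt B * A2_norm \<beta> f" if "f \<in> A2 \<beta>" for f
  proof -
    have f: "f holomorphic_vec_on polydisc" using that by (simp add: A2_def)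
    \<comment> \<open>\<open>enn2real\<close> sends infinity to 0, so monotonicity depends on the
      finiteness of the right-hand side.\<close>
    have "enn2real (bergman_norm_sq \<beta> (f \<circ> \<Phi>)) \<le> enn2real (ennreal B * bergman_norm_sq \<beta> f)"
      using B(2)[OF f] fin[OF that] by (intro enn2real_mono) auto
    also have "\<dots> = B * enn2real (bergman_norm_sq \<beta> f)"
      using B(1) by (simp add: enn2real_mult)
    finally show ?thesis
      by (simp add: A2_norm_def eq flip: real_sqrt_mult)
  qed
  ultimately show ?thesis
    unfolding comp_op_continuous_def comp_op_def by blast
qed

end

subsection \<open>Unboundedness\<close>

text \<open>Cut the disc into the layers k/j \<le> 1 - |z| \<le> (k + 1)/j. On such a layer |z|^(2j)
  \<le> exp(-k), and its mass is at most C ((k + 1)/j)^a; the sum over k converges and leaves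
  j^(-a).\<close>

lemma (in radial_tails) moment_le:
  obtains M where "0 \<le> M"
    "\<And>j. 0 < j \<Longrightarrow> (\<integral>\<^sup>+z. ennreal (norm z ^ (2 * j)) \<partial>\<mu>) \<le> ennreal (M * real j powr - a)"
proof -
  define h where "h k = C * exp (- real k) * (real k + 1) powr a" for k :: nat
  have "summable (\<lambda>k. exp (- real k) * (real k + 1) powr a)"
  proof (rule summable_comparison_test_bigo)
    show "summable (\<lambda>k. norm (exp (-1/2) ^ k :: real))" by (simp add: summable_geometric)
    have "(\<lambda>k. exp (- real k) * (real k + 1) powr a) \<in> O(\<lambda>k. exp (- real k / 2))"
      using a_nonneg by real_asymp
    then show "(\<lambda>k. exp (- real k) * (real k + 1) powr a) \<in> O(\<lambda>k. exp (-1/2) ^ k)"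
      by (simp flip: exp_of_nat_mult)
  qed
  then have h: "summable h" unfolding h_def by (simp add: mult.assoc summable_mult)
  have h0: "0 \<le> h k" for k using C_ge_1 by (simp add: h_def)
  have "(\<integral>\<^sup>+z. ennreal (norm z ^ (2 * j)) \<partial>\<mu>) \<le> ennreal (suminf h * real j powr - a)" if j: "0 < j" for j
  proof -
    have "(\<integral>\<^sup>+z. ennreal (norm z ^ (2 * j)) \<partial>\<mu>)
      \<le> (\<integral>\<^sup>+z. (\<Sum>k. ennreal (exp (- real k)) * indicator {z. 1 - (real k + 1) / real j \<le> norm z} z) \<partial>\<mu>)"
    proof (rule nn_integral_mono_AE)
      show "AE z in \<mu>. ennreal (norm z ^ (2 * j)) \<le> (\<Sum>k. ennreal (exp (- real k)) * indicator {z. 1 - (real k + 1) / real j \<le> norm z} z)"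
        using AE_le_1
      proof eventually_elim
        fix z :: complex assume z: "norm z \<le> 1"
        define k where "k = nat \<lfloor>real j * (1 - norm z)\<rfloor>"
        have k: "real k \<le> real j * (1 - norm z)" "real j * (1 - norm z) \<le> real k + 1"
          using z by (auto simp: k_def)
        have "norm z \<le> exp (- (1 - norm z))" using exp_ge_add_one_self[of "- (1 - norm z)"] by simp
        then have "norm z ^ j \<le> exp (- (1 - norm z)) ^ j"
          by (intro power_mono) auto
        moreover have "norm z ^ (2 * j) \<le> norm z ^ j"
          using z by (intro power_decreasing) auto
        ultimately have "norm z ^ (2 * j) \<le> exp (- (1 - norm z)) ^ j" by linarith
        also have "exp (- (1 - norm z)) ^ j = exp (- (real j * (1 - norm z)))"
          by (subst exp_of_nat_mult[symmetric]) (simp add: algebra_simps)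
        also have "\<dots> \<le> exp (- real k)" using k by simp
        finally have "ennreal (norm z ^ (2 * j)) \<le> ennreal (exp (- real k))"
          by (auto intro: ennreal_leI)
        also have "\<dots> = ennreal (exp (- real k)) * indicator {z. 1 - (real k + 1) / real j \<le> norm z} z"
          using k j by (auto simp: field_simps split: split_indicator)
        also have "\<dots> \<le> (\<Sum>k. ennreal (exp (- real k)) * indicator {z. 1 - (real k + 1) / real j \<le> norm z} z)"
        proof -
          have "T k \<le> suminf T" for T :: "nat \<Rightarrow> ennreal"
            using sum_le_suminf[of T "{k}"] by simp
          then show ?thesis .
        qed
        finally show "ennreal (norm z ^ (2 * j)) \<le> \<dots>" .
      qed
    qed
    also have "\<dots> = (\<Sum>k. ennreal (exp (- real k)) * emeasure \<mu> {z. 1 - (real k + 1) / real j \<le> norm z})"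
      by (subst nn_integral_suminf) (auto simp: nn_integral_cmult_indicator)
    also have "\<dots> \<le> (\<Sum>k. ennreal (h k * real j powr - a))"
    proof (rule suminf_le)
      fix k
      have "ennreal (exp (- real k)) * emeasure \<mu> {z. 1 - (real k + 1) / real j \<le> norm z}
         \<le> ennreal (exp (- real k)) * ennreal (C * ((real k + 1) / real j) powr a)"
        by (intro mult_left_mono tail_le) (use j in auto)
      also have "\<dots> = ennreal (h k * real j powr - a)"
        using C_ge_1 j by (simp add: h_def powr_divide powr_minus field_simps flip: ennreal_mult)
      finally show "ennreal (exp (- real k)) * emeasure \<mu> {z. 1 - (real k + 1) / real j \<le> norm z}
         \<le> ennreal (h k * real j powr - a)" .
    qed auto
    also have "\<dots> = ennreal (\<Sum>k. h k * real j powr - a)"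
      by (rule suminf_ennreal2) (use h h0 in \<open>auto intro: summable_mult2\<close>)
    also have "(\<Sum>k. h k * real j powr - a) = suminf h * real j powr - a"
      by (rule suminf_mult2[OF h, symmetric])
    finally show ?thesis .
  qed
  moreover have "0 \<le> suminf h" using h h0 by (rule suminf_nonneg)
  ultimately show ?thesis using that by blast
qed

text \<open>The restriction to the middle third of the exponents makes all monomials have comparable norms.\<close>

definition test_poly :: "nat \<Rightarrow> complex ^ 3 \<Rightarrow> complex" where
  "test_poly N v = (\<Sum>i=N..2*N. v $ 1 ^ (3 * N - i) * v $ 2 ^ i)"

lemma test_poly_holomorphic: "test_poly N holomorphic_vec_on S"
  unfolding test_poly_def
  by (intro holomorphic_vec_on_sum holomorphic_vec_on_mult holomorphic_vec_on_power holomorphic_vec_on_nth)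

lemma test_poly_borel [measurable]: "test_poly N \<in> borel_measurable borel"
  unfolding test_poly_def by measurable

text \<open>The source of the unboundedness: the N+1 monomials reinforce each other on the image of
  \<Phi>.\<close>

lemma test_poly_diagonal: "test_poly N (vec3 w w z) = of_nat (N + 1) * w ^ (3 * N)"
proof -
  have "test_poly N (vec3 w w z) = (\<Sum>i=N..2*N. w ^ (3 * N))"
    unfolding test_poly_def by (intro sum.cong) (auto simp flip: power_add)
  then show ?thesis by simp
qed

lemma test_poly_scale: "test_poly N (r *\<^sub>R v) = of_real r ^ (3 * N) * test_poly N v"
  unfolding test_poly_def sum_distrib_left
proof (rule sum.cong[OF refl])
  fix i assume "i \<in> {N..2*N}"
  then have e: "of_real r ^ (3 * N) = of_real r ^ (3 * N - i) * (of_real r ^ i :: complex)"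
    by (simp flip: power_add)
  have c: "(r *\<^sub>R v) $ j = of_real r * v $ j" for j
    unfolding vector_scaleR_component by (rule scaleR_conv_of_real)
  show "(r *\<^sub>R v) $ 1 ^ (3 * N - i) * (r *\<^sub>R v) $ 2 ^ i = of_real r ^ (3 * N) * (v $ 1 ^ (3 * N - i) * v $ 2 ^ i)"
    unfolding c power_mult_distrib e by (simp only: mult_ac)
qed

text \<open>Averaging over rotations of the second variable and Parseval make the monomials
  orthogonal. Both exponents are at least N on the middle third, so every term is at most |x|^(2N)
  |y|^(2N) on the bidisc, and there are N+1 of them.\<close>

lemma (in radial_tails) test_poly_norm:
  assumes N: "0 < N" and M: "0 \<le> M" "(\<integral>\<^sup>+z. ennreal (norm z ^ (2 * N)) \<partial>\<mu>) \<le> ennreal M"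
  shows "(\<integral>\<^sup>+v. ennreal ((norm (test_poly N v))\<^sup>2) \<partial>vec_product_measure \<mu>) \<le> ennreal ((real N + 1) * M\<^sup>2)"
proof -
  have y: "(\<integral>\<^sup>+y. ennreal ((norm (test_poly N (vec3 x y 0)))\<^sup>2) \<partial>\<mu>) \<le> ennreal ((real N + 1) * M) * ennreal (norm x ^ (2 * N))"
    if x: "norm x \<le> 1" for x
  proof -
    define d where "d y i = x ^ (3 * N - i) * y ^ i" for y i
    have "(\<integral>\<^sup>+y. ennreal ((norm (test_poly N (vec3 x y 0)))\<^sup>2) \<partial>\<mu>)
       = (\<integral>\<^sup>+y. \<integral>\<^sup>+\<zeta>. ennreal ((norm (test_poly N (vec3 x (\<zeta> * y) 0)))\<^sup>2) \<partial>circle_measure \<partial>\<mu>)"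
      by (rule nn_integral_average) measurable
    also have "\<dots> = (\<integral>\<^sup>+y. ennreal (\<Sum>i=N..2*N. (norm (d y i))\<^sup>2) \<partial>\<mu>)"
    proof (rule nn_integral_cong)
      fix y
      have "test_poly N (vec3 x (\<zeta> * y) 0) = (\<Sum>i=N..2*N. d y i * \<zeta> ^ i)" for \<zeta>
        by (simp add: test_poly_def d_def power_mult_distrib mult_ac)
      then show "(\<integral>\<^sup>+\<zeta>. ennreal ((norm (test_poly N (vec3 x (\<zeta> * y) 0)))\<^sup>2) \<partial>circle_measure)
         = ennreal (\<Sum>i=N..2*N. (norm (d y i))\<^sup>2)"
        by (simp add: circle_parseval)
    qed
    also have "\<dots> \<le> (\<integral>\<^sup>+y. ennreal ((real N + 1) * norm x ^ (2 * N)) * ennreal (norm y ^ (2 * N)) \<partial>\<mu>)"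
    proof (rule nn_integral_mono_AE)
      show "AE y in \<mu>. ennreal (\<Sum>i=N..2*N. (norm (d y i))\<^sup>2) \<le> ennreal ((real N + 1) * norm x ^ (2 * N)) * ennreal (norm y ^ (2 * N))"
        using AE_le_1
      proof eventually_elim
        fix y :: complex assume y: "norm y \<le> 1"
        have "(\<Sum>i=N..2*N. (norm (d y i))\<^sup>2) \<le> (\<Sum>i=N..2*N. norm x ^ (2 * N) * norm y ^ (2 * N))"
        proof (rule sum_mono)
          fix i assume i: "i \<in> {N..2*N}"
          have "(norm (d y i))\<^sup>2 = norm x ^ (2 * (3 * N - i)) * norm y ^ (2 * i)"
            by (simp add: d_def norm_mult norm_power power_mult_distrib flip: power_mult) (simp add: mult.commute)
          also have "\<dots> \<le> norm x ^ (2 * N) * norm y ^ (2 * N)"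
            using i x y by (intro mult_mono power_decreasing) auto
          finally show "(norm (d y i))\<^sup>2 \<le> norm x ^ (2 * N) * norm y ^ (2 * N)" .
        qed
        also have "\<dots> = (real N + 1) * norm x ^ (2 * N) * norm y ^ (2 * N)"
          by (simp add: algebra_simps)
        finally show "ennreal (\<Sum>i=N..2*N. (norm (d y i))\<^sup>2) \<le> ennreal ((real N + 1) * norm x ^ (2 * N)) * ennreal (norm y ^ (2 * N))"
          by (simp add: ennreal_leI flip: ennreal_mult)
      qed
    qed
    also have "\<dots> = ennreal ((real N + 1) * norm x ^ (2 * N)) * (\<integral>\<^sup>+y. ennreal (norm y ^ (2 * N)) \<partial>\<mu>)"
      by (rule nn_integral_cmult) measurable
    also have "\<dots> \<le> ennreal ((real N + 1) * norm x ^ (2 * N)) * ennreal M"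
      by (intro mult_left_mono M) auto
    also have "\<dots> = ennreal ((real N + 1) * M) * ennreal (norm x ^ (2 * N))"
      using M by (simp add: mult_ac flip: ennreal_mult)
    finally show ?thesis .
  qed
  have tz: "test_poly N (vec3 x y z) = test_poly N (vec3 x y 0)" for x y z
    by (simp add: test_poly_def)
  have "(\<integral>\<^sup>+v. ennreal ((norm (test_poly N v))\<^sup>2) \<partial>vec_product_measure \<mu>)
     = (\<integral>\<^sup>+x. \<integral>\<^sup>+y. \<integral>\<^sup>+z. ennreal ((norm (test_poly N (vec3 x y z)))\<^sup>2) \<partial>\<mu> \<partial>\<mu> \<partial>\<mu>)"
    by (rule nn_integral_vec3) (auto intro: sigma_finite_measure_axioms)
  also have "\<dots> = (\<integral>\<^sup>+x. \<integral>\<^sup>+y. \<integral>\<^sup>+z. ennreal ((norm (test_poly N (vec3 x y 0)))\<^sup>2) \<partial>\<mu> \<partial>\<mu> \<partial>\<mu>)"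
    by (intro nn_integral_cong) (subst tz, rule refl)
  also have "\<dots> = (\<integral>\<^sup>+x. \<integral>\<^sup>+y. ennreal ((norm (test_poly N (vec3 x y 0)))\<^sup>2) \<partial>\<mu> \<partial>\<mu>)"
    by (simp add: emeasure_space_1)
  also have "\<dots> \<le> (\<integral>\<^sup>+x. ennreal ((real N + 1) * M) * ennreal (norm x ^ (2 * N)) \<partial>\<mu>)"
  proof (rule nn_integral_mono_AE)
    show "AE x in \<mu>. (\<integral>\<^sup>+y. ennreal ((norm (test_poly N (vec3 x y 0)))\<^sup>2) \<partial>\<mu>)
      \<le> ennreal ((real N + 1) * M) * ennreal (norm x ^ (2 * N))"
      using AE_le_1 by eventually_elim (rule y)
  qed
  also have "\<dots> = ennreal ((real N + 1) * M) * (\<integral>\<^sup>+x. ennreal (norm x ^ (2 * N)) \<partial>\<mu>)"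
    by (rule nn_integral_cmult) measurable
  also have "\<dots> \<le> ennreal ((real N + 1) * M) * ennreal M"
    by (intro mult_left_mono M) auto
  also have "\<dots> = ennreal ((real N + 1) * M\<^sup>2)"
    using M by (simp add: power2_eq_square mult_ac flip: ennreal_mult)
  finally show ?thesis .
qed

section \<open>Hardy and Bergman norms of the test polynomials\<close>

definition A2_measure :: "real \<Rightarrow> complex measure" where
  "A2_measure \<beta> = (if \<beta> = -1 then circle_measure else disc_measure \<beta>)"

lemma radial_tails_A2_measure:
  assumes "-1 \<le> \<beta>"
  obtains c C where "radial_tails (A2_measure \<beta>) (\<beta> + 1) c C"
proof (cases "\<beta> = -1")
  case True
  then show ?thesis using that[of 1 1] radial_tails_circle by (simp add: A2_measure_def)
next
  case False
  then show ?thesis using that[of 1 "2 powr (\<beta> + 1)"] radial_tails_disc[of \<beta>] assms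
    by (simp add: A2_measure_def)
qed

text \<open>In the Hardy case the supremum over radii is removed by homogeneity: scaling by r < 1
  only decreases the modulus.\<close>

lemma A2_norm_sq_test_poly_le:
  "A2_norm_sq \<beta> (test_poly N) \<le> (\<integral>\<^sup>+v. ennreal ((norm (test_poly N v))\<^sup>2) \<partial>vec_product_measure (A2_measure \<beta>))"
proof (cases "\<beta> = -1")
  case True
  have "(\<integral>\<^sup>+v. ennreal ((norm (test_poly N (r *\<^sub>R v)))\<^sup>2) * indicator torus v \<partial>vec_product_measure circle_measure)
     \<le> (\<integral>\<^sup>+v. ennreal ((norm (test_poly N v))\<^sup>2) \<partial>vec_product_measure circle_measure)"
    if r: "0 < r" "r < 1" for r
  proof (rule nn_integral_mono)
    fix v :: "complex ^ 3"
    have "norm (test_poly N (r *\<^sub>R v)) = r ^ (3 * N) * norm (test_poly N v)"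
      using r by (simp add: test_poly_scale norm_mult norm_power)
    also have "\<dots> \<le> norm (test_poly N v)"
      using r by (intro mult_left_le_one_le power_le_one) auto
    finally have "(norm (test_poly N (r *\<^sub>R v)))\<^sup>2 \<le> (norm (test_poly N v))\<^sup>2"
      by (intro power_mono) auto
    then show "ennreal ((norm (test_poly N (r *\<^sub>R v)))\<^sup>2) * indicator torus v \<le> ennreal ((norm (test_poly N v))\<^sup>2)"
      by (auto intro: ennreal_leI split: split_indicator)
  qed
  then show ?thesis
    using True by (auto simp: A2_norm_sq_def hardy_norm_sq_def A2_measure_def intro!: SUP_least)
next
  case False
  then show ?thesis
    by (auto simp: A2_norm_sq_def bergman_norm_sq_def A2_measure_def intro!: nn_integral_mono split: split_indicator)
qed

lemma emeasure_vec_product_box: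
  assumes M: "prob_space M" and [measurable_cong, simp]: "sets M = sets borel"
    and [measurable]: "S1 \<in> sets borel" "S2 \<in> sets borel" "S3 \<in> sets borel"
  shows "(\<integral>\<^sup>+v. indicator S1 (v $ 1) * indicator S2 (v $ 2) * indicator S3 (v $ 3) \<partial>(vec_product_measure M :: (complex ^ 3) measure))
    = emeasure M S1 * emeasure M S2 * emeasure M S3"
proof -
  interpret prob_space M by fact
  have "(\<integral>\<^sup>+v. indicator S1 (v $ 1) * indicator S2 (v $ 2) * indicator S3 (v $ 3) \<partial>(vec_product_measure M :: (complex ^ 3) measure))
     = (\<integral>\<^sup>+x. \<integral>\<^sup>+y. \<integral>\<^sup>+z. indicator S1 x * indicator S2 y * indicator S3 z \<partial>M \<partial>M \<partial>M)"
    by (subst nn_integral_vec3) (auto intro: sigma_finite_measure_axioms)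
  also have "\<dots> = (\<integral>\<^sup>+x. \<integral>\<^sup>+y. indicator S1 x * indicator S2 y * emeasure M S3 \<partial>M \<partial>M)"
    by (simp add: nn_integral_cmult_indicator)
  also have "\<dots> = (\<integral>\<^sup>+x. \<integral>\<^sup>+y. indicator S1 x * emeasure M S3 * indicator S2 y \<partial>M \<partial>M)"
    by (simp only: mult_ac)
  also have "\<dots> = (\<integral>\<^sup>+x. indicator S1 x * emeasure M S3 * emeasure M S2 \<partial>M)"
    by (simp add: nn_integral_cmult_indicator)
  also have "\<dots> = (\<integral>\<^sup>+x. emeasure M S3 * emeasure M S2 * indicator S1 x \<partial>M)"
    by (simp only: mult_ac)
  also have "\<dots> = emeasure M S1 * emeasure M S2 * emeasure M S3"
    by (subst nn_integral_cmult_indicator) (simp_all add: mult_ac)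
  finally show ?thesis .
qed

section \<open>Lower bounds for the composed test polynomials\<close>

context contact_map
begin

text \<open>On this window each factor of \<psi> is at least 1 - O(1/n), which survives the power
  2n. The angular width n^(-1/p') makes the contact term at most K/n. In the constant, 6 comes from
  the three moduli, each at least 1 - 1/n \<ge> exp(-2/n), K from the contact, and L from passing
  from \<open>sgn x\<close> to x.\<close>

lemma \<psi>_lower:
  obtains \<kappa> where "0 < \<kappa>"
    "\<And>n v. 2 \<le> n \<Longrightarrow> v \<in> polydisc \<Longrightarrow> v $ 1 \<in> sector 1 (1 / real n) (real n powr (- 1 / p')) \<Longrightarrow>
      1 - 1 / real n \<le> norm (v $ 2) \<Longrightarrow> 1 - 1 / real n \<le> norm (v $ 3) \<Longrightarrow> \<kappa> \<le> norm (\<psi> v) ^ (2 * n)"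
proof -
  obtain L where L: "0 \<le> L" "\<And>z w. norm z \<le> 1 \<Longrightarrow> norm w \<le> 1 \<Longrightarrow> \<bar>Re (U z) - Re (U w)\<bar> \<le> L * norm (z - w)"
    using U_lipschitz by blast
  have "exp (- 2 * (6 + K + L)) \<le> norm (\<psi> v) ^ (2 * n)"
    if n: "2 \<le> n" and v: "v \<in> polydisc" and s: "v $ 1 \<in> sector 1 (1 / real n) (real n powr (- 1 / p'))"
      and v2: "1 - 1 / real n \<le> norm (v $ 2)" and v3: "1 - 1 / real n \<le> norm (v $ 3)" for n v
  proof -
    define x where "x = v $ 1"
    have x1: "norm x < 1" using v by (simp add: polydisc_def x_def)
    have xs: "1 - 1 / real n \<le> norm x" "norm (sgn x - 1) \<le> real n powr (- 1 / p')"
      using s by (auto simp: sector_def x_def)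
    have n2: "1 / real n \<le> 1 / 2" using n by (simp add: field_simps)
    then have "x \<noteq> 0" using xs by auto
    have "- (1 / real n) - 2 * (1 / real n)\<^sup>2 \<le> ln (1 - 1 / real n)"
      by (rule ln_one_minus_pos_lower_bound) (use n2 in auto)
    moreover have "2 * (1 / real n)\<^sup>2 \<le> 1 / real n"
      using n by (simp add: power2_eq_square field_simps)
    ultimately have "- (2 / real n) \<le> ln (1 - 1 / real n)" by simp
    then have e: "exp (- (2 / real n)) \<le> 1 - 1 / real n"
      using n2 by (subst (asm) ln_ge_iff) auto
    have "Re (U (sgn x)) \<le> K * norm (sgn x - 1) powr p'"
      by (rule Re_U_le) (use \<open>x \<noteq> 0\<close> in \<open>simp add: norm_sgn\<close>)
    also have "\<dots> \<le> K * (real n powr (- 1 / p')) powr p'"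
      using xs p'_pos K_nonneg by (intro mult_left_mono powr_mono2) auto
    also have "(real n powr (- 1 / p')) powr p' = 1 / real n"
    proof -
      have "(real n powr (- 1 / p')) powr p' = real n powr (- 1 / p' * p')" by (rule powr_powr)
      also have "- 1 / p' * p' = - 1" using p'_pos by simp
      finally show ?thesis using n by (simp add: powr_minus_divide)
    qed
    finally have u: "Re (U (sgn x)) \<le> K / real n" by simp
    have "sgn x - x = (1 - norm x) *\<^sub>R sgn x"
      using \<open>x \<noteq> 0\<close> by (simp add: scaleR_diff_left left_diff_distrib sgn_div_norm)
    then have "norm (sgn x - x) \<le> 1 / real n"
      using \<open>x \<noteq> 0\<close> x1 xs by (simp add: norm_sgn)
    then have "L * norm (sgn x - x) \<le> L * (1 / real n)"
      using L by (intro mult_left_mono) auto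
    moreover have "\<bar>Re (U (sgn x)) - Re (U x)\<bar> \<le> L * norm (sgn x - x)"
      by (rule L(2)) (use x1 in \<open>auto simp: norm_sgn\<close>)
    ultimately have "Re (U x) \<le> (K + L) / real n" using u by (simp add: add_divide_distrib)
    then have "exp (- ((K + L) / real n)) \<le> exp (- Re (U x))" by simp
    then have "exp (- (2 / real n)) * exp (- ((K + L) / real n)) * exp (- (2 / real n)) * exp (- (2 / real n)) \<le> norm (\<psi> v)"
      unfolding norm_\<psi> norm_g x_def[symmetric] using e xs v2 v3 by (intro mult_mono) auto
    also have "exp (- (2 / real n)) * exp (- ((K + L) / real n)) * exp (- (2 / real n)) * exp (- (2 / real n)) = exp (- ((6 + K + L) / real n))"
      by (simp add: add_divide_distrib flip: exp_add)
    finally have "exp (- ((6 + K + L) / real n)) ^ (2 * n) \<le> norm (\<psi> v) ^ (2 * n)"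
      by (intro power_mono) auto
    moreover have "exp (- ((6 + K + L) / real n)) ^ (2 * n) = exp (- 2 * (6 + K + L))"
      using n by (simp flip: exp_of_nat_mult)
    ultimately show ?thesis by simp
  qed
  then show ?thesis using that[of "exp (- 2 * (6 + K + L))"] by simp
qed

text \<open>Only the window of \<open>\<psi>_lower\<close> is integrated over. There the squared
  modulus is at least a constant times (N + 1)^2, and the exponent of N is minus that of the window:
  three depths \<beta> + 1 and one width 1/p'.\<close>

lemma A2_norm_sq_comp_ge:
  assumes \<beta>: "-1 \<le> \<beta>"
  obtains \<kappa> where "0 < \<kappa>" "\<And>N. 0 < N \<Longrightarrow>
    ennreal (\<kappa> * (real N + 1)\<^sup>2 * real N powr (- 3 * (\<beta> + 1) - 1 / p')) \<le> A2_norm_sq \<beta> (test_poly N \<circ> \<Phi>)"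
proof -
  obtain c C where \<mu>: "radial_tails (A2_measure \<beta>) (\<beta> + 1) c C"
    by (rule radial_tails_A2_measure[OF \<beta>])
  define \<mu> where "\<mu> = A2_measure \<beta>"
  interpret radial_tails \<mu> "\<beta> + 1" c C unfolding \<mu>_def by fact
  obtain \<kappa>0 where \<kappa>0: "0 < \<kappa>0"
    "\<And>n v. 2 \<le> n \<Longrightarrow> v \<in> polydisc \<Longrightarrow> v $ 1 \<in> sector 1 (1 / real n) (real n powr (- 1 / p')) \<Longrightarrow>
      1 - 1 / real n \<le> norm (v $ 2) \<Longrightarrow> 1 - 1 / real n \<le> norm (v $ 3) \<Longrightarrow> \<kappa>0 \<le> norm (\<psi> v) ^ (2 * n)"
    using \<psi>_lower by blast
  define \<kappa>1 where "\<kappa>1 = \<kappa>0 * (c ^ 3 / (2 * pi))"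
  define e where "e = - 3 * (\<beta> + 1) - 1 / p'"
  have "ennreal (\<kappa>1 * 3 powr e * (real N + 1)\<^sup>2 * real N powr e) \<le> A2_norm_sq \<beta> (test_poly N \<circ> \<Phi>)"
    if N: "0 < N" for N
  proof -
    \<comment> \<open>The degree of the test polynomial; the factor \<open>3 powr e\<close> in the
      final constant stems from here.\<close>
    define n where "n = 3 * N"
    have n: "2 \<le> n" using N by (simp add: n_def)
    define \<rho> where "\<rho> = real n powr (- 1 / p')"
    have \<rho>: "0 \<le> \<rho>" "\<rho> \<le> 1"
      using n p'_pos powr_mono[of "- 1 / p'" 0 "real n"] by (auto simp: \<rho>_def)
    have pw: "ennreal ((real N + 1)\<^sup>2 * \<kappa>0) \<le> ennreal ((norm ((test_poly N \<circ> \<Phi>) v))\<^sup>2)"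
      if "v \<in> polydisc" "v $ 1 \<in> sector 1 (1 / real n) \<rho>" "1 - 1 / real n \<le> norm (v $ 2)" "1 - 1 / real n \<le> norm (v $ 3)" for v
    proof -
      have "(norm ((test_poly N \<circ> \<Phi>) v))\<^sup>2 = (real N + 1)\<^sup>2 * norm (\<psi> v) ^ (2 * n)"
        by (simp add: \<Phi>_def test_poly_diagonal norm_mult norm_power power_mult_distrib n_def mult.commute flip: power_mult of_nat_Suc)
      moreover have "(real N + 1)\<^sup>2 * \<kappa>0 \<le> (real N + 1)\<^sup>2 * norm (\<psi> v) ^ (2 * n)"
        using \<kappa>0(2)[OF n] that unfolding \<rho>_def by (intro mult_left_mono) auto
      ultimately show ?thesis by (simp add: ennreal_leI)
    qed
    define T where "T = {z::complex. 1 - 1 / real n \<le> norm z}"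
    have [measurable]: "T \<in> sets borel" unfolding T_def by measurable
    have x: "0 < 1 / real n" "1 / real n < 1" using n by auto
    have low: "ennreal (c ^ 3 / (2 * pi) * real n powr e) \<le> emeasure \<mu> (sector 1 (1 / real n) \<rho>) * emeasure \<mu> T * emeasure \<mu> T"
    proof -
      have "ennreal (\<rho> / (2 * pi) * (c * (1 / real n) powr (\<beta> + 1))) * ennreal (c * (1 / real n) powr (\<beta> + 1)) * ennreal (c * (1 / real n) powr (\<beta> + 1))
        \<le> emeasure \<mu> (sector 1 (1 / real n) \<rho>) * emeasure \<mu> T * emeasure \<mu> T"
        unfolding T_def by (intro mult_mono emeasure_sector_ge tail_ge) (use x \<rho> in auto)
      also have "ennreal (\<rho> / (2 * pi) * (c * (1 / real n) powr (\<beta> + 1))) * ennreal (c * (1 / real n) powr (\<beta> + 1)) * ennreal (c * (1 / real n) powr (\<beta> + 1))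
         = ennreal (c ^ 3 / (2 * pi) * (real n powr (- 1 / p') * real n powr - (\<beta> + 1) * real n powr - (\<beta> + 1) * real n powr - (\<beta> + 1)))"
      proof -
        have "(1 / real n) powr (\<beta> + 1) = real n powr - (\<beta> + 1)"
          by (simp only: powr_divide powr_minus_divide) simp
        then show ?thesis
          using c_pos by (simp add: \<rho>_def power3_eq_cube mult_ac flip: ennreal_mult)
      qed
      also have "real n powr (- 1 / p') * real n powr - (\<beta> + 1) * real n powr - (\<beta> + 1) * real n powr - (\<beta> + 1) = real n powr e"
        by (simp only: powr_add[symmetric]) (simp add: e_def algebra_simps)
      finally show ?thesis .
    qed
    have key: "ennreal ((real N + 1)\<^sup>2 * \<kappa>0) * ennreal (c ^ 3 / (2 * pi) * real n powr e) \<le> A2_norm_sq \<beta> (test_poly N \<circ> \<Phi>)"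
    proof (cases "\<beta> = -1")
      case True
      then have \<mu>c: "\<mu> = circle_measure" by (simp add: \<mu>_def A2_measure_def)
      \<comment> \<open>At this radius every point of the dilated torus has exactly the modulus that
        the window demands, so only the angular condition on the first coordinate remains.\<close>
      define r where "r = 1 - 1 / real n"
      have r: "0 < r" "r < 1" using x by (auto simp: r_def)
      let ?V = "vec_product_measure \<mu> :: (complex ^ 3) measure"
      \<comment> \<open>Intersecting with the sphere, of full measure, places each point of the
        product set on the torus; the open disc plays this part in the Bergman case.\<close>
      let ?A = "sector 1 (1 / real n) \<rho> \<inter> sphere 0 1" and ?B = "T \<inter> sphere 0 1"
      have [measurable]: "sphere (0::complex) 1 \<in> sets borel" by simp
      have AE: "emeasure \<mu> (S \<inter> sphere 0 1) = emeasure \<mu> S" if [measurable]: "S \<in> sets borel" for S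
      proof (rule emeasure_eq_AE)
        show "AE z in \<mu>. z \<in> S \<inter> sphere 0 1 \<longleftrightarrow> z \<in> S"
          unfolding \<mu>c using AE_circle by eventually_elim simp
      qed auto
      have "ennreal ((real N + 1)\<^sup>2 * \<kappa>0) * ennreal (c ^ 3 / (2 * pi) * real n powr e)
         \<le> ennreal ((real N + 1)\<^sup>2 * \<kappa>0) * (emeasure \<mu> ?A * emeasure \<mu> ?B * emeasure \<mu> ?B)"
        using low by (intro mult_left_mono) (simp_all add: AE)
      also have "\<dots> = ennreal ((real N + 1)\<^sup>2 * \<kappa>0) * (\<integral>\<^sup>+v. indicator ?A (v $ 1) * indicator ?B (v $ 2) * indicator ?B (v $ 3) \<partial>?V)"
        by (subst emeasure_vec_product_box) (auto intro: prob_space_axioms)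
      also have "\<dots> = (\<integral>\<^sup>+v. ennreal ((real N + 1)\<^sup>2 * \<kappa>0) * (indicator ?A (v $ 1) * indicator ?B (v $ 2) * indicator ?B (v $ 3)) \<partial>?V)"
        by (subst nn_integral_cmult) auto
      also have "\<dots> \<le> (\<integral>\<^sup>+v\<in>torus. ennreal ((norm ((test_poly N \<circ> \<Phi>) (r *\<^sub>R v)))\<^sup>2) \<partial>?V)"
      proof (rule nn_integral_mono)
        fix v :: "complex ^ 3"
        show "ennreal ((real N + 1)\<^sup>2 * \<kappa>0) * (indicator ?A (v $ 1) * indicator ?B (v $ 2) * indicator ?B (v $ 3))
          \<le> ennreal ((norm ((test_poly N \<circ> \<Phi>) (r *\<^sub>R v)))\<^sup>2) * indicator torus v"
        proof (cases "v $ 1 \<in> ?A \<and> v $ 2 \<in> ?B \<and> v $ 3 \<in> ?B")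
          case True
          then have nv: "norm (v $ 1) = 1" "norm (v $ 2) = 1" "norm (v $ 3) = 1" by auto
          then have "v \<in> torus" by (simp add: torus_def forall_3)
          moreover have "r *\<^sub>R v \<in> polydisc" using r nv by (simp add: polydisc_def forall_3)
          moreover have "(r *\<^sub>R v) $ 1 \<in> sector 1 (1 / real n) \<rho>"
            using True r nv by (simp add: sector_def sgn_scaleR r_def)
          ultimately show ?thesis
            using True pw[of "r *\<^sub>R v"] r nv by (simp add: r_def)
        qed (auto split: split_indicator)
      qed
      also have "\<dots> \<le> hardy_norm_sq (test_poly N \<circ> \<Phi>)"
        unfolding hardy_norm_sq_def \<mu>c by (rule SUP_upper) (use r in auto)
      finally show ?thesis using True by (simp add: A2_norm_sq_def)
    next
      case False
      then have \<mu>d: "\<mu> = disc_measure \<beta>" by (simp add: \<mu>_def A2_measure_def)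
      let ?V = "vec_product_measure \<mu> :: (complex ^ 3) measure"
      let ?A = "sector 1 (1 / real n) \<rho> \<inter> ball 0 1" and ?B = "T \<inter> ball 0 1"
      have [measurable]: "ball (0::complex) 1 \<in> sets borel" by simp
      have AE: "emeasure \<mu> (S \<inter> ball 0 1) = emeasure \<mu> S" if [measurable]: "S \<in> sets borel" for S
      proof (rule emeasure_eq_AE)
        show "AE z in \<mu>. z \<in> S \<inter> ball 0 1 \<longleftrightarrow> z \<in> S"
          unfolding \<mu>d using AE_disc_measure[of \<beta>] by eventually_elim simp
      qed auto
      have "ennreal ((real N + 1)\<^sup>2 * \<kappa>0) * ennreal (c ^ 3 / (2 * pi) * real n powr e)
         \<le> ennreal ((real N + 1)\<^sup>2 * \<kappa>0) * (emeasure \<mu> ?A * emeasure \<mu> ?B * emeasure \<mu> ?B)"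
        using low by (intro mult_left_mono) (simp_all add: AE)
      also have "\<dots> = ennreal ((real N + 1)\<^sup>2 * \<kappa>0) * (\<integral>\<^sup>+v. indicator ?A (v $ 1) * indicator ?B (v $ 2) * indicator ?B (v $ 3) \<partial>?V)"
        by (subst emeasure_vec_product_box) (auto intro: prob_space_axioms)
      also have "\<dots> = (\<integral>\<^sup>+v. ennreal ((real N + 1)\<^sup>2 * \<kappa>0) * (indicator ?A (v $ 1) * indicator ?B (v $ 2) * indicator ?B (v $ 3)) \<partial>?V)"
        by (subst nn_integral_cmult) auto
      also have "\<dots> \<le> bergman_norm_sq \<beta> (test_poly N \<circ> \<Phi>)"
        unfolding bergman_norm_sq_def \<mu>d
      proof (rule nn_integral_mono)
        fix v :: "complex ^ 3"
        show "ennreal ((real N + 1)\<^sup>2 * \<kappa>0) * (indicator ?A (v $ 1) * indicator ?B (v $ 2) * indicator ?B (v $ 3))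
          \<le> ennreal ((norm ((test_poly N \<circ> \<Phi>) v))\<^sup>2) * indicator polydisc v"
        proof (cases "v $ 1 \<in> ?A \<and> v $ 2 \<in> ?B \<and> v $ 3 \<in> ?B")
          case True
          then have "v \<in> polydisc" by (simp add: polydisc_def forall_3)
          then show ?thesis using True pw[of v] by (simp add: T_def)
        qed (auto split: split_indicator)
      qed
      finally show ?thesis using False by (simp add: A2_norm_sq_def)
    qed
    have "ennreal ((real N + 1)\<^sup>2 * \<kappa>0) * ennreal (c ^ 3 / (2 * pi) * real n powr e)
       = ennreal (\<kappa>1 * 3 powr e * (real N + 1)\<^sup>2 * real N powr e)"
      using \<kappa>0 c_pos by (simp add: \<kappa>1_def n_def powr_mult mult_ac flip: ennreal_mult)
    with key show ?thesis by simp
  qed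
  moreover have "0 < \<kappa>1 * 3 powr e" using \<kappa>0 c_pos by (simp add: \<kappa>1_def)
  ultimately show ?thesis using that unfolding e_def by blast
qed

text \<open>The squared norms compare (N + 1)^2 N^(-3(\<beta> + 1) - 1/p') with (N + 1)
  N^(-2(\<beta> + 1)); the quotient is at least N^s with s = -\<beta> - 1/p' > 0, up to a constant
  factor.\<close>

lemma not_comp_op_continuous_\<Phi>:
  assumes \<beta>: "-1 \<le> \<beta>" and q: "1 / p' < - \<beta>"
  shows "\<not> comp_op_continuous \<beta> \<Phi>"
proof
  assume "comp_op_continuous \<beta> \<Phi>"
  then obtain A where sub: "comp_op \<Phi> ` A2 \<beta> \<subseteq> A2 \<beta>"
    and A: "\<And>f. f \<in> A2 \<beta> \<Longrightarrow> A2_norm \<beta> (comp_op \<Phi> f) \<le> A * A2_norm \<beta> f"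
    unfolding comp_op_continuous_def by blast
  obtain c C where \<mu>: "radial_tails (A2_measure \<beta>) (\<beta> + 1) c C"
    by (rule radial_tails_A2_measure[OF \<beta>])
  interpret radial_tails "A2_measure \<beta>" "\<beta> + 1" c C by fact
  obtain M where M: "0 \<le> M"
    "\<And>j. 0 < j \<Longrightarrow> (\<integral>\<^sup>+z. ennreal (norm z ^ (2 * j)) \<partial>A2_measure \<beta>) \<le> ennreal (M * real j powr - (\<beta> + 1))"
    using moment_le by blast
  obtain \<kappa> where \<kappa>: "0 < \<kappa>" "\<And>N. 0 < N \<Longrightarrow>
    ennreal (\<kappa> * (real N + 1)\<^sup>2 * real N powr (- 3 * (\<beta> + 1) - 1 / p')) \<le> A2_norm_sq \<beta> (test_poly N \<circ> \<Phi>)"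
    using A2_norm_sq_comp_ge[OF \<beta>] by blast
  define s where "s = - \<beta> - 1 / p'"
  have s: "0 < s" using q by (simp add: s_def)
  have bound: "\<kappa> * real N powr s \<le> A\<^sup>2 * M\<^sup>2" if N: "0 < N" for N
  proof -
    define m where "m = M * real N powr - (\<beta> + 1)"
    have m: "0 \<le> m" using M by (simp add: m_def)
    have le: "A2_norm_sq \<beta> (test_poly N) \<le> ennreal ((real N + 1) * m\<^sup>2)"
      using A2_norm_sq_test_poly_le test_poly_norm[OF N m] M(2)[OF N] unfolding m_def
      by (blast intro: order_trans)
    then have f: "test_poly N \<in> A2 \<beta>"
      by (auto simp: A2_def test_poly_holomorphic intro: order_le_less_trans)
    then have "comp_op \<Phi> (test_poly N) \<in> A2 \<beta>" using sub by blast
    then have fin: "A2_norm_sq \<beta> (test_poly N \<circ> \<Phi>) < \<infinity>" by (simp add: A2_def comp_op_def)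
    have "(A2_norm \<beta> (test_poly N))\<^sup>2 = enn2real (A2_norm_sq \<beta> (test_poly N))"
      by (simp add: A2_norm_def)
    also have "\<dots> \<le> (real N + 1) * m\<^sup>2"
      using le m by (intro enn2real_leI) auto
    finally have up: "(A2_norm \<beta> (test_poly N))\<^sup>2 \<le> (real N + 1) * m\<^sup>2" .
    have "\<kappa> * (real N + 1)\<^sup>2 * real N powr (- 3 * (\<beta> + 1) - 1 / p') \<le> enn2real (A2_norm_sq \<beta> (test_poly N \<circ> \<Phi>))"
      using enn2real_mono[OF \<kappa>(2)[OF N]] fin \<kappa>(1) by simp
    also have "\<dots> = (A2_norm \<beta> (comp_op \<Phi> (test_poly N)))\<^sup>2"
      by (simp add: A2_norm_def comp_op_def)
    also have "\<dots> \<le> (A * A2_norm \<beta> (test_poly N))\<^sup>2"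
      by (rule power_mono[OF A[OF f]]) (simp add: A2_norm_def)
    also have "\<dots> \<le> A\<^sup>2 * ((real N + 1) * m\<^sup>2)"
      unfolding power_mult_distrib by (intro mult_left_mono up) auto
    finally have "(real N + 1) * (\<kappa> * (real N + 1) * real N powr (- 3 * (\<beta> + 1) - 1 / p')) \<le> (real N + 1) * (A\<^sup>2 * m\<^sup>2)"
      by (simp add: power2_eq_square mult_ac)
    then have "\<kappa> * (real N + 1) * real N powr (- 3 * (\<beta> + 1) - 1 / p') \<le> A\<^sup>2 * m\<^sup>2"
      by (rule mult_left_le_imp_le) auto
    moreover have "\<kappa> * real N * real N powr (- 3 * (\<beta> + 1) - 1 / p') \<le> \<kappa> * (real N + 1) * real N powr (- 3 * (\<beta> + 1) - 1 / p')"
      using \<kappa>(1) by (intro mult_right_mono) auto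
    ultimately have "\<kappa> * (real N powr 1 * real N powr (- 3 * (\<beta> + 1) - 1 / p')) \<le> A\<^sup>2 * m\<^sup>2"
      by (simp add: mult.assoc)
    then have "real N powr (2 * (\<beta> + 1)) * (\<kappa> * (real N powr 1 * real N powr (- 3 * (\<beta> + 1) - 1 / p'))) \<le> real N powr (2 * (\<beta> + 1)) * (A\<^sup>2 * m\<^sup>2)"
      by (intro mult_left_mono) auto
    moreover have "real N powr (2 * (\<beta> + 1)) * (real N powr 1 * real N powr (- 3 * (\<beta> + 1) - 1 / p')) = real N powr s"
      by (simp only: powr_add[symmetric]) (simp add: s_def algebra_simps)
    moreover have "real N powr (2 * (\<beta> + 1)) * m\<^sup>2 = M\<^sup>2"
    proof -
      have "real N powr (2 * (\<beta> + 1)) * (real N powr - (\<beta> + 1) * real N powr - (\<beta> + 1)) = 1"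
        using N by (simp only: powr_add[symmetric]) simp
      then show ?thesis by (simp add: m_def power2_eq_square mult_ac)
    qed
    ultimately show ?thesis by (simp add: mult_ac)
  qed
  have "filterlim (\<lambda>N. real N powr s) at_top sequentially"
    by (rule filterlim_compose[OF real_powr_at_top[OF s] filterlim_real_sequentially])
  then have "\<forall>\<^sub>F N in sequentially. (A\<^sup>2 * M\<^sup>2 + 1) / \<kappa> \<le> real N powr s"
    by (simp add: filterlim_at_top)
  then have "\<forall>\<^sub>F N in sequentially. False"
    using eventually_gt_at_top[of 0]
  proof eventually_elim
    fix N :: nat assume "(A\<^sup>2 * M\<^sup>2 + 1) / \<kappa> \<le> real N powr s" "0 < N"
    then show False using bound[of N] \<kappa>(1) by (simp add: field_simps)
  qed
  then show False by simp
qed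

end

theorem theorem1p2:
  fixes \<beta>\<^sub>1 \<beta>\<^sub>2 :: real
  assumes "-1 \<le> \<beta>\<^sub>1" and "\<beta>\<^sub>1 < \<beta>\<^sub>2" and "\<beta>\<^sub>2 \<le> 0"
  shows "\<exists>\<phi> :: complex ^ 3 \<Rightarrow> complex ^ 3.
           \<phi> \<in> polydisc_maps \<and>
           (\<forall>i. Ck_closed_polydisc 1 (\<lambda>z. \<phi> z $ i)) \<and>
           comp_op_continuous \<beta>\<^sub>2 \<phi> \<and>
           \<not> comp_op_continuous \<beta>\<^sub>1 \<phi>"
proof -
  obtain q where q: "- \<beta>\<^sub>2 < q" "q < - \<beta>\<^sub>1" using dense[of "- \<beta>\<^sub>2" "- \<beta>\<^sub>1"] assms by auto
  obtain q' where q': "q < q'" "q' < - \<beta>\<^sub>1" using dense[OF q(2)] by auto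
  \<comment> \<open>\<open>\<beta>\<^sub>2 \<le> 0\<close> gives q > 0, and
    \<open>- 1 \<le> \<beta>\<^sub>1\<close> gives q < 1, so that p = 1/q exceeds 1 as
    \<open>exists_power_contact\<close> demands.\<close>
  have pos: "0 < q" "q < 1" "0 < q'" using q q' assms by auto
  obtain U V :: "complex \<Rightarrow> complex" and c C :: real where
    "continuous_on (cball 0 1) V"
    "\<And>z. norm z \<le> 1 \<Longrightarrow> (U has_field_derivative V z) (at z within cball 0 1)"
    "\<And>z. norm z \<le> 1 \<Longrightarrow> 0 \<le> Re (U z)"
    "0 < c" "0 \<le> C"
    "\<And>\<zeta>. norm \<zeta> = 1 \<Longrightarrow> c * norm (\<zeta> - 1) powr (1 / q) \<le> Re (U \<zeta>)"
    "\<And>\<zeta>. norm \<zeta> = 1 \<Longrightarrow> Re (U \<zeta>) \<le> C * norm (\<zeta> - 1) powr (1 / q')"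
    by (rule exists_power_contact[of "1 / q" "1 / q'"]) (use pos q' in \<open>auto simp: field_simps\<close>)
  then interpret contact_map U V "1 / q" "1 / q'" c C
    using pos by unfold_locales auto
  have "comp_op_continuous \<beta>\<^sub>2 \<Phi>"
    by (rule comp_op_continuous_\<Phi>) (use assms q in auto)
  moreover have "\<not> comp_op_continuous \<beta>\<^sub>1 \<Phi>"
    by (rule not_comp_op_continuous_\<Phi>) (use assms q' in auto)
  ultimately show ?thesis
    using \<Phi>_polydisc_maps \<Phi>_C1 by blast
qed

end
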